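(* Let $n\ge 4$ be an even integer and let $K:\mathbb{R}^n\to\mathbb{R}$ be a smooth function satisfying the polynomially cone condition $\mathbf{(PCC)}$ and $x\cdot\nabla K(x)\le 0$ for all $x\in\mathbb{R}^n$. Then there is no function $u\in C^\infty(\mathbb{R}^n)$ satisfying $$(-\Delta)^{n/2}u=K(x)e^{nu}\quad\text{on }\mathbb{R}^n,$$ with $u\le C$ on $\mathbb{R}^n$ for some constant $C\in\mathbb{R}$, $$\Delta u(x)\to 0\quad\text{as }|x|\to\infty,$$ and such that $$\int_{\mathbb{R}^n}|K(x)|e^{nu(x)}\,\mathrm{d}x<\infty.$$
   Context: Polynomially cone condition $\mathbf{(PCC)}$: a continuous function $K:\mathbb{R}^n\to\mathbb{R}$ satisfies $\mathbf{(PCC)}$ if there exist $R_1>0$, $\theta>0$, $\gamma\ge n$, $c_1>0$, $c_2>0$ and a cone $C_\theta$ with angle $\theta$ and vertex at the origin (i.e. a solid circular cone $C_\theta=\{x\in\mathbb{R}^n: x\cdot e\ge |x|\cos\theta\}$ for some unit vector $e$ and $0<\theta\le\pi$) such that $|K(x)|\le c_2|x|^\gamma$ for all $|x|\ge R_1$, and $|K(x)|\ge c_1|x|^\gamma$ for all $x\in C_\theta\setminus B_{R_1}(0)$. Here $B_r(x_0)$ is the Euclidean ball of radius $r$ centered at $x_0$. $\Delta$ is the Euclidean Laplacian, $(-\Delta)^{n/2}$ is its (integer) iterated power, and $u$ is real-valued. *)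

theory Defs
  imports "HOL-Analysis.Analysis"
begin

definition partial_deriv :: "'a::euclidean_space \<Rightarrow> ('a \<Rightarrow> real) \<Rightarrow> 'a \<Rightarrow> real" where
  "partial_deriv b f x = frechet_derivative f (at x) b"

text \<open>Class \<open>C\<^sup>k\<close> on the whole space. As \<open>frechet_derivative\<close> is an arbitrary choice where no
  derivative exists, differentiability is required separately at each stage.\<close>

primrec C_k :: "nat \<Rightarrow> ('a::euclidean_space \<Rightarrow> real) \<Rightarrow> bool" where
  "C_k 0 f \<longleftrightarrow> continuous_on UNIV f"
| "C_k (Suc k) f \<longleftrightarrow>
     (\<forall>x. f differentiable (at x)) \<and> (\<forall>b\<in>Basis. C_k k (partial_deriv b f))"

definition smooth_fun :: "('a::euclidean_space \<Rightarrow> real) \<Rightarrow> bool" where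
  "smooth_fun f \<longleftrightarrow> (\<forall>k. C_k k f)"

definition gradient :: "('a::euclidean_space \<Rightarrow> real) \<Rightarrow> 'a \<Rightarrow> 'a" where
  "gradient f x = (\<Sum>b\<in>Basis. partial_deriv b f x *\<^sub>R b)"

definition laplacian :: "('a::euclidean_space \<Rightarrow> real) \<Rightarrow> 'a \<Rightarrow> real" where
  "laplacian f x = (\<Sum>b\<in>Basis. partial_deriv b (partial_deriv b f) x)"

definition neg_laplacian :: "('a::euclidean_space \<Rightarrow> real) \<Rightarrow> 'a \<Rightarrow> real" where
  "neg_laplacian f x = - laplacian f x"

definition solid_cone :: "'a::euclidean_space \<Rightarrow> real \<Rightarrow> 'a set" where
  "solid_cone e \<theta> = {x. x \<bullet> e \<ge> norm x * cos \<theta>}"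

text \<open>The exponent \<open>\<gamma>\<close> is real, hence \<open>powr\<close>; it is only used at \<open>norm x \<ge> R\<^sub>1 > 0\<close>.\<close>

definition PCC :: "('a::euclidean_space \<Rightarrow> real) \<Rightarrow> bool" where
  "PCC K \<longleftrightarrow> continuous_on UNIV K \<and>
     (\<exists>R\<^sub>1 \<theta> \<gamma> c\<^sub>1 c\<^sub>2 :: real. \<exists>e :: 'a.
        R\<^sub>1 > 0 \<and> 0 < \<theta> \<and> \<theta> \<le> pi \<and> \<gamma> \<ge> real DIM('a) \<and> c\<^sub>1 > 0 \<and> c\<^sub>2 > 0 \<and> norm e = 1 \<and>
        (\<forall>x. norm x \<ge> R\<^sub>1 \<longrightarrow> \<bar>K x\<bar> \<le> c\<^sub>2 * norm x powr \<gamma>) \<and>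
        (\<forall>x \<in> solid_cone e \<theta> - ball 0 R\<^sub>1. \<bar>K x\<bar> \<ge> c\<^sub>1 * norm x powr \<gamma>))"

end

theory Submission
  imports Defs
begin

text \<open>
  Let \<open>n = 2m\<close>, \<open>f = K e\<^sup>n\<^sup>u\<close> and let \<open>\<Lambda>\<close> be the integral of \<open>f\<close>. Averages of a smooth function with
  weight \<open>(1 - |y|\<^sup>2)\<^sup>j\<close> over the ball of radius \<open>\<surd>t\<close> have as \<open>t\<close>-derivative a multiple of the
  corresponding averages (with exponent \<open>j + 1\<close>) of the Laplacian. Iterating this \<open>m\<close> times turns the
  equation into an ordinary differential equation in \<open>t\<close> whose top order term is controlled by the
  \<open>L\<^sup>1\<close> norm of \<open>f\<close>; the hypothesis that the Laplacian of \<open>u\<close> vanishes at infinity excludes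
  polynomial solutions. Thus all lower order terms decay, the averages of \<open>u\<close> behave like
  \<open>- 2 c \<Lambda> log |x|\<close> for a constant \<open>c > 0\<close>, and the gradient of \<open>u\<close> is that of a logarithmic potential
  of \<open>f\<close>; no fundamental solution and no explicit value of \<open>c\<close> is needed.

  Testing the gradient formula with \<open>f\<close> times the field \<open>x\<close> (cut off at radius \<open>R\<close>) and symmetrizing gives
  \<open>- c \<Lambda>\<^sup>2\<close>, whereas integrating by parts gives \<open>- \<Lambda>\<close> plus a term of the sign of
  \<open>- x \<bullet> \<nabla>K\<close>. Hence \<open>\<Lambda> - c \<Lambda>\<^sup>2 > 0\<close>, strictly since \<open>K\<close> is not constant along rays. On the other hand,
  Jensen's inequality on balls of radius \<open>\<delta>k\<close> around \<open>k e\<close> inside the cone, together with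
  \<open>|K| \<ge> c\<^sub>1 |x|\<^sup>\<gamma>\<close> and \<open>\<gamma> \<ge> n\<close>, forces \<open>2 c \<Lambda> \<ge> (n + \<gamma>) / n \<ge> 2\<close>, a contradiction.
\<close>

section \<open>Weights and integration by parts\<close>

text \<open>The constant \<open>c\<close> is \<open>pot_coeff / bump_mass\<close>: the numerator
  collects the factors that appear when averages are differentiated, the denominator is the integral
  of the weight with exponent 2. Polynomial weights replace spherical means because they vanish on
  the unit sphere: integration by parts leaves no boundary terms, and a derivative can also be moved
  from \<open>f\<close> to the weight, with a gain of \<open>1 / sqrt t\<close>.

  The obstacle is to represent the gradient of \<open>u\<close> through a singular kernel while only
  the integral of the absolute value of \<open>f\<close> is controlled. Keeping \<open>t\<close>
  positive avoids it: Taylor extrapolation of the averages and a regularized potential have the same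
  derivative in \<open>t\<close> and the same limit 0 at infinity, hence agree. The upper bound on
  \<open>u\<close> enters here, as it makes averages of the gradient vanish at infinity. The limit
  \<open>t\<close> to 0 is taken only inside the symmetrized double integral, where a Lipschitz
  field compensates the singularity.

  For \<open>\<gamma> = n\<close> the cone yields only \<open>c * \<Lambda> \<ge> 1\<close>, so
  strictness in the dilation identity decides the contradiction.\<close>

lemma max0_power_has_derivative:
  fixes r :: real
  assumes "j \<ge> 1"
  shows "((\<lambda>r. max 0 r ^ Suc j) has_real_derivative real (Suc j) * max 0 r ^ j) (at r)"
proof -
  consider "r > 0" | "r < 0" | "r = 0" by linarith
  then show ?thesis
  proof cases
    case 1
    have "((\<lambda>r::real. r ^ Suc j) has_real_derivative real (Suc j) * r ^ j) (at r)"
      using DERIV_pow[of "Suc j" r] by simp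
    then have "((\<lambda>r::real. max 0 r ^ Suc j) has_real_derivative real (Suc j) * r ^ j) (at r)"
      by (rule has_field_derivative_transform_within_open[where S="{0<..}"]) (use 1 in auto)
    then show ?thesis using 1 by simp
  next
    case 2
    have "((\<lambda>r::real. 0) has_real_derivative 0) (at r)" by simp
    then have "((\<lambda>r::real. max 0 r ^ Suc j) has_real_derivative 0) (at r)"
      by (rule has_field_derivative_transform_within_open[where S="{..<0}"]) (use 2 in auto)
    moreover have "real (Suc j) * max 0 r ^ j = 0" using 2 assms by simp
    ultimately show ?thesis by metis
  next
    case 3
    have "((\<lambda>y::real. max 0 y ^ j) \<longlongrightarrow> max 0 0 ^ j) (at (0::real))"
      by (intro tendsto_intros)
    moreover have "max 0 0 ^ j = (0::real)" using assms by simp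
    ultimately have lim: "((\<lambda>y::real. max 0 y ^ j) \<longlongrightarrow> 0) (at 0)" by metis
    \<comment> \<open>At the kink the difference quotient is bounded by \<open>max 0 y ^ j\<close>,
      which tends to 0 because \<open>j \<ge> 1\<close>.\<close>
    have "((\<lambda>y::real. (max 0 y ^ Suc j - max 0 0 ^ Suc j) / (y - 0)) \<longlongrightarrow> 0) (at 0)"
    proof (rule Lim_null_comparison[OF _ lim])
      show "\<forall>\<^sub>F y in at 0. norm ((max 0 y ^ Suc j - max 0 0 ^ Suc j) / (y - 0)) \<le> max 0 y ^ j"
        unfolding eventually_at
        by (rule exI[of _ 1]) (auto simp: max_def)
    qed
    then have "((\<lambda>r::real. max 0 r ^ Suc j) has_real_derivative 0) (at r)"
      using 3 by (simp only: has_field_derivative_iff)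
    moreover have "real (Suc j) * max 0 r ^ j = 0" using 3 assms by simp
    ultimately show ?thesis by metis
  qed
qed

text \<open>For \<open>j \<ge> 1\<close> the weight is supported in the closed unit ball, and the
  gradient of \<open>bump (Suc j)\<close> is \<open>- 2 (j + 1) y\<close> times
  \<open>bump j\<close>, so the family is closed under integration by parts. Exponent 0 gives the
  constant 1, as \<open>0 ^ 0 = 1\<close>.\<close>

definition bump :: "nat \<Rightarrow> 'a::euclidean_space \<Rightarrow> real" where
  "bump j y = max 0 (1 - y \<bullet> y) ^ j"

lemma continuous_on_bump [continuous_intros]:
  "continuous_on S f \<Longrightarrow> continuous_on S (\<lambda>x. bump j (f x))"
  unfolding bump_def by (intro continuous_intros)

lemma bump_nonneg [simp]: "0 \<le> bump j y"
  by (simp add: bump_def)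

lemma bump_le_one: "bump j y \<le> 1"
  unfolding bump_def by (intro power_le_one) auto

lemma bump_zero_outside:
  assumes "j \<ge> 1" "norm y \<ge> 1"
  shows "bump j y = 0"
proof -
  have "y \<bullet> y \<ge> 1"
    using assms(2) by (metis dot_square_norm one_le_power)
  then show ?thesis using assms(1) by (simp add: bump_def max_def)
qed

lemma bump_pos: "norm y < 1 \<Longrightarrow> bump j y > 0"
  using abs_square_less_1[of "norm y"] by (simp add: bump_def dot_square_norm)

lemma bump_has_derivative:
  assumes "j \<ge> 1"
  shows "((\<lambda>s. bump (Suc j) (y + s *\<^sub>R b)) has_real_derivative
           - 2 * real (Suc j) * ((y + s *\<^sub>R b) \<bullet> b) * bump j (y + s *\<^sub>R b)) (at s)"
proof -
  have "((\<lambda>s. 1 - (y + s *\<^sub>R b) \<bullet> (y + s *\<^sub>R b)) has_real_derivative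
          - 2 * ((y + s *\<^sub>R b) \<bullet> b)) (at s)"
    unfolding inner_add_left inner_add_right inner_scaleR_left inner_scaleR_right
    by (auto intro!: derivative_eq_intros simp: inner_commute algebra_simps)
  from DERIV_chain2[OF max0_power_has_derivative[OF assms] this]
  show ?thesis unfolding bump_def by (simp add: algebra_simps)
qed

section \<open>Integration of continuous functions with compact support\<close>

lemma integrable_compact_support:
  fixes f :: "'a::euclidean_space \<Rightarrow> real"
  assumes "continuous_on UNIV f" and "\<And>y. y \<notin> cbox c d \<Longrightarrow> f y = 0"
  shows "integrable lborel f"
proof -
  have "integrable lborel (\<lambda>x. indicator (cbox c d) x *\<^sub>R f x)"
    by (rule borel_integrable_compact) (auto intro: continuous_on_subset[OF assms(1)])
  also have "(\<lambda>x. indicator (cbox c d) x *\<^sub>R f x) = f"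
    using assms(2) by (auto simp: indicator_def fun_eq_iff)
  finally show ?thesis .
qed

lemma integral_cbox_support:
  fixes f :: "'a::euclidean_space \<Rightarrow> real"
  assumes "continuous_on UNIV f" and "\<And>y. y \<notin> cbox c d \<Longrightarrow> f y = 0"
  shows "(\<integral>y. f y \<partial>lborel) = integral (cbox c d) f"
proof -
  have "(\<integral>y. f y \<partial>lborel) = integral UNIV f"
    using integral_lborel[OF integrable_compact_support[OF assms]] by simp
  also have "\<dots> = integral (cbox c d) f"
  proof -
    have "f = (\<lambda>x. if x \<in> cbox c d then f x else 0)" using assms(2) by auto
    then show ?thesis by (metis integral_restrict_UNIV)
  qed
  finally show ?thesis .
qed

text \<open>A common support box for all parameters reduces the claim to the Leibniz rule over a
  compact box, so no dominating function has to be found.\<close>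

lemma DERIV_integral_compact_support:
  fixes \<phi> :: "real \<Rightarrow> 'a::euclidean_space \<Rightarrow> real"
  assumes der: "\<And>s y. s \<in> {p<..<q} \<Longrightarrow> ((\<lambda>s. \<phi> s y) has_real_derivative \<phi>' s y) (at s)"
    and cont: "\<And>s. s \<in> {p<..<q} \<Longrightarrow> continuous_on UNIV (\<phi> s)"
    and cont': "continuous_on ({p<..<q} \<times> UNIV) (\<lambda>(s, y). \<phi>' s y)"
    and supp: "\<And>s y. s \<in> {p<..<q} \<Longrightarrow> y \<notin> cbox c d \<Longrightarrow> \<phi> s y = 0"
    and s0: "s0 \<in> {p<..<q}"
  shows "((\<lambda>s. \<integral>y. \<phi> s y \<partial>lborel) has_real_derivative (\<integral>y. \<phi>' s0 y \<partial>lborel)) (at s0)"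
proof -
  \<comment> \<open>Off the box the integrand vanishes for all parameters in the interval, hence so
    does its parameter derivative.\<close>
  have supp': "\<phi>' s y = 0" if "s \<in> {p<..<q}" "y \<notin> cbox c d" for s y
  proof -
    have "((\<lambda>s. 0) has_real_derivative \<phi>' s y) (at s)"
      by (rule has_field_derivative_transform_within_open[OF der[OF that(1)] open_greaterThanLessThan that(1)])
        (rule supp[OF _ that(2)])
    from DERIV_unique[OF this DERIV_const] show ?thesis .
  qed
  have c1: "continuous_on UNIV (\<phi>' s0)"
  proof -
    have "continuous_on UNIV (\<lambda>y::'a. (s0, y))" by (intro continuous_intros)
    then have "continuous_on UNIV (\<lambda>y. case (s0, y) of (s, y) \<Rightarrow> \<phi>' s y)"
      by (rule continuous_on_compose2[OF cont']) (use s0 in auto)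
    then show ?thesis by simp
  qed
  have "((\<lambda>s. integral (cbox c d) (\<phi> s)) has_field_derivative integral (cbox c d) (\<phi>' s0))
      (at s0 within {p<..<q})"
  proof (rule leibniz_rule_field_derivative[where fx=\<phi>'])
    show "continuous_on ({p<..<q} \<times> cbox c d) (\<lambda>(x, t). \<phi>' x t)"
      by (rule continuous_on_subset[OF cont']) auto
    show "\<phi> s integrable_on cbox c d" if "s \<in> {p<..<q}" for s
      by (rule integrable_continuous, rule continuous_on_subset[OF cont[OF that]]) simp
    show "((\<lambda>s. \<phi> s y) has_field_derivative \<phi>' s y) (at s within {p<..<q})" if "s \<in> {p<..<q}" for s y
      by (rule has_field_derivative_at_within[OF der[OF that]])
  qed (use s0 in auto)
  then have int: "((\<lambda>s. integral (cbox c d) (\<phi> s)) has_field_derivative integral (cbox c d) (\<phi>' s0)) (at s0)"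
    unfolding at_within_open[OF s0 open_greaterThanLessThan] .
  have eq: "(\<integral>y. \<phi> s y \<partial>lborel) = integral (cbox c d) (\<phi> s)" if "s \<in> {p<..<q}" for s
    by (rule integral_cbox_support[OF cont[OF that] supp[OF that]])
  have "((\<lambda>s. \<integral>y. \<phi> s y \<partial>lborel) has_field_derivative integral (cbox c d) (\<phi>' s0)) (at s0)"
    by (rule has_field_derivative_transform_within_open[OF int open_greaterThanLessThan s0])
      (rule eq[symmetric])
  moreover have "(\<integral>y. \<phi>' s0 y \<partial>lborel) = integral (cbox c d) (\<phi>' s0)"
    by (rule integral_cbox_support[OF c1 supp'[OF s0]])
  ultimately show ?thesis by simp
qed

lemma bounded_cbox_containing:
  fixes S :: "'a::euclidean_space set"
  assumes "bounded S"
  obtains c d where "S \<subseteq> cbox c d"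
  using bounded_subset_cbox_symmetric[OF assms] by blast

text \<open>The integral of the translate of \<open>\<phi>\<close> by \<open>s b\<close> does not
  depend on \<open>s\<close>; differentiating under the integral at \<open>s = 0\<close> gives the
  claim. All integrations by parts below rest on it.\<close>

lemma integral_directional_derivative_zero:
  fixes \<phi> :: "'a::euclidean_space \<Rightarrow> real"
  assumes der: "\<And>y. ((\<lambda>s. \<phi> (y + s *\<^sub>R b)) has_real_derivative \<phi>' y) (at 0)"
    and cont: "continuous_on UNIV \<phi>" and cont': "continuous_on UNIV \<phi>'"
    and supp: "\<And>y. norm y \<ge> r \<Longrightarrow> \<phi> y = 0"
  shows "(\<integral>y. \<phi>' y \<partial>lborel) = 0"
proof -
  \<comment> \<open>Shifting by \<open>s b\<close> with \<open>\<bar>s\<bar> < 1\<close> enlarges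
    the support by at most \<open>norm b\<close>.\<close>
  define R where "R = r + norm b"
  obtain c d :: 'a where cd: "cball 0 R \<subseteq> cbox c d"
    using bounded_cbox_containing[OF bounded_cball] by blast
  have der': "((\<lambda>s. \<phi> (y + s *\<^sub>R b)) has_real_derivative \<phi>' (y + s *\<^sub>R b)) (at s)" for s y
    using der[of "y + s *\<^sub>R b"] DERIV_shift[of "\<lambda>u. \<phi> (y + u *\<^sub>R b)" _ 0 s]
    by (simp add: algebra_simps)
  have "((\<lambda>s. \<integral>y. \<phi> (y + s *\<^sub>R b) \<partial>lborel) has_real_derivative (\<integral>y. \<phi>' (y + 0 *\<^sub>R b) \<partial>lborel)) (at 0)"
  proof (rule DERIV_integral_compact_support[where p="-1" and q=1 and c=c and d=d
        and \<phi>'="\<lambda>s y. \<phi>' (y + s *\<^sub>R b)"])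
    show "continuous_on UNIV (\<lambda>y. \<phi> (y + s *\<^sub>R b))" for s
      by (rule continuous_on_compose2[OF cont]) (auto intro!: continuous_intros)
    show "continuous_on ({- 1<..<1} \<times> UNIV) (\<lambda>(s, y). \<phi>' (y + s *\<^sub>R b))"
      unfolding case_prod_beta
      by (rule continuous_on_compose2[OF cont']) (auto intro!: continuous_intros)
    show "\<phi> (y + s *\<^sub>R b) = 0" if "s \<in> {-1<..<1}" "y \<notin> cbox c d" for s y
    proof (rule supp)
      have "norm y > R" using that cd by (meson mem_cball_0 not_le subsetD)
      moreover have "norm (s *\<^sub>R b) \<le> norm b"
        using that by (auto simp: mult_left_le_one_le abs_le_iff)
      moreover have "norm y \<le> norm (y + s *\<^sub>R b) + norm (s *\<^sub>R b)"
        by (metis add_diff_cancel_right' norm_triangle_ineq4)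
      ultimately show "r \<le> norm (y + s *\<^sub>R b)" by (simp add: R_def)
    qed
  qed (use der' in auto)
  moreover have "(\<integral>y. \<phi> (y + s *\<^sub>R b) \<partial>lborel) = (\<integral>y. \<phi> y \<partial>lborel)" for s
  proof -
    have m: "\<phi> \<in> borel_measurable borel" by (rule borel_measurable_continuous_onI[OF cont])
    have "(\<integral>y. \<phi> y \<partial>lborel) = (\<integral>y. \<phi> y \<partial>(distr lborel borel ((+) (s *\<^sub>R b))))"
      by (simp add: lborel_distr_plus)
    also have "\<dots> = (\<integral>y. \<phi> (y + s *\<^sub>R b) \<partial>lborel)"
      by (subst integral_distr) (use m in \<open>auto simp: add.commute\<close>)
    finally show ?thesis by simp
  qed
  ultimately have "((\<lambda>s. \<integral>y. \<phi> y \<partial>lborel) has_real_derivative (\<integral>y. \<phi>' y \<partial>lborel)) (at (0::real))"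
    by simp
  from DERIV_unique[OF this DERIV_const] show ?thesis .
qed

lemma integral_affine:
  fixes f :: "'a::euclidean_space \<Rightarrow> real"
  assumes "f \<in> borel_measurable borel" "c > 0"
  shows "(\<integral>y. f (x + c *\<^sub>R y) \<partial>lborel) = (\<integral>z. f z \<partial>lborel) / c ^ DIM('a)"
proof -
  have "(\<integral>z. f z \<partial>lborel) = (\<integral>z. f z \<partial>density (distr lborel borel (\<lambda>y. x + c *\<^sub>R y)) (\<lambda>_. \<bar>c\<bar> ^ DIM('a)))"
    using lborel_affine[of c x] assms(2) by simp
  also have "\<dots> = (\<integral>z. c ^ DIM('a) * f z \<partial>(distr lborel borel (\<lambda>y. x + c *\<^sub>R y)))"
    by (subst integral_density) (use assms in auto)
  also have "\<dots> = (\<integral>y. c ^ DIM('a) * f (x + c *\<^sub>R y) \<partial>lborel)"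
    by (subst integral_distr) (use assms in auto)
  also have "\<dots> = c ^ DIM('a) * (\<integral>y. f (x + c *\<^sub>R y) \<partial>lborel)" by simp
  finally show ?thesis using assms(2) by simp
qed

section \<open>Smooth functions\<close>

lemma smooth_fun_differentiable: "smooth_fun g \<Longrightarrow> g differentiable (at x)"
  unfolding smooth_fun_def by (metis C_k.simps(2))

lemma smooth_fun_partial_deriv: "smooth_fun g \<Longrightarrow> b \<in> Basis \<Longrightarrow> smooth_fun (partial_deriv b g)"
  unfolding smooth_fun_def by (metis C_k.simps(2))

lemma smooth_fun_continuous: "smooth_fun g \<Longrightarrow> continuous_on UNIV g"
  unfolding smooth_fun_def by (metis C_k.simps(1))

lemma smooth_fun_continuous_compose:
  "smooth_fun g \<Longrightarrow> continuous_on S h \<Longrightarrow> continuous_on S (\<lambda>x. g (h x))"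
  using smooth_fun_continuous continuous_on_compose2 by blast

lemma smooth_fun_has_derivative:
  assumes "smooth_fun g"
  shows "(g has_derivative (\<lambda>v. \<Sum>b\<in>Basis. (v \<bullet> b) * partial_deriv b g x)) (at x)"
proof -
  have d: "(g has_derivative frechet_derivative g (at x)) (at x)"
    using smooth_fun_differentiable[OF assms] by (simp add: frechet_derivative_works)
  then interpret linear "frechet_derivative g (at x)" by (rule has_derivative_linear)
  have "frechet_derivative g (at x) v = (\<Sum>b\<in>Basis. (v \<bullet> b) * partial_deriv b g x)" for v
  proof -
    have "frechet_derivative g (at x) v = frechet_derivative g (at x) (\<Sum>b\<in>Basis. (v \<bullet> b) *\<^sub>R b)"
      by (simp add: euclidean_representation)
    also have "\<dots> = (\<Sum>b\<in>Basis. (v \<bullet> b) * partial_deriv b g x)"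
      by (simp add: sum scale partial_deriv_def)
    finally show ?thesis .
  qed
  then show ?thesis using d by (metis (no_types, lifting) has_derivative_eq_rhs ext)
qed

lemma smooth_fun_DERIV_line:
  assumes "smooth_fun g"
  shows "((\<lambda>s. g (x + s *\<^sub>R v)) has_real_derivative
           (\<Sum>b\<in>Basis. (v \<bullet> b) * partial_deriv b g (x + s *\<^sub>R v))) (at s)"
proof -
  have "((\<lambda>s. x + s *\<^sub>R v) has_derivative (\<lambda>h. h *\<^sub>R v)) (at s)"
    by (auto intro!: derivative_eq_intros)
  from has_derivative_compose[OF this smooth_fun_has_derivative[OF assms]]
  show ?thesis unfolding has_field_derivative_def
    by (rule has_derivative_eq_rhs) (auto simp: fun_eq_iff sum_distrib_right sum_distrib_left mult_ac)
qed

lemma smooth_fun_DERIV_Basis: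
  assumes "smooth_fun g" "b \<in> Basis"
  shows "((\<lambda>s. g (x + s *\<^sub>R b)) has_real_derivative partial_deriv b g (x + s *\<^sub>R b)) (at s)"
proof -
  have "(\<Sum>c\<in>Basis. (b \<bullet> c) * partial_deriv c g y) = partial_deriv b g y" for y
  proof -
    have "(\<Sum>c\<in>Basis. (b \<bullet> c) * partial_deriv c g y) = (\<Sum>c\<in>Basis. if c = b then partial_deriv c g y else 0)"
      using assms(2) by (intro sum.cong) (auto simp: inner_Basis)
    then show ?thesis using assms(2) by simp
  qed
  then show ?thesis using smooth_fun_DERIV_line[OF assms(1), of x b s] by simp
qed

lemma partial_derivI:
  assumes "(g has_derivative g') (at x)"
  shows "partial_deriv b g x = g' b"
  unfolding partial_deriv_def using frechet_derivative_at[OF assms] by simp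

lemma C_k_add: "C_k k f \<Longrightarrow> C_k k g \<Longrightarrow> C_k k (\<lambda>x. f x + g x)"
proof (induction k arbitrary: f g)
  case 0
  then show ?case by (auto intro: continuous_intros)
next
  case (Suc k)
  have "partial_deriv b (\<lambda>x. f x + g x) = (\<lambda>x. partial_deriv b f x + partial_deriv b g x)" for b
  proof
    fix x
    have "(f has_derivative frechet_derivative f (at x)) (at x)"
         "(g has_derivative frechet_derivative g (at x)) (at x)"
      using Suc.prems by (auto simp: frechet_derivative_works)
    from partial_derivI[OF has_derivative_add[OF this]]
    show "partial_deriv b (\<lambda>x. f x + g x) x = partial_deriv b f x + partial_deriv b g x"
      by (simp add: partial_deriv_def)
  qed
  then show ?case using Suc by (auto intro: differentiable_add)
qed

lemma C_k_minus: "C_k k f \<Longrightarrow> C_k k (\<lambda>x. - f x)"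
proof (induction k arbitrary: f)
  case 0
  then show ?case by (auto intro: continuous_intros)
next
  case (Suc k)
  have "partial_deriv b (\<lambda>x. - f x) = (\<lambda>x. - partial_deriv b f x)" for b
  proof
    fix x
    have "(f has_derivative frechet_derivative f (at x)) (at x)"
      using Suc.prems by (auto simp: frechet_derivative_works)
    from partial_derivI[OF has_derivative_minus[OF this]]
    show "partial_deriv b (\<lambda>x. - f x) x = - partial_deriv b f x"
      by (simp add: partial_deriv_def)
  qed
  then show ?case using Suc by (auto intro: differentiable_minus)
qed

lemma C_k_const: "C_k k (\<lambda>x. c)"
proof (induction k arbitrary: c)
  case (Suc k)
  have "partial_deriv b (\<lambda>x::'a. c) = (\<lambda>x. 0)" for b
    by (auto simp: partial_derivI[OF has_derivative_const])
  then show ?case using Suc by auto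
qed auto

lemma smooth_fun_sum:
  "finite A \<Longrightarrow> (\<And>a. a \<in> A \<Longrightarrow> smooth_fun (f a)) \<Longrightarrow> smooth_fun (\<lambda>x. \<Sum>a\<in>A. f a x)"
proof (induction A rule: finite_induct)
  case empty
  then show ?case by (simp add: smooth_fun_def C_k_const)
next
  case (insert a A)
  then have "smooth_fun (f a)" "smooth_fun (\<lambda>x. \<Sum>a\<in>A. f a x)" by auto
  then have "smooth_fun (\<lambda>x. f a x + (\<Sum>a\<in>A. f a x))"
    unfolding smooth_fun_def by (auto intro: C_k_add)
  then show ?case using insert.hyps by simp
qed

lemma smooth_fun_minus: "smooth_fun f \<Longrightarrow> smooth_fun (\<lambda>x. - f x)"
  unfolding smooth_fun_def by (auto intro: C_k_minus)

lemma smooth_fun_laplacian: "smooth_fun g \<Longrightarrow> smooth_fun (laplacian g)"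
  unfolding laplacian_def[abs_def] by (intro smooth_fun_sum smooth_fun_partial_deriv) auto

lemma smooth_fun_neg_laplacian: "smooth_fun g \<Longrightarrow> smooth_fun (neg_laplacian g)"
  unfolding neg_laplacian_def[abs_def] by (intro smooth_fun_minus smooth_fun_laplacian)

lemma smooth_fun_neg_laplacian_power: "smooth_fun g \<Longrightarrow> smooth_fun ((neg_laplacian ^^ k) g)"
  by (induction k) (auto intro: smooth_fun_neg_laplacian)

text \<open>The mean value theorem is applied to the increment in direction \<open>c\<close> as a
  function of the \<open>b\<close>-coordinate, then to the \<open>b\<close>-derivative in direction
  \<open>c\<close>. The second difference is symmetric in \<open>b\<close> and \<open>c\<close>,
  which is what yields equality of mixed derivatives.\<close>

lemma second_difference_mean_value:
  fixes g :: "'a::euclidean_space \<Rightarrow> real"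
  assumes g: "smooth_fun g" and b: "b \<in> Basis" and c: "c \<in> Basis" and s: "s > 0"
  shows "\<exists>p. dist p x \<le> 2 * s \<and>
     g (x + s *\<^sub>R b + s *\<^sub>R c) - g (x + s *\<^sub>R b) - g (x + s *\<^sub>R c) + g x
       = s\<^sup>2 * partial_deriv c (partial_deriv b g) p"
proof -
  have "\<exists>\<xi>>0. \<xi> < s \<and>
      (g ((x + s *\<^sub>R c) + s *\<^sub>R b) - g (x + s *\<^sub>R b)) - (g ((x + s *\<^sub>R c) + 0 *\<^sub>R b) - g (x + 0 *\<^sub>R b))
      = (s - 0) * (partial_deriv b g ((x + s *\<^sub>R c) + \<xi> *\<^sub>R b) - partial_deriv b g (x + \<xi> *\<^sub>R b))"
    using s by (rule MVT2) (intro DERIV_diff smooth_fun_DERIV_Basis g b)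
  then obtain \<xi> where \<xi>: "0 < \<xi>" "\<xi> < s" and
    e1: "(g ((x + s *\<^sub>R c) + s *\<^sub>R b) - g (x + s *\<^sub>R b)) - (g (x + s *\<^sub>R c) - g x)
      = s * (partial_deriv b g ((x + s *\<^sub>R c) + \<xi> *\<^sub>R b) - partial_deriv b g (x + \<xi> *\<^sub>R b))"
    by auto
  have "\<exists>\<eta>>0. \<eta> < s \<and>
      partial_deriv b g ((x + \<xi> *\<^sub>R b) + s *\<^sub>R c) - partial_deriv b g ((x + \<xi> *\<^sub>R b) + 0 *\<^sub>R c)
      = (s - 0) * (partial_deriv c (partial_deriv b g) ((x + \<xi> *\<^sub>R b) + \<eta> *\<^sub>R c))"
    using s by (rule MVT2) (intro DERIV_diff smooth_fun_DERIV_Basis smooth_fun_partial_deriv g b c)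
  then obtain \<eta> where \<eta>: "0 < \<eta>" "\<eta> < s" and
    e2: "partial_deriv b g ((x + \<xi> *\<^sub>R b) + s *\<^sub>R c) - partial_deriv b g (x + \<xi> *\<^sub>R b)
      = s * (partial_deriv c (partial_deriv b g) ((x + \<xi> *\<^sub>R b) + \<eta> *\<^sub>R c))"
    by auto
  let ?p = "(x + \<xi> *\<^sub>R b) + \<eta> *\<^sub>R c"
  have "dist ?p x = norm (\<xi> *\<^sub>R b + \<eta> *\<^sub>R c)" by (simp add: dist_norm)
  also have "\<dots> \<le> \<xi> + \<eta>"
    using norm_triangle_ineq[of "\<xi> *\<^sub>R b" "\<eta> *\<^sub>R c"] b c \<xi> \<eta> by simp
  finally have "dist ?p x \<le> 2 * s" using \<xi> \<eta> by simp
  moreover have "g (x + s *\<^sub>R b + s *\<^sub>R c) - g (x + s *\<^sub>R b) - g (x + s *\<^sub>R c) + g x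
       = s\<^sup>2 * partial_deriv c (partial_deriv b g) ?p"
  proof -
    have c1: "x + s *\<^sub>R b + s *\<^sub>R c = (x + s *\<^sub>R c) + s *\<^sub>R b"
      and c2: "(x + \<xi> *\<^sub>R b) + s *\<^sub>R c = (x + s *\<^sub>R c) + \<xi> *\<^sub>R b" by (simp_all add: algebra_simps)
    show ?thesis using e1 e2 unfolding c1 c2 by (simp add: power2_eq_square)
  qed
  ultimately show ?thesis by blast
qed

text \<open>Reading one second difference in both orders produces two points near \<open>x\<close>
  at which the two mixed derivatives agree; shrinking the square moves both points to
  \<open>x\<close>, and continuity finishes.\<close>

lemma partial_deriv_commute:
  fixes g :: "'a::euclidean_space \<Rightarrow> real"
  assumes g: "smooth_fun g" and b: "b \<in> Basis" and c: "c \<in> Basis"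
  shows "partial_deriv c (partial_deriv b g) = partial_deriv b (partial_deriv c g)"
proof
  fix x
  define s where "s k = 1 / real (Suc k)" for k
  have s: "s k > 0" for k by (simp add: s_def)
  have "\<forall>k. \<exists>p. dist p x \<le> 2 * s k \<and>
     g (x + s k *\<^sub>R b + s k *\<^sub>R c) - g (x + s k *\<^sub>R b) - g (x + s k *\<^sub>R c) + g x
       = (s k)\<^sup>2 * partial_deriv c (partial_deriv b g) p"
    using second_difference_mean_value[OF g b c s] by blast
  then obtain p where p: "\<And>k. dist (p k) x \<le> 2 * s k"
     "\<And>k. g (x + s k *\<^sub>R b + s k *\<^sub>R c) - g (x + s k *\<^sub>R b) - g (x + s k *\<^sub>R c) + g x
       = (s k)\<^sup>2 * partial_deriv c (partial_deriv b g) (p k)" by metis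
  have "\<forall>k. \<exists>p. dist p x \<le> 2 * s k \<and>
     g (x + s k *\<^sub>R c + s k *\<^sub>R b) - g (x + s k *\<^sub>R c) - g (x + s k *\<^sub>R b) + g x
       = (s k)\<^sup>2 * partial_deriv b (partial_deriv c g) p"
    using second_difference_mean_value[OF g c b s] by blast
  then obtain q where q: "\<And>k. dist (q k) x \<le> 2 * s k"
     "\<And>k. g (x + s k *\<^sub>R c + s k *\<^sub>R b) - g (x + s k *\<^sub>R c) - g (x + s k *\<^sub>R b) + g x
       = (s k)\<^sup>2 * partial_deriv b (partial_deriv c g) (q k)" by metis
  have eq: "partial_deriv c (partial_deriv b g) (p k) = partial_deriv b (partial_deriv c g) (q k)" for k
  proof -
    have "x + s k *\<^sub>R c + s k *\<^sub>R b = x + s k *\<^sub>R b + s k *\<^sub>R c" by (simp add: algebra_simps)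
    then have "(s k)\<^sup>2 * partial_deriv c (partial_deriv b g) (p k) = (s k)\<^sup>2 * partial_deriv b (partial_deriv c g) (q k)"
      using p(2)[of k] q(2)[of k] by (simp only:)
    then show ?thesis using s[of k] by simp
  qed
  have s0: "(\<lambda>k. 2 * s k) \<longlonglongrightarrow> 2 * 0"
    unfolding s_def by (intro tendsto_intros LIMSEQ_Suc lim_1_over_n)
  have "p \<longlonglongrightarrow> x" "q \<longlonglongrightarrow> x"
    by (rule tendsto_dist_iff[THEN iffD2], rule tendsto_sandwich[OF _ _ tendsto_const, where h="\<lambda>k. 2 * s k"],
        use p(1) q(1) s0 in auto)+
  then have "(\<lambda>k. partial_deriv c (partial_deriv b g) (p k)) \<longlonglongrightarrow> partial_deriv c (partial_deriv b g) x"
    and "(\<lambda>k. partial_deriv b (partial_deriv c g) (q k)) \<longlonglongrightarrow> partial_deriv b (partial_deriv c g) x"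
    using smooth_fun_continuous[OF smooth_fun_partial_deriv[OF smooth_fun_partial_deriv[OF g b] c]]
      smooth_fun_continuous[OF smooth_fun_partial_deriv[OF smooth_fun_partial_deriv[OF g c] b]]
    by (auto simp: continuous_on_eq_continuous_at isCont_tendsto_compose)
  then show "partial_deriv c (partial_deriv b g) x = partial_deriv b (partial_deriv c g) x"
    unfolding eq by (rule LIMSEQ_unique)
qed

lemma neg_laplacian_partial_deriv:
  fixes g :: "'a::euclidean_space \<Rightarrow> real"
  assumes g: "smooth_fun g" and c: "c \<in> Basis"
  shows "neg_laplacian (partial_deriv c g) = partial_deriv c (neg_laplacian g)"
proof
  fix x
  have "((\<lambda>x. - (\<Sum>b\<in>Basis. partial_deriv b (partial_deriv b g) x)) has_derivative
     (\<lambda>v. - (\<Sum>b\<in>Basis. \<Sum>d\<in>Basis. (v \<bullet> d) * partial_deriv d (partial_deriv b (partial_deriv b g)) x))) (at x)"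
    by (intro has_derivative_minus has_derivative_sum smooth_fun_has_derivative smooth_fun_partial_deriv g)
  from partial_derivI[OF this, of c]
  have "partial_deriv c (neg_laplacian g) x
     = - (\<Sum>b\<in>Basis. \<Sum>d\<in>Basis. (c \<bullet> d) * partial_deriv d (partial_deriv b (partial_deriv b g)) x)"
    by (simp add: neg_laplacian_def[abs_def] laplacian_def)
  also have "\<dots> = - (\<Sum>b\<in>Basis. partial_deriv c (partial_deriv b (partial_deriv b g)) x)"
  proof -
    have "(\<Sum>d\<in>Basis. (c \<bullet> d) * h d) = h c" for h :: "'a \<Rightarrow> real"
    proof -
      have "(\<Sum>d\<in>Basis. (c \<bullet> d) * h d) = (\<Sum>d\<in>Basis. if d = c then h d else 0)"
        using c by (intro sum.cong) (auto simp: inner_Basis)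
      then show ?thesis using c by simp
    qed
    then show ?thesis by simp
  qed
  also have "\<dots> = - (\<Sum>b\<in>Basis. partial_deriv b (partial_deriv b (partial_deriv c g)) x)"
    using g c by (simp add: partial_deriv_commute[of _ _ c] smooth_fun_partial_deriv)
  finally show "neg_laplacian (partial_deriv c g) x = partial_deriv c (neg_laplacian g) x"
    by (simp add: neg_laplacian_def laplacian_def)
qed

text \<open>Used to pass from the equation for \<open>u\<close> to one for each partial derivative
  of \<open>u\<close>, whose right-hand side is the partial derivative of \<open>f\<close>.\<close>

lemma neg_laplacian_power_partial_deriv:
  assumes "smooth_fun g" and "c \<in> Basis"
  shows "(neg_laplacian ^^ k) (partial_deriv c g) = partial_deriv c ((neg_laplacian ^^ k) g)"
  using assms by (induction k) (auto simp: neg_laplacian_partial_deriv smooth_fun_neg_laplacian_power)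

section \<open>Weighted averages over balls\<close>

text \<open>The parameter \<open>t\<close> is the squared radius, since then the derivative of an
  average is a constant multiple of another average, with no power of the radius. The weight is not
  normalized, so \<open>t = 0\<close> gives the value at the center times the integral of the
  weight.\<close>

definition bump_avg :: "nat \<Rightarrow> ('a::euclidean_space \<Rightarrow> real) \<Rightarrow> 'a \<Rightarrow> real \<Rightarrow> real" where
  "bump_avg j g x t = (\<integral>y. bump j y * g (x + sqrt t *\<^sub>R y) \<partial>lborel)"

lemma unit_ball_cbox:
  obtains c d :: "'a::euclidean_space" where "\<And>y::'a. y \<notin> cbox c d \<Longrightarrow> norm y \<ge> 1"
proof -
  obtain c d :: 'a where "cball 0 1 \<subseteq> cbox c d"
    using bounded_cbox_containing[OF bounded_cball] by blast
  then have "norm y \<ge> 1" if "y \<notin> cbox c d" for y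
    using that by (meson linear mem_cball_0 subsetD)
  then show ?thesis using that by blast
qed

lemma integrable_bump_mult:
  fixes h :: "'a::euclidean_space \<Rightarrow> real"
  assumes "j \<ge> 1" "continuous_on UNIV h"
  shows "integrable lborel (\<lambda>y. bump j y * h y)"
proof -
  obtain c d :: 'a where cd: "\<And>y. y \<notin> cbox c d \<Longrightarrow> norm y \<ge> 1" by (rule unit_ball_cbox) blast
  show ?thesis
  proof (rule integrable_compact_support)
    show "continuous_on UNIV (\<lambda>y. bump j y * h y)"
      by (intro continuous_intros assms)
    show "bump j y * h y = 0" if "y \<notin> cbox c d" for y
      using bump_zero_outside[OF assms(1) cd[OF that]] by simp
  qed
qed

lemma integrable_bump: "j \<ge> 1 \<Longrightarrow> integrable lborel (bump j :: 'a::euclidean_space \<Rightarrow> real)"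
  using integrable_bump_mult[of j "\<lambda>_. 1"] by (simp add: continuous_on_const)

lemma continuous_on_affine_compose:
  fixes g :: "'a::euclidean_space \<Rightarrow> real"
  assumes "continuous_on UNIV g"
  shows "continuous_on S (\<lambda>y. g (x + c *\<^sub>R y))"
  by (rule continuous_on_compose2[OF assms]) (auto intro!: continuous_intros)

lemma integrable_bump_affine:
  fixes g :: "'a::euclidean_space \<Rightarrow> real"
  assumes "j \<ge> 1" "continuous_on UNIV g"
  shows "integrable lborel (\<lambda>y. bump j y * g (x + c *\<^sub>R y))"
  by (rule integrable_bump_mult[OF assms(1) continuous_on_affine_compose[OF assms(2)]])

lemma integral_pos_continuous:
  fixes h :: "'a::euclidean_space \<Rightarrow> real"
  assumes int: "integrable lborel h" and cont: "continuous_on UNIV h"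
    and nonneg: "\<And>x. h x \<ge> 0" and pos: "h x0 > 0"
  shows "(\<integral>x. h x \<partial>lborel) > 0"
proof -
  have "isCont h x0" using cont by (simp add: continuous_on_eq_continuous_at)
  then have "\<forall>\<^sub>F x in at x0. h x0 / 2 < h x"
    using pos by (intro order_tendstoD(1)[of h "h x0"]) (auto simp: isCont_def)
  then obtain d where d: "d > 0" "\<And>x. dist x x0 < d \<Longrightarrow> h x0 / 2 \<le> h x"
    unfolding eventually_at using pos by (metis UNIV_I field_sum_of_halves less_add_same_cancel1 less_eq_real_def half_gt_zero)
  have "(\<integral>x. h x0 / 2 * indicator (ball x0 d) x \<partial>lborel) \<le> (\<integral>x. h x \<partial>lborel)"
  proof (rule integral_mono[OF _ int])
    show "integrable lborel (\<lambda>x. h x0 / 2 * indicator (ball x0 d) x)"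
      by (intro integrable_mult_right integrable_real_indicator emeasure_bounded_finite) auto
    show "h x0 / 2 * indicator (ball x0 d) x \<le> h x" for x
      using d(2)[of x] nonneg[of x] by (simp add: indicator_def dist_commute)
  qed
  moreover have "(\<integral>x. h x0 / 2 * indicator (ball x0 d) x \<partial>lborel) > 0"
    using pos d(1) by (simp add: content_ball_pos)
  ultimately show ?thesis by linarith
qed

lemma bump_integral_pos:
  assumes "j \<ge> 1"
  shows "(\<integral>y. bump j y \<partial>(lborel :: 'a::euclidean_space measure)) > 0"
proof (rule integral_pos_continuous[OF integrable_bump[OF assms], of 0])
  show "continuous_on UNIV (bump j :: 'a \<Rightarrow> real)"
    using continuous_on_bump[OF continuous_on_id, of UNIV j] by simp
qed (auto intro: bump_pos)

text \<open>The gradient of \<open>bump (Suc j)\<close> is \<open>- 2 (j + 1) y\<close> times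
  \<open>bump j\<close>, and the chain rule contributes \<open>c\<close>. Read from left to right
  the identity absorbs a factor \<open>y \<bullet> b\<close>; read from right to left it removes a
  derivative from \<open>h\<close>.\<close>

lemma bump_integral_by_parts:
  fixes h :: "'a::euclidean_space \<Rightarrow> real"
  assumes j: "j \<ge> 1" and h: "smooth_fun h" and b: "b \<in> Basis"
  shows "2 * real (Suc j) * (\<integral>y. bump j y * ((y \<bullet> b) * h (x + c *\<^sub>R y)) \<partial>lborel)
       = c * (\<integral>y. bump (Suc j) y * partial_deriv b h (x + c *\<^sub>R y) \<partial>lborel)"
proof -
  have c1: "continuous_on UNIV (\<lambda>y. (y \<bullet> b) * h (x + c *\<^sub>R y))"
    and c2: "continuous_on UNIV (\<lambda>y. partial_deriv b h (x + c *\<^sub>R y))"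
    by (intro continuous_intros continuous_on_affine_compose smooth_fun_continuous h
        smooth_fun_partial_deriv b)+
  let ?d = "\<lambda>y. c * (bump (Suc j) y * partial_deriv b h (x + c *\<^sub>R y))
     - 2 * real (Suc j) * (bump j y * ((y \<bullet> b) * h (x + c *\<^sub>R y)))"
  have "(\<integral>y. ?d y \<partial>lborel) = 0"
  proof (rule integral_directional_derivative_zero[where b=b and r=1
        and \<phi>="\<lambda>y. bump (Suc j) y * h (x + c *\<^sub>R y)"])
    fix y :: 'a
    have "((\<lambda>s. bump (Suc j) (y + s *\<^sub>R b)) has_real_derivative
           - 2 * real (Suc j) * (y \<bullet> b) * bump j y) (at 0)"
      using bump_has_derivative[OF j, of y b 0] by simp
    moreover have "((\<lambda>s. h (x + c *\<^sub>R (y + s *\<^sub>R b))) has_real_derivative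
         c * partial_deriv b h (x + c *\<^sub>R y)) (at 0)"
    proof -
      have "((\<lambda>s. c * s) has_real_derivative c) (at 0)" by (auto intro!: derivative_eq_intros)
      from DERIV_chain2[OF _ this, of "\<lambda>s. h ((x + c *\<^sub>R y) + s *\<^sub>R b)"]
        smooth_fun_DERIV_Basis[OF h b, of "x + c *\<^sub>R y" 0]
      have "((\<lambda>s. h ((x + c *\<^sub>R y) + (c * s) *\<^sub>R b)) has_real_derivative
         partial_deriv b h (x + c *\<^sub>R y) * c) (at 0)" by simp
      then show ?thesis by (simp add: algebra_simps)
    qed
    ultimately show "((\<lambda>s. bump (Suc j) (y + s *\<^sub>R b) * h (x + c *\<^sub>R (y + s *\<^sub>R b)))
        has_real_derivative ?d y) (at 0)"
      by (rule DERIV_cong[OF DERIV_mult]) (simp add: algebra_simps)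
    show "bump (Suc j) y * h (x + c *\<^sub>R y) = 0" if "norm y \<ge> 1"
      using that by (simp add: bump_zero_outside)
  next
    show "continuous_on UNIV (\<lambda>y. bump (Suc j) y * h (x + c *\<^sub>R y))"
      by (intro continuous_intros continuous_on_affine_compose smooth_fun_continuous h)
    show "continuous_on UNIV ?d"
      by (intro continuous_intros c1 c2)
  qed
  then show ?thesis
    using integrable_bump_mult[OF j c1] integrable_bump_mult[OF _ c2, of "Suc j"] by simp
qed

text \<open>Differentiating \<open>sqrt t\<close> gives the radial derivative of \<open>g\<close>
  with factor \<open>1 / (2 sqrt t)\<close>; integrating by parts turns it into the Laplacian with
  factor \<open>sqrt t / (2 (j + 1))\<close>. The square roots cancel and leave
  \<open>1 / (4 (j + 1))\<close>.\<close>

lemma DERIV_bump_avg: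
  fixes g :: "'a::euclidean_space \<Rightarrow> real"
  assumes j: "j \<ge> 1" and g: "smooth_fun g" and t: "t > 0"
  shows "(bump_avg j g x has_real_derivative
           - (bump_avg (Suc j) (neg_laplacian g) x t / (4 * real (Suc j)))) (at t)"
proof -
  obtain c d :: 'a where cd: "\<And>y. y \<notin> cbox c d \<Longrightarrow> norm y \<ge> 1" by (rule unit_ball_cbox) blast
  let ?\<phi>' = "\<lambda>s y. bump j y * ((\<Sum>b\<in>Basis. (y \<bullet> b) * partial_deriv b g (x + sqrt s *\<^sub>R y)) * (inverse (sqrt s) / 2))"
  have "((\<lambda>s. \<integral>y. bump j y * g (x + sqrt s *\<^sub>R y) \<partial>lborel) has_real_derivative
      (\<integral>y. ?\<phi>' t y \<partial>lborel)) (at t)"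
  proof (rule DERIV_integral_compact_support[where p=0 and q="2*t" and c=c and d=d and \<phi>'="?\<phi>'"])
    show "((\<lambda>s. bump j y * g (x + sqrt s *\<^sub>R y)) has_real_derivative ?\<phi>' s y) (at s)"
      if "s \<in> {0<..<2*t}" for s y
      by (intro DERIV_cmult DERIV_chain2[OF smooth_fun_DERIV_line[OF g]] DERIV_real_sqrt) (use that in auto)
    show "continuous_on UNIV (\<lambda>y. bump j y * g (x + sqrt s *\<^sub>R y))" for s
      by (intro continuous_intros continuous_on_affine_compose smooth_fun_continuous g)
    show "continuous_on ({0<..<2*t} \<times> UNIV) (\<lambda>(s, y). ?\<phi>' s y)"
      unfolding case_prod_beta
      by (intro continuous_intros smooth_fun_continuous_compose[OF smooth_fun_partial_deriv[OF g]]) auto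
    show "bump j y * g (x + sqrt s *\<^sub>R y) = 0" if "y \<notin> cbox c d" for s y
      using bump_zero_outside[OF j cd[OF that]] by simp
  qed (use t in auto)
  moreover have "(\<integral>y. ?\<phi>' t y \<partial>lborel) = - (bump_avg (Suc j) (neg_laplacian g) x t / (4 * real (Suc j)))"
  proof -
    have i1: "integrable lborel (\<lambda>y. bump j y * ((y \<bullet> b) * partial_deriv b g (x + sqrt t *\<^sub>R y)))"
      if "b \<in> Basis" for b
      by (intro integrable_bump_mult j continuous_intros continuous_on_affine_compose
          smooth_fun_continuous smooth_fun_partial_deriv g that)
    have i2: "integrable lborel (\<lambda>y. bump (Suc j) y * partial_deriv b (partial_deriv b g) (x + sqrt t *\<^sub>R y))"
      if "b \<in> Basis" for b
      by (intro integrable_bump_mult continuous_on_affine_compose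
          smooth_fun_continuous smooth_fun_partial_deriv g that) simp
    have "(\<integral>y. ?\<phi>' t y \<partial>lborel) = (\<integral>y. (inverse (sqrt t) / 2) *
        (\<Sum>b\<in>Basis. bump j y * ((y \<bullet> b) * partial_deriv b g (x + sqrt t *\<^sub>R y))) \<partial>lborel)"
      by (intro Bochner_Integration.integral_cong refl) (simp add: sum_distrib_left mult_ac)
    also have "\<dots> = (inverse (sqrt t) / 2) *
        (\<Sum>b\<in>Basis. (\<integral>y. bump j y * ((y \<bullet> b) * partial_deriv b g (x + sqrt t *\<^sub>R y)) \<partial>lborel))"
      using i1 by simp
    also have "\<dots> = (inverse (sqrt t) / 2) * (\<Sum>b\<in>Basis. sqrt t / (2 * real (Suc j)) *
        (\<integral>y. bump (Suc j) y * partial_deriv b (partial_deriv b g) (x + sqrt t *\<^sub>R y) \<partial>lborel))"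
    proof -
      have "(\<integral>y. bump j y * ((y \<bullet> b) * partial_deriv b g (x + sqrt t *\<^sub>R y)) \<partial>lborel)
          = sqrt t / (2 * real (Suc j)) *
            (\<integral>y. bump (Suc j) y * partial_deriv b (partial_deriv b g) (x + sqrt t *\<^sub>R y) \<partial>lborel)"
        if "b \<in> Basis" for b
        using bump_integral_by_parts[OF j smooth_fun_partial_deriv[OF g that] that, of x "sqrt t"]
        by (simp add: field_simps)
      then show ?thesis by simp
    qed
    also have "\<dots> = (1 / (4 * real (Suc j))) * (\<Sum>b\<in>Basis.
        (\<integral>y. bump (Suc j) y * partial_deriv b (partial_deriv b g) (x + sqrt t *\<^sub>R y) \<partial>lborel))"
      using t unfolding sum_distrib_left[symmetric] by (simp add: field_simps)
    also have "(\<Sum>b\<in>Basis. (\<integral>y. bump (Suc j) y * partial_deriv b (partial_deriv b g) (x + sqrt t *\<^sub>R y) \<partial>lborel))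
        = (\<integral>y. (\<Sum>b\<in>Basis. bump (Suc j) y * partial_deriv b (partial_deriv b g) (x + sqrt t *\<^sub>R y)) \<partial>lborel)"
      using i2 by simp
    also have "\<dots> = - bump_avg (Suc j) (neg_laplacian g) x t"
      by (simp add: bump_avg_def neg_laplacian_def laplacian_def sum_distrib_left)
    also have "(1 / (4 * real (Suc j))) * - bump_avg (Suc j) (neg_laplacian g) x t
        = - (bump_avg (Suc j) (neg_laplacian g) x t / (4 * real (Suc j)))" by simp
    finally show ?thesis .
  qed
  ultimately show ?thesis unfolding bump_avg_def[abs_def] by metis
qed

lemma continuous_on_bump_avg:
  fixes g :: "'a::euclidean_space \<Rightarrow> real"
  assumes j: "j \<ge> 1" and g: "continuous_on UNIV g"
  shows "continuous_on S (\<lambda>p. bump_avg j g (fst p) (snd p))"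
proof -
  obtain c d :: 'a where cd: "\<And>y. y \<notin> cbox c d \<Longrightarrow> norm y \<ge> 1" by (rule unit_ball_cbox) blast
  have "bump_avg j g (fst p) (snd p) = integral (cbox c d) (\<lambda>y. bump j y * g (fst p + sqrt (snd p) *\<^sub>R y))" for p
    unfolding bump_avg_def
    by (rule integral_cbox_support)
      (use bump_zero_outside[OF j cd] in \<open>auto intro!: continuous_intros continuous_on_affine_compose g\<close>)
  moreover have "continuous_on S (\<lambda>p. integral (cbox c d) (\<lambda>y. bump j y * g (fst p + sqrt (snd p) *\<^sub>R y)))"
    by (rule integral_continuous_on_param)
      (auto simp: case_prod_beta intro!: continuous_intros continuous_on_compose2[OF g])
  ultimately show ?thesis by simp
qed

lemma bump_avg_at_0:
  fixes x :: "'a::euclidean_space"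
  shows "bump_avg j g x 0 = (\<integral>y. bump j (y :: 'a) \<partial>lborel) * g x"
  by (simp add: bump_avg_def)

text \<open>Substituting \<open>z = x + sqrt t y\<close> costs only the volume factor, so the bound
  is uniform in the center \<open>x\<close>. The general \<open>w\<close> covers both a weight and a
  weight times a coordinate.\<close>

lemma integral_affine_le:
  fixes f w :: "'a::euclidean_space \<Rightarrow> real"
  assumes f: "integrable lborel f" and t: "t > 0"
    and w: "\<And>y. \<bar>w y\<bar> \<le> 1"
  shows "\<bar>\<integral>y. w y * f (x + sqrt t *\<^sub>R y) \<partial>lborel\<bar> \<le> (\<integral>z. \<bar>f z\<bar> \<partial>lborel) / sqrt t ^ DIM('a)"
proof -
  have meas: "f \<in> borel_measurable borel" using f by auto
  have fin: "integrable lborel (\<lambda>y. \<bar>f (x + sqrt t *\<^sub>R y)\<bar>)"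
  proof -
    have i: "integrable (density (distr lborel borel (\<lambda>y. x + sqrt t *\<^sub>R y)) (\<lambda>_. ennreal (\<bar>sqrt t\<bar> ^ DIM('a)))) f"
      using f lborel_affine[of "sqrt t" x] t by simp
    have "integrable (distr lborel borel (\<lambda>y. x + sqrt t *\<^sub>R y)) (\<lambda>z. sqrt t ^ DIM('a) * f z)"
      using i t by (subst (asm) integrable_density) (use meas in auto)
    then have "integrable lborel (\<lambda>y. sqrt t ^ DIM('a) * f (x + sqrt t *\<^sub>R y))"
      by (subst (asm) integrable_distr_eq) (use meas in auto)
    then have "integrable lborel (\<lambda>y. f (x + sqrt t *\<^sub>R y))" using t by simp
    then show ?thesis by (rule integrable_abs)
  qed
  have "\<bar>\<integral>y. w y * f (x + sqrt t *\<^sub>R y) \<partial>lborel\<bar> \<le> (\<integral>y. \<bar>w y * f (x + sqrt t *\<^sub>R y)\<bar> \<partial>lborel)"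
    by (rule integral_abs_bound)
  also have "\<dots> \<le> (\<integral>y. \<bar>f (x + sqrt t *\<^sub>R y)\<bar> \<partial>lborel)"
    by (rule integral_mono'[OF fin]) (auto simp: abs_mult intro!: mult_left_le_one_le w)
  also have "\<dots> = (\<integral>z. \<bar>f z\<bar> \<partial>lborel) / sqrt t ^ DIM('a)"
    by (rule integral_affine[of "\<lambda>z. \<bar>f z\<bar>"]) (use meas t in auto)
  finally show ?thesis .
qed

lemma bump_avg_le:
  fixes f :: "'a::euclidean_space \<Rightarrow> real"
  assumes f: "integrable lborel f" and t: "t > 0"
  shows "\<bar>bump_avg j f x t\<bar> \<le> (\<integral>z. \<bar>f z\<bar> \<partial>lborel) / sqrt t ^ DIM('a)"
  unfolding bump_avg_def by (rule integral_affine_le[OF f t]) (simp add: bump_le_one)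

lemma abs_bump_inner_le_one:
  assumes "j \<ge> 1" "b \<in> Basis"
  shows "\<bar>bump j y * (y \<bullet> b)\<bar> \<le> 1"
proof (cases "norm y \<ge> 1")
  case True
  then have "bump j y = 0" by (rule bump_zero_outside[OF assms(1)])
  then show ?thesis by simp
next
  case False
  then have "\<bar>y \<bullet> b\<bar> \<le> 1" using Basis_le_norm[OF assms(2), of y] by linarith
  then show ?thesis using bump_le_one[of j y] by (simp add: abs_mult mult_le_one)
qed

lemma bump_avg_partial_deriv:
  fixes f :: "'a::euclidean_space \<Rightarrow> real"
  assumes "j \<ge> 1" "smooth_fun f" "b \<in> Basis" "t > 0"
  shows "bump_avg (Suc j) (partial_deriv b f) x t
    = 2 * real (Suc j) / sqrt t * (\<integral>y. bump j y * ((y \<bullet> b) * f (x + sqrt t *\<^sub>R y)) \<partial>lborel)"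
  using bump_integral_by_parts[OF assms(1-3), of x "sqrt t"] assms(4)
  by (simp add: bump_avg_def field_simps)

text \<open>The derivative is moved to the weight, so the integral of \<open>\<bar>f\<bar>\<close>
  alone controls the average; compared with \<open>bump_avg_le\<close> a factor
  \<open>1 / sqrt t\<close> is gained.\<close>

lemma bump_avg_partial_deriv_le:
  fixes f :: "'a::euclidean_space \<Rightarrow> real"
  assumes j: "j \<ge> 1" and f: "smooth_fun f" "integrable lborel f" and b: "b \<in> Basis" and t: "t > 0"
  shows "\<bar>bump_avg (Suc j) (partial_deriv b f) x t\<bar>
    \<le> 2 * real (Suc j) / sqrt t * ((\<integral>z. \<bar>f z\<bar> \<partial>lborel) / sqrt t ^ DIM('a))"
proof -
  have "\<bar>\<integral>y. (bump j y * (y \<bullet> b)) * f (x + sqrt t *\<^sub>R y) \<partial>lborel\<bar> \<le> (\<integral>z. \<bar>f z\<bar> \<partial>lborel) / sqrt t ^ DIM('a)"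
    by (rule integral_affine_le[OF f(2) t abs_bump_inner_le_one[OF j b]])
  then show ?thesis
    unfolding bump_avg_partial_deriv[OF j f(1) b t] using t
    unfolding abs_mult by (intro mult_mono) (auto simp: mult.assoc)
qed

section \<open>Averages of functions vanishing at infinity\<close>

lemma bounded_if_tendsto_0_at_infinity:
  fixes g :: "'a::euclidean_space \<Rightarrow> real"
  assumes "continuous_on UNIV g" "(g \<longlongrightarrow> 0) at_infinity"
  obtains B where "\<And>x. \<bar>g x\<bar> \<le> B"
proof -
  have "\<forall>\<^sub>F x in at_infinity. \<bar>g x\<bar> < 1"
    using tendstoD[OF assms(2), of 1] by (simp add: dist_norm)
  then obtain b where b: "\<And>x. b \<le> norm x \<Longrightarrow> \<bar>g x\<bar> < 1"
    unfolding eventually_at_infinity by blast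
  have "compact (g ` cball 0 b)"
    by (intro compact_continuous_image continuous_on_subset[OF assms(1)]) auto
  then have "bounded (g ` cball 0 b)" by (rule compact_imp_bounded)
  then obtain B where "\<forall>y\<in>g ` cball 0 b. norm y \<le> B" unfolding bounded_iff by blast
  then have B: "\<bar>g x\<bar> \<le> B" if "x \<in> cball 0 b" for x using that by simp
  have "\<bar>g x\<bar> \<le> max B 1" for x
    using b[of x] B[of x] by (cases "norm x \<ge> b") auto
  then show ?thesis using that by blast
qed

text \<open>For \<open>y \<noteq> 0\<close> the point \<open>x + sqrt t y\<close> leaves every
  bounded set, so the integrand tends to 0; boundedness of \<open>g\<close> and integrability of the
  weight give dominated convergence.\<close>

lemma bump_avg_tendsto_0:
  fixes g :: "'a::euclidean_space \<Rightarrow> real"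
  assumes j: "j \<ge> 1" and g: "continuous_on UNIV g" "(g \<longlongrightarrow> 0) at_infinity"
  shows "(bump_avg j g x \<longlongrightarrow> 0) at_top"
proof -
  obtain B where B: "\<And>x. \<bar>g x\<bar> \<le> B" by (rule bounded_if_tendsto_0_at_infinity[OF g]) blast
  have "((\<lambda>t. \<integral>y. bump j y * g (x + sqrt t *\<^sub>R y) \<partial>lborel) \<longlongrightarrow> (\<integral>y. 0 \<partial>(lborel::'a measure))) at_top"
  proof (rule integral_dominated_convergence_at_top[where w="\<lambda>y. bump j y * B"])
    show "integrable lborel (\<lambda>y::'a. bump j y * B)"
      by (intro integrable_mult_left integrable_bump j)
    show "\<forall>\<^sub>F t in at_top. AE y in lborel. norm (bump j y * g (x + sqrt t *\<^sub>R y)) \<le> bump j y * B"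
      by (auto simp: abs_mult intro!: always_eventually mult_left_mono B)
    show "AE y in lborel. ((\<lambda>t. bump j y * g (x + sqrt t *\<^sub>R y)) \<longlongrightarrow> 0) at_top"
    proof -
      have "((\<lambda>t. bump j y * g (x + sqrt t *\<^sub>R y)) \<longlongrightarrow> 0) at_top" if "y \<noteq> 0" for y
      proof -
        have "filterlim (\<lambda>t. norm y * sqrt t) at_top at_top"
          by (rule filterlim_tendsto_pos_mult_at_top[OF tendsto_const _ sqrt_at_top]) (use that in simp)
        then have "filterlim (\<lambda>t. - norm x + norm y * sqrt t) at_top at_top"
          by (rule filterlim_tendsto_add_at_top[OF tendsto_const])
        then have "filterlim (\<lambda>t. norm (x + sqrt t *\<^sub>R y)) at_top at_top"
        proof (rule filterlim_at_top_mono)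
          show "\<forall>\<^sub>F t in at_top. - norm x + norm y * sqrt t \<le> norm (x + sqrt t *\<^sub>R y)"
            using eventually_ge_at_top[of 0]
          proof eventually_elim
            case (elim t)
            have "norm (sqrt t *\<^sub>R y) \<le> norm (x + sqrt t *\<^sub>R y) + norm x"
              by (metis add_diff_cancel_left' norm_triangle_ineq4)
            then show ?case using elim by (simp add: mult.commute)
          qed
        qed
        then have "filterlim (\<lambda>t. x + sqrt t *\<^sub>R y) at_infinity at_top"
          by (rule filterlim_norm_at_top_imp_at_infinity)
        then have "((\<lambda>t. g (x + sqrt t *\<^sub>R y)) \<longlongrightarrow> 0) at_top"
          by (rule filterlim_compose[OF g(2)])
        then show ?thesis by (rule tendsto_mult_right_zero)
      qed
      moreover have "AE y::'a in lborel. y \<noteq> 0" by (rule AE_lborel_singleton)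
      ultimately show ?thesis by auto
    qed
    show "(\<lambda>y. bump j y * g (x + sqrt t *\<^sub>R y)) \<in> borel_measurable lborel" for t
      using integrable_bump_affine[OF j g(1)] by (rule borel_measurable_integrable)
  qed simp
  then show ?thesis unfolding bump_avg_def[abs_def] by simp
qed

section \<open>Decay along chains of derivatives\<close>

text \<open>The tail integral \<open>p\<close> of the bound is a barrier: \<open>F - p\<close>
  increases, \<open>F + p\<close> decreases, and every value of the first lies below every value of
  the second.\<close>

lemma limit_of_decaying_derivative:
  fixes F G :: "real \<Rightarrow> real"
  assumes der: "\<And>t. t > 0 \<Longrightarrow> (F has_real_derivative - G t) (at t)"
    and bnd: "\<And>t. t > 0 \<Longrightarrow> \<bar>G t\<bar> \<le> B * t powr - (\<beta> + 1)" and \<beta>: "\<beta> \<ge> 1/2"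
  obtains l where "(F \<longlongrightarrow> l) at_top" "\<And>t. t > 0 \<Longrightarrow> \<bar>F t - l\<bar> \<le> 2 * B * t powr - \<beta>"
proof -
  have B: "B \<ge> 0" using bnd[of 1] by simp
  define p where "p t = B / \<beta> * t powr - \<beta>" for t
  have dp: "(p has_real_derivative - B * t powr - (\<beta> + 1)) (at t)" if "t > 0" for t
    unfolding p_def using that \<beta>
    by (auto intro!: derivative_eq_intros simp: powr_diff powr_minus field_simps powr_add)
  have inc: "F s - p s \<le> F t - p t" if "0 < s" "s \<le> t" for s t
  proof (rule DERIV_nonneg_imp_nondecreasing[OF that(2)])
    fix r assume "s \<le> r" "r \<le> t"
    then have r: "r > 0" using that by simp
    then show "\<exists>y. ((\<lambda>t. F t - p t) has_real_derivative y) (at r) \<and> 0 \<le> y"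
      using DERIV_diff[OF der[OF r] dp[OF r]] bnd[OF r] by (intro exI conjI) auto
  qed
  have dec: "F s + p s \<ge> F t + p t" if "0 < s" "s \<le> t" for s t
  proof (rule DERIV_nonpos_imp_nonincreasing[OF that(2)])
    fix r assume "s \<le> r" "r \<le> t"
    then have r: "r > 0" using that by simp
    then show "\<exists>y. ((\<lambda>t. F t + p t) has_real_derivative y) (at r) \<and> y \<le> 0"
      using DERIV_add[OF der[OF r] dp[OF r]] bnd[OF r] by (intro exI conjI) auto
  qed
  have p0: "p t \<ge> 0" for t using B \<beta> by (simp add: p_def)
  have cross: "F s - p s \<le> F t + p t" if "0 < s" "0 < t" for s t
    using inc[of s "max s t"] dec[of t "max s t"] p0[of "max s t"] that by simp
  define l where "l = (SUP t\<in>{0<..}. F t - p t)"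
  have bdd: "bdd_above ((\<lambda>t. F t - p t) ` {0<..})"
    by (rule bdd_aboveI[of _ "F 1 + p 1"]) (use cross in auto)
  have lo: "F t - p t \<le> l" if "t > 0" for t
    unfolding l_def by (rule cSUP_upper[OF _ bdd]) (use that in auto)
  have hi: "l \<le> F t + p t" if "t > 0" for t
    unfolding l_def by (rule cSUP_least) (use cross that in auto)
  have est: "\<bar>F t - l\<bar> \<le> 2 * B * t powr - \<beta>" if t: "t > 0" for t
  proof -
    have "\<bar>F t - l\<bar> \<le> p t" using lo[OF t] hi[OF t] by linarith
    also have "\<dots> \<le> 2 * B * t powr - \<beta>"
    proof -
      \<comment> \<open>As \<open>\<beta> \<ge> 1/2\<close>, the factor \<open>1 / \<beta>\<close>
        is at most 2; the constant thus doubles in each application, whatever the exponent.\<close>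
      have "B * 1 \<le> B * (2 * \<beta>)" using B \<beta> by (intro mult_left_mono) auto
      then have "B / \<beta> \<le> 2 * B" using \<beta> by (simp add: field_simps)
      then show ?thesis unfolding p_def by (intro mult_right_mono) auto
    qed
    finally show ?thesis .
  qed
  have "((\<lambda>t. 2 * B * t powr - \<beta>) \<longlongrightarrow> 2 * B * 0) at_top"
    by (intro tendsto_mult tendsto_const tendsto_neg_powr) (use \<beta> in \<open>auto simp: filterlim_ident\<close>)
  then have "((\<lambda>t. 2 * B * t powr - \<beta>) \<longlongrightarrow> 0) at_top" by simp
  then have "((\<lambda>t. F t - l) \<longlongrightarrow> 0) at_top"
  proof (rule Lim_null_comparison[rotated])
    show "\<forall>\<^sub>F t in at_top. norm (F t - l) \<le> 2 * B * t powr - \<beta>"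
      using eventually_gt_at_top[of 0] by eventually_elim (use est in auto)
  qed
  then have "(F \<longlongrightarrow> l) at_top" by (simp add: LIM_zero_iff)
  then show ?thesis using est that by blast
qed

text \<open>A lower bound \<open>c\<close> on one member forces linear growth of the preceding one
  with the opposite sign; \<open>s\<close> carries the alternating sign down to
  \<open>E 0\<close>.\<close>

lemma derivative_chain_not_null:
  fixes E :: "nat \<Rightarrow> real \<Rightarrow> real"
  assumes der: "\<And>k t. k < m \<Longrightarrow> t > 0 \<Longrightarrow> (E k has_real_derivative - E (Suc k) t) (at t)"
    and "j \<le> m" and "c > 0" and "\<forall>\<^sub>F t in at_top. c \<le> s * E j t"
  shows "\<not> (E 0 \<longlongrightarrow> 0) at_top"
  using assms(2-)
proof (induction j arbitrary: c s)
  case 0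
  show ?case
  proof
    assume "(E 0 \<longlongrightarrow> 0) at_top"
    then have "((\<lambda>t. s * E 0 t) \<longlongrightarrow> 0) at_top" by (rule tendsto_mult_right_zero)
    then have "\<forall>\<^sub>F t in at_top. s * E 0 t < c" using 0 by (simp add: order_tendsto_iff)
    with 0(3) have "\<forall>\<^sub>F t::real in at_top. False" by eventually_elim simp
    then show False by simp
  qed
next
  case (Suc j)
  obtain T0 where T0: "\<And>t. t \<ge> T0 \<Longrightarrow> c \<le> s * E (Suc j) t"
    using Suc.prems(3) unfolding eventually_at_top_linorder by blast
  define T where "T = max T0 1"
  have inc: "(- s) * E j T - c * T \<le> (- s) * E j t - c * t" if "t \<ge> T" for t
  proof (rule DERIV_nonneg_imp_nondecreasing[OF that])
    fix r assume "T \<le> r" "r \<le> t"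
    then have r: "r > 0" "r \<ge> T0" by (auto simp: T_def)
    have "((\<lambda>t. (- s) * E j t - c * t) has_real_derivative (- s) * (- E (Suc j) r) - c * 1) (at r)"
      using Suc.prems(1) r by (intro DERIV_diff DERIV_cmult der DERIV_ident) auto
    then show "\<exists>y. ((\<lambda>t. (- s) * E j t - c * t) has_real_derivative y) (at r) \<and> 0 \<le> y"
      using T0[OF r(2)] by (intro exI conjI) auto
  qed
  have "\<forall>\<^sub>F t in at_top. 1 \<le> (- s) * E j t"
    using eventually_ge_at_top[of T] eventually_ge_at_top[of "(1 + s * E j T + c * T) / c"]
  proof eventually_elim
    case (elim t)
    then have "1 + s * E j T + c * T \<le> c * t" using Suc.prems(2) by (simp add: field_simps)
    then show ?case using inc[OF elim(1)] by simp
  qed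
  then show ?case using Suc.IH[of 1 "- s"] Suc.prems by simp
qed

text \<open>Going down from \<open>E m\<close>, the bound on a derivative yields a limit with a
  rate, and \<open>derivative_chain_not_null\<close> rules out a nonzero limit. This is what
  excludes polynomial behavior in \<open>t\<close>.\<close>

lemma derivative_chain_decay:
  fixes E :: "nat \<Rightarrow> real \<Rightarrow> real"
  assumes der: "\<And>k t. k < m \<Longrightarrow> t > 0 \<Longrightarrow> (E k has_real_derivative - E (Suc k) t) (at t)"
    and bnd: "\<And>t. t > 0 \<Longrightarrow> \<bar>E m t\<bar> \<le> B * t powr - (real m + \<alpha>)" and \<alpha>: "\<alpha> \<ge> 1/2"
    and lim: "(E 0 \<longlongrightarrow> 0) at_top"
    and "k \<le> m" "t > 0"
  shows "\<bar>E k t\<bar> \<le> 2 ^ (m - k) * B * t powr - (real k + \<alpha>)"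
  using \<open>k \<le> m\<close> \<open>t > 0\<close>
proof (induction "m - k" arbitrary: k t)
  case 0
  then show ?case using bnd by simp
next
  case (Suc d)
  then have k: "k < m" "d = m - Suc k" "m - k = Suc (m - Suc k)" by auto
  have b: "\<bar>E (Suc k) s\<bar> \<le> (2 ^ (m - Suc k) * B) * s powr - ((real k + \<alpha>) + 1)" if "s > 0" for s
    using Suc.hyps(1)[OF k(2) _ that] k by (simp add: algebra_simps)
  obtain l where l: "(E k \<longlongrightarrow> l) at_top"
    "\<And>t. t > 0 \<Longrightarrow> \<bar>E k t - l\<bar> \<le> 2 * (2 ^ (m - Suc k) * B) * t powr - (real k + \<alpha>)"
    by (rule limit_of_decaying_derivative[of "E k" "E (Suc k)", OF der[OF k(1)] b]) (use \<alpha> in auto)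
  have "l = 0"
  proof (rule ccontr)
    assume "l \<noteq> 0"
    then have "0 < \<bar>l\<bar>" by simp
    have "((\<lambda>t. sgn l * E k t) \<longlongrightarrow> sgn l * l) at_top" by (intro tendsto_intros l)
    then have "((\<lambda>t. sgn l * E k t) \<longlongrightarrow> \<bar>l\<bar>) at_top" by (simp add: abs_sgn mult.commute)
    then have "\<forall>\<^sub>F t in at_top. \<bar>l\<bar> / 2 < sgn l * E k t"
      using \<open>0 < \<bar>l\<bar>\<close> by (intro order_tendstoD(1)) auto
    then have "\<forall>\<^sub>F t in at_top. \<bar>l\<bar> / 2 \<le> sgn l * E k t" by eventually_elim simp
    from derivative_chain_not_null[OF der _ _ this, of m] lim k \<open>0 < \<bar>l\<bar>\<close> show False by auto
  qed
  then show ?case using l(2)[OF Suc.prems(2)] unfolding k(3) by simp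
qed

text \<open>With \<open>t\<close> the square of the radius, the averages of a function and of the iterates of its
  Laplacian form a chain under \<open>- d/dt\<close>.\<close>

definition avg_coeff :: "nat \<Rightarrow> nat \<Rightarrow> real" where
  "avg_coeff N k = 1 / (4 ^ k * pochhammer (real N + 1) k)"

lemma avg_coeff_pos: "avg_coeff N k > 0"
  by (simp add: avg_coeff_def pochhammer_pos)

text \<open>\<open>avg_coeff\<close> is the product of the factors \<open>1 / (4 (N + i))\<close>,
  \<open>1 \<le> i \<le> k\<close>, produced by \<open>DERIV_bump_avg\<close>, and the exponent of
  the weight rises with \<open>k\<close>; so each member is minus the derivative of the preceding
  one without further constants.\<close>

definition lap_avg :: "nat \<Rightarrow> ('a::euclidean_space \<Rightarrow> real) \<Rightarrow> nat \<Rightarrow> 'a \<Rightarrow> real \<Rightarrow> real" where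
  "lap_avg N g k x t = avg_coeff N k * bump_avg (N + k) ((neg_laplacian ^^ k) g) x t"

lemma DERIV_lap_avg:
  assumes "N \<ge> 1" "smooth_fun g" "t > 0"
  shows "(lap_avg N g k x has_real_derivative - lap_avg N g (Suc k) x t) (at t)"
proof -
  have "(lap_avg N g k x has_real_derivative avg_coeff N k *
      - (bump_avg (Suc (N + k)) (neg_laplacian ((neg_laplacian ^^ k) g)) x t / (4 * real (Suc (N + k))))) (at t)"
    unfolding lap_avg_def[abs_def]
    by (intro DERIV_cmult DERIV_bump_avg smooth_fun_neg_laplacian_power) (use assms in auto)
  also have "avg_coeff N k *
      - (bump_avg (Suc (N + k)) (neg_laplacian ((neg_laplacian ^^ k) g)) x t / (4 * real (Suc (N + k))))
      = - lap_avg N g (Suc k) x t"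
    by (simp add: lap_avg_def avg_coeff_def pochhammer_Suc algebra_simps)
  finally show ?thesis .
qed

text \<open>The Taylor polynomial in \<open>t\<close> that extrapolates \<open>lap_avg N g 0 x\<close> back to \<open>t = 0\<close>;
  its \<open>t\<close>-derivative only involves the top order term.\<close>

definition taylor_avg :: "nat \<Rightarrow> ('a::euclidean_space \<Rightarrow> real) \<Rightarrow> nat \<Rightarrow> 'a \<Rightarrow> real \<Rightarrow> real" where
  "taylor_avg N g m x t = (\<Sum>k<m. t ^ k / fact k * lap_avg N g k x t)"

text \<open>The sum telescopes: differentiating the power of \<open>t\<close> in one term cancels
  what comes from differentiating the average in the preceding term.\<close>

lemma DERIV_taylor_avg:
  assumes "N \<ge> 1" "smooth_fun g" "t > 0"
  shows "(taylor_avg N g (Suc m) x has_real_derivative - (t ^ m / fact m * lap_avg N g (Suc m) x t)) (at t)"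
proof (induction m)
  case 0
  show ?case using DERIV_lap_avg[OF assms, of 0 x] by (simp add: taylor_avg_def[abs_def])
next
  case (Suc m)
  have "((\<lambda>t. t ^ Suc m / fact (Suc m)) has_real_derivative t ^ m / fact m) (at t)"
    using DERIV_cdivide[OF DERIV_pow[of "Suc m" t], of "fact (Suc m)"]
    by (simp add: field_simps del: of_nat_Suc)
  from DERIV_add[OF Suc DERIV_mult[OF this DERIV_lap_avg[OF assms, of "Suc m" x]]]
  show ?case unfolding taylor_avg_def[abs_def] by (subst sum.lessThan_Suc) (simp add: algebra_simps)
qed

lemma continuous_on_taylor_avg:
  assumes "N \<ge> 1" "smooth_fun g"
  shows "continuous_on S (\<lambda>p. taylor_avg N g m (fst p) (snd p))"
  unfolding taylor_avg_def lap_avg_def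
  by (intro continuous_intros continuous_on_bump_avg smooth_fun_continuous smooth_fun_neg_laplacian_power)
    (use assms in auto)

text \<open>Only \<open>k = 0\<close> survives, since \<open>0 ^ 0 = 1\<close>. This is how
  pointwise values are recovered from averages.\<close>

lemma taylor_avg_at_0:
  fixes g :: "'a::euclidean_space \<Rightarrow> real"
  shows "taylor_avg N g (Suc m) x 0 = (\<integral>y. bump N (y :: 'a) \<partial>lborel) * g x"
proof -
  have "taylor_avg N g (Suc m) x 0 = (\<Sum>k<Suc m. if k = 0 then lap_avg N g 0 x 0 else 0)"
    unfolding taylor_avg_def by (intro sum.cong) auto
  then show ?thesis by (simp add: lap_avg_def avg_coeff_def bump_avg_at_0)
qed

section \<open>Solutions of the polyharmonic equation\<close>

text \<open>The derivative, in the squared distance \<open>d\<close>, of a version of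
  \<open>- ln d\<close> smoothed at scale \<open>r\<close>. It is \<open>- 1 / d\<close> for
  \<open>d \<ge> r\<close> and \<open>((1 - d / r) ^ (p + 1) - 1) / d\<close> for
  \<open>0 < d < r\<close>; the geometric sum avoids the division by \<open>d\<close> and also
  covers \<open>d = 0\<close>.\<close>

definition log_kernel_deriv :: "nat \<Rightarrow> real \<Rightarrow> real \<Rightarrow> real" where
  "log_kernel_deriv p r d = - (1 / max r d) * (\<Sum>k\<le>p. max 0 (1 - d / r) ^ k)"

text \<open>Geometric sum with ratio \<open>1 - d / r\<close>. The right-hand side lies between -1
  and 0, which later gives a domination uniform in the scale \<open>r\<close>.\<close>

lemma log_kernel_deriv_mult:
  assumes "r > 0" "d \<ge> 0"
  shows "d * log_kernel_deriv p r d = max 0 (1 - d / r) ^ Suc p - 1"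
proof (cases "d < r")
  case True
  define X where "X = 1 - d / r"
  have X: "max 0 (1 - d / r) = X" "d / r = 1 - X" using True assms by (auto simp: X_def field_simps)
  have "max r d = r" using True by simp
  then have "d * log_kernel_deriv p r d = - (d / r * (\<Sum>k\<le>p. X ^ k))"
    unfolding log_kernel_deriv_def X(1) by simp
  then have "d * log_kernel_deriv p r d = - ((1 - X) * (\<Sum>k\<le>p. X ^ k))"
    unfolding X(2) .
  also have "(1 - X) * (\<Sum>k\<le>p. X ^ k) = 1 - X ^ Suc p"
    using sum_gp_basic[of X p] by simp
  finally show ?thesis unfolding X(1) by simp
next
  case False
  have X: "max 0 (1 - d / r) = 0" using False assms by (simp add: field_simps)
  have "(\<Sum>k\<le>p. (0::real) ^ k) = (\<Sum>k\<le>p. if k = 0 then 1 else 0)" by (intro sum.cong) (auto simp: power_0_left)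
  then have "(\<Sum>k\<le>p. (0::real) ^ k) = 1" by simp
  then show ?thesis using False assms unfolding log_kernel_deriv_def X by (simp add: max_def)
qed

text \<open>As the value does not involve \<open>r\<close>, kernels at two scales differ only on a
  bounded set; this is used to differentiate \<open>grad_pot\<close>.\<close>

lemma log_kernel_deriv_far:
  assumes "r > 0" "d \<ge> r"
  shows "log_kernel_deriv p r d = - 1 / d"
proof -
  have "d * log_kernel_deriv p r d = -1"
  proof -
    have "max 0 (1 - d / r) = 0" using assms by (simp add: field_simps)
    then show ?thesis using log_kernel_deriv_mult[of r d p] assms by simp
  qed
  then show ?thesis using assms by (simp add: field_simps)
qed

lemma abs_log_kernel_deriv_le:
  assumes "r > 0" "d \<ge> 0"
  shows "\<bar>log_kernel_deriv p r d\<bar> \<le> real (Suc p) / max r d"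
proof -
  have X: "0 \<le> max 0 (1 - d / r)" "max 0 (1 - d / r) \<le> 1" using assms by auto
  have "(\<Sum>k\<le>p. max 0 (1 - d / r) ^ k) \<le> (\<Sum>k\<le>p. 1)"
    by (intro sum_mono power_le_one X)
  moreover have "(\<Sum>k\<le>p. max 0 (1 - d / r) ^ k) \<ge> 0" by (intro sum_nonneg zero_le_power X)
  ultimately show ?thesis using assms unfolding log_kernel_deriv_def
    by (simp add: abs_mult divide_right_mono)
qed

text \<open>The chain rule produces a factor \<open>d\<close> that cancels the denominator. What
  remains is a truncated power with exponent \<open>p\<close>, the same weight that arises from
  averages of \<open>f\<close>. At \<open>d = 0\<close> the sum is simply
  \<open>p + 1\<close>.\<close>

lemma DERIV_log_kernel_deriv:
  assumes p: "p \<ge> 1" and "r > 0" "d \<ge> 0"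
  shows "((\<lambda>r. log_kernel_deriv p r d) has_real_derivative
           real (Suc p) / r\<^sup>2 * max 0 (1 - d / r) ^ p) (at r)"
proof (cases "d = 0")
  case True
  have D: "((\<lambda>r. - real (Suc p) / r) has_real_derivative real (Suc p) / r\<^sup>2) (at r)"
    using assms by (auto intro!: derivative_eq_intros simp: power2_eq_square simp del: of_nat_Suc)
  have "- real (Suc p) / s = log_kernel_deriv p s d" if "s \<in> {0<..}" for s
    using that True by (simp add: log_kernel_deriv_def max_def field_simps)
  from has_field_derivative_transform_within_open[OF D open_greaterThan _ this]
  have "((\<lambda>r. log_kernel_deriv p r d) has_real_derivative real (Suc p) / r\<^sup>2) (at r)"
    using assms by simp
  then show ?thesis using True by simp
next
  case False
  have "((\<lambda>s. 1 - d / s) has_real_derivative d / r\<^sup>2) (at r)"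
    using assms by (auto intro!: derivative_eq_intros simp: power2_eq_square)
  from DERIV_chain2[OF max0_power_has_derivative[OF p] this]
  have "((\<lambda>s. max 0 (1 - d / s) ^ Suc p) has_real_derivative
      real (Suc p) * max 0 (1 - d / r) ^ p * (d / r\<^sup>2)) (at r)" .
  from DERIV_cdivide[OF DERIV_diff[OF this DERIV_const], of 1 d]
  have D: "((\<lambda>s. (max 0 (1 - d / s) ^ Suc p - 1) / d) has_real_derivative
      real (Suc p) / r\<^sup>2 * max 0 (1 - d / r) ^ p) (at r)"
    by (rule DERIV_cong) (use False in simp)
  have "(max 0 (1 - d / s) ^ Suc p - 1) / d = log_kernel_deriv p s d" if "s \<in> {0<..}" for s
    using log_kernel_deriv_mult[of s d p] that assms False by (simp add: field_simps)
  from has_field_derivative_transform_within_open[OF D open_greaterThan _ this]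
  show ?thesis using assms by simp
qed

lemma continuous_on_log_kernel_deriv:
  assumes "r > 0" "continuous_on S h"
  shows "continuous_on S (\<lambda>z. log_kernel_deriv p r (h z))"
  unfolding log_kernel_deriv_def
  by (intro continuous_intros assms) (use assms in auto)

lemma abs_power_div_fact_le:
  assumes "t \<ge> (0::real)"
  shows "\<bar>t ^ k / fact k\<bar> \<le> t ^ k"
proof -
  have "t ^ k * 1 \<le> t ^ k * fact k" using assms by (intro mult_left_mono) (auto simp: fact_ge_1)
  then show ?thesis using assms by (simp add: field_simps)
qed

locale polyharmonic =
  fixes u f :: "'a::euclidean_space \<Rightarrow> real" and m :: nat and C :: real
  assumes dim: "DIM('a) = 2 * m" and m2: "m \<ge> 2"
    and smooth_u: "smooth_fun u"
    and eq: "(neg_laplacian ^^ m) u = f"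
    and f_int: "integrable lborel f"
    and lap_lim: "(laplacian u \<longlongrightarrow> 0) at_infinity"
    and ub: "u x \<le> C"
begin

section \<open>Decay of averages of the iterated Laplacians\<close>

definition mass where "mass = (\<integral>z. \<bar>f z\<bar> \<partial>lborel)"

lemma mass_nonneg: "mass \<ge> 0"
  by (simp add: mass_def)

lemma smooth_f: "smooth_fun f"
  using smooth_fun_neg_laplacian_power[OF smooth_u, of m] eq by simp

lemma sqrt_power_dim: "t > 0 \<Longrightarrow> sqrt t ^ DIM('a) = t ^ m"
  by (simp add: dim power_mult)

definition decay_const where "decay_const N = 2 ^ m * (avg_coeff N m * mass)"

lemma decay_const_nonneg: "decay_const N \<ge> 0"
  using mass_nonneg avg_coeff_pos[of N m] by (simp add: decay_const_def)

text \<open>The chain starts at \<open>k = 1\<close>, because averages of the Laplacian vanish at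
  infinity, and ends at averages of \<open>f\<close>, which are at most \<open>mass / t ^ m\<close>
  as the dimension is \<open>2 m\<close>. With the index shifted by one the decay exponent is
  \<open>\<alpha> = 1\<close>. The bound is uniform in \<open>x\<close>.\<close>

lemma lap_avg_decay:
  assumes N: "N \<ge> 1" and k: "1 \<le> k" "k \<le> m" and t: "t > 0"
  shows "\<bar>lap_avg N u k x t\<bar> \<le> decay_const N / t ^ k"
proof -
  define B where "B = avg_coeff N m * mass"
  have B0: "B \<ge> 0" using mass_nonneg avg_coeff_pos[of N m] by (simp add: B_def)
  have bnd: "\<bar>lap_avg N u (Suc (m - 1)) x t\<bar> \<le> B * t powr - (real (m - 1) + 1)" if t: "t > 0" for t
  proof -
    have "\<bar>bump_avg (N + m) f x t\<bar> \<le> mass / t ^ m"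
      using bump_avg_le[OF f_int t, of "N + m" x] sqrt_power_dim[OF t] by (simp add: mass_def)
    then have "\<bar>lap_avg N u m x t\<bar> \<le> avg_coeff N m * (mass / t ^ m)"
      unfolding lap_avg_def eq abs_mult using avg_coeff_pos[of N m] by (intro mult_mono) auto
    moreover have "t powr - real m = 1 / t ^ m"
      using t by (simp add: powr_minus powr_realpow field_simps)
    ultimately show ?thesis using m2 by (simp add: B_def)
  qed
  have lim: "(lap_avg N u (Suc 0) x \<longlongrightarrow> 0) at_top"
  proof -
    have "(neg_laplacian u \<longlongrightarrow> 0) at_infinity"
      using tendsto_minus[OF lap_lim] by (simp add: neg_laplacian_def[abs_def])
    from bump_avg_tendsto_0[OF _ smooth_fun_continuous[OF smooth_fun_neg_laplacian[OF smooth_u]] this, of "N + 1" x]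
    have "((\<lambda>t. avg_coeff N 1 * bump_avg (N + 1) (neg_laplacian u) x t) \<longlongrightarrow> 0) at_top"
      by (intro tendsto_mult_right_zero) simp
    then show ?thesis by (simp add: lap_avg_def[abs_def])
  qed
  have "\<bar>lap_avg N u (Suc (k - 1)) x t\<bar> \<le> 2 ^ ((m - 1) - (k - 1)) * B * t powr - (real (k - 1) + 1)"
    by (rule derivative_chain_decay[of "m - 1" "\<lambda>k. lap_avg N u (Suc k) x"])
      (use k t N bnd lim in \<open>auto intro: DERIV_lap_avg smooth_u\<close>)
  also have "\<dots> = 2 ^ (m - k) * B / t ^ k"
    using k t by (simp add: powr_minus powr_realpow field_simps)
  also have "\<dots> \<le> 2 ^ m * B / t ^ k"
    using B0 t by (intro divide_right_mono mult_right_mono power_increasing) auto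
  finally show ?thesis using k by (simp add: decay_const_def B_def)
qed

text \<open>In every term with \<open>k \<ge> 1\<close> the power of \<open>t\<close> cancels the
  decay. Hence the growth of plain averages of \<open>u\<close> can be read off from
  \<open>taylor_avg\<close>, whose derivative is explicit.\<close>

lemma taylor_avg_close:
  assumes N: "N \<ge> 1" and t: "t > 0"
  shows "\<bar>taylor_avg N u m x t - lap_avg N u 0 x t\<bar> \<le> real m * decay_const N"
proof -
  obtain n where n: "m = Suc n" using m2 by (cases m) auto
  have "taylor_avg N u m x t - lap_avg N u 0 x t = (\<Sum>k<n. t ^ Suc k / fact (Suc k) * lap_avg N u (Suc k) x t)"
    unfolding taylor_avg_def n by (subst sum.lessThan_Suc_shift) simp
  also have "\<bar>\<dots>\<bar> \<le> (\<Sum>k<n. \<bar>t ^ Suc k / fact (Suc k) * lap_avg N u (Suc k) x t\<bar>)" by (rule sum_abs)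
  also have "\<dots> \<le> (\<Sum>k<n. decay_const N)"
  proof (rule sum_mono)
    fix k assume "k \<in> {..<n}"
    then have "\<bar>lap_avg N u (Suc k) x t\<bar> \<le> decay_const N / t ^ Suc k"
      using N t n by (intro lap_avg_decay) auto
    moreover have "\<bar>t ^ Suc k / fact (Suc k)\<bar> \<le> t ^ Suc k"
      by (rule abs_power_div_fact_le) (use t in simp)
    ultimately have "\<bar>t ^ Suc k / fact (Suc k)\<bar> * \<bar>lap_avg N u (Suc k) x t\<bar>
        \<le> t ^ Suc k * (decay_const N / t ^ Suc k)"
      using t by (intro mult_mono) auto
    then show "\<bar>t ^ Suc k / fact (Suc k) * lap_avg N u (Suc k) x t\<bar> \<le> decay_const N"
      using t by (simp add: abs_mult del: fact_Suc power_Suc)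
  qed
  also have "\<dots> \<le> real m * decay_const N" using decay_const_nonneg[of N] n by (simp add: algebra_simps)
  finally show ?thesis .
qed

text \<open>The derivative of the average is at most \<open>decay_const N / t\<close> in absolute
  value.\<close>

lemma lap_avg_ge_log:
  assumes N: "N \<ge> 1" and t: "t \<ge> 1"
  shows "lap_avg N u 0 x t \<ge> lap_avg N u 0 x 1 - decay_const N * ln t"
proof -
  have "lap_avg N u 0 x 1 + decay_const N * ln 1 \<le> lap_avg N u 0 x t + decay_const N * ln t"
  proof (rule DERIV_nonneg_imp_nondecreasing[OF t])
    fix r :: real assume "1 \<le> r" "r \<le> t"
    then have r: "r > 0" by simp
    have "((\<lambda>t. lap_avg N u 0 x t + decay_const N * ln t) has_real_derivative
        - lap_avg N u (Suc 0) x r + decay_const N * inverse r) (at r)"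
      by (intro DERIV_add DERIV_cmult DERIV_ln DERIV_lap_avg N smooth_u r)
    moreover have "\<bar>lap_avg N u (Suc 0) x r\<bar> \<le> decay_const N * inverse r"
      using lap_avg_decay[OF N, of 1 r x] r m2 by (simp add: divide_inverse)
    ultimately show "\<exists>y. ((\<lambda>t. lap_avg N u 0 x t + decay_const N * ln t) has_real_derivative y) (at r) \<and> 0 \<le> y"
      by (intro exI conjI) auto
  qed
  then show ?thesis by simp
qed

section \<open>Vanishing of gradient averages at infinity\<close>

lemma bump_avg_abs_le_log:
  obtains A where "\<And>t. t \<ge> 1 \<Longrightarrow> (\<integral>y. bump 1 y * \<bar>u (x + sqrt t *\<^sub>R y)\<bar> \<partial>lborel) \<le> A + decay_const 1 * ln t"
proof -
  have c: "continuous_on UNIV u" by (rule smooth_fun_continuous[OF smooth_u])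
  define \<kappa> where "\<kappa> = (\<integral>y. bump 1 (y :: 'a) \<partial>lborel)"
  have "(\<integral>y. bump 1 y * \<bar>u (x + sqrt t *\<^sub>R y)\<bar> \<partial>lborel)
      \<le> (2 * \<bar>C\<bar> * \<kappa> - lap_avg 1 u 0 x 1) + decay_const 1 * ln t" if t: "t \<ge> 1" for t
  proof -
    have i1: "integrable lborel (\<lambda>y. bump 1 y * u (x + sqrt t *\<^sub>R y))"
      and i2: "integrable lborel (\<lambda>y. bump 1 y * \<bar>u (x + sqrt t *\<^sub>R y)\<bar>)"
      by (intro integrable_bump_mult continuous_intros continuous_on_affine_compose c; simp)+
    have i3: "integrable lborel (\<lambda>y::'a. 2 * \<bar>C\<bar> * bump 1 y)" by (simp add: integrable_bump)
    have "(\<integral>y. bump 1 y * \<bar>u (x + sqrt t *\<^sub>R y)\<bar> \<partial>lborel)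
        \<le> (\<integral>y. 2 * \<bar>C\<bar> * bump 1 y - bump 1 y * u (x + sqrt t *\<^sub>R y) \<partial>lborel)"
    proof (rule integral_mono[OF i2 Bochner_Integration.integrable_diff[OF i3 i1]])
      fix y :: 'a
      \<comment> \<open>The upper bound on \<open>u\<close> converts the logarithmic lower bound for
        signed averages into a bound for averages of the absolute value.\<close>
      have "\<bar>u (x + sqrt t *\<^sub>R y)\<bar> \<le> 2 * \<bar>C\<bar> - u (x + sqrt t *\<^sub>R y)"
        using ub[of "x + sqrt t *\<^sub>R y"] by linarith
      from mult_left_mono[OF this bump_nonneg[of 1 y]]
      show "bump 1 y * \<bar>u (x + sqrt t *\<^sub>R y)\<bar> \<le> 2 * \<bar>C\<bar> * bump 1 y - bump 1 y * u (x + sqrt t *\<^sub>R y)"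
        by (simp add: algebra_simps)
    qed
    also have "\<dots> = 2 * \<bar>C\<bar> * \<kappa> - lap_avg 1 u 0 x t"
      using i1 i3 by (simp add: \<kappa>_def lap_avg_def avg_coeff_def bump_avg_def)
    finally show ?thesis using lap_avg_ge_log[OF _ t, of 1 x] by simp
  qed
  then show ?thesis using that by blast
qed

text \<open>Integration by parts turns the average of a derivative into \<open>4 / sqrt t\<close>
  times a first moment of \<open>u\<close>, which grows at most like \<open>ln t\<close>.\<close>

lemma lap_avg_partial_deriv_tendsto_0:
  assumes b: "b \<in> Basis"
  shows "(lap_avg 2 (partial_deriv b u) 0 x \<longlongrightarrow> 0) at_top"
proof -
  have c: "continuous_on UNIV u" by (rule smooth_fun_continuous[OF smooth_u])
  obtain A where A: "\<And>t. t \<ge> 1 \<Longrightarrow> (\<integral>y. bump 1 y * \<bar>u (x + sqrt t *\<^sub>R y)\<bar> \<partial>lborel) \<le> A + decay_const 1 * ln t"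
    by (rule bump_avg_abs_le_log[of x]) blast
  have est: "norm (lap_avg 2 (partial_deriv b u) 0 x t) \<le> 4 / sqrt t * (A + decay_const 1 * ln t)" if t: "t \<ge> 1" for t
  proof -
    have "lap_avg 2 (partial_deriv b u) 0 x t = 4 / sqrt t * (\<integral>y. bump 1 y * ((y \<bullet> b) * u (x + sqrt t *\<^sub>R y)) \<partial>lborel)"
      using bump_avg_partial_deriv[of 1 u b t x] smooth_u b t
      by (simp add: lap_avg_def avg_coeff_def numeral_2_eq_2)
    moreover have "\<bar>\<integral>y. bump 1 y * ((y \<bullet> b) * u (x + sqrt t *\<^sub>R y)) \<partial>lborel\<bar>
        \<le> (\<integral>y. \<bar>bump 1 y * ((y \<bullet> b) * u (x + sqrt t *\<^sub>R y))\<bar> \<partial>lborel)"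
      by (rule integral_abs_bound)
    moreover have "\<dots> \<le> (\<integral>y. bump 1 y * \<bar>u (x + sqrt t *\<^sub>R y)\<bar> \<partial>lborel)"
    proof (rule integral_mono')
      show "integrable lborel (\<lambda>y. bump 1 y * \<bar>u (x + sqrt t *\<^sub>R y)\<bar>)"
        by (intro integrable_bump_mult continuous_intros continuous_on_affine_compose c; simp)
      fix y :: 'a
      show "\<bar>bump 1 y * ((y \<bullet> b) * u (x + sqrt t *\<^sub>R y))\<bar> \<le> bump 1 y * \<bar>u (x + sqrt t *\<^sub>R y)\<bar>"
      proof (cases "norm y \<ge> 1")
        case True
        then have "bump 1 y = 0" by (intro bump_zero_outside) auto
        then show ?thesis by simp
      next
        case False
        then have "\<bar>y \<bullet> b\<bar> \<le> 1" using Basis_le_norm[OF b, of y] by linarith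
        then show ?thesis unfolding abs_mult by (intro mult_mono mult_left_le_one_le) auto
      qed
    qed simp
    ultimately show ?thesis using A[OF t] t by (simp add: abs_mult divide_right_mono)
  qed
  have "((\<lambda>t. 4 / sqrt t * (A + decay_const 1 * ln t)) \<longlongrightarrow> 0) at_top"
  proof -
    have "((\<lambda>t. ln (sqrt t) / sqrt t) \<longlongrightarrow> 0) at_top"
      by (rule filterlim_compose[OF ln_x_over_x_tendsto_0 sqrt_at_top])
    moreover have "((\<lambda>t. inverse (sqrt t)) \<longlongrightarrow> 0) at_top"
      by (intro tendsto_inverse_0_at_top sqrt_at_top)
    ultimately have "((\<lambda>t. 4 * A * inverse (sqrt t) + 8 * decay_const 1 * (ln (sqrt t) / sqrt t)) \<longlongrightarrow> 0) at_top"
      by (intro tendsto_add_zero tendsto_mult_right_zero)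
    moreover have "\<forall>\<^sub>F t in at_top. 4 * A * inverse (sqrt t) + 8 * decay_const 1 * (ln (sqrt t) / sqrt t)
        = 4 / sqrt t * (A + decay_const 1 * ln t)"
      using eventually_gt_at_top[of 0] by eventually_elim (simp add: ln_sqrt field_simps)
    ultimately show ?thesis by (rule Lim_transform_eventually)
  qed
  then show ?thesis
    by (rule Lim_null_comparison[rotated]) (use est in \<open>auto simp: eventually_at_top_linorder\<close>)
qed

definition grad_decay_const where
  "grad_decay_const = 2 ^ m * (avg_coeff 2 m * (2 * real (m + 2) * mass))"

text \<open>Moving the derivative of \<open>f\<close> to the weight gains \<open>1 / sqrt t\<close>
  at the top, so \<open>\<alpha> = 1/2\<close>, and by
  \<open>lap_avg_partial_deriv_tendsto_0\<close> the chain can start at \<open>k = 0\<close>. The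
  choice \<open>N = 2\<close> leaves exponent 1 after an integration by parts, the least that
  vanishes on the unit sphere.\<close>

lemma lap_avg_partial_deriv_decay:
  assumes b: "b \<in> Basis" and k: "k \<le> m" and t: "t > 0"
  shows "\<bar>lap_avg 2 (partial_deriv b u) k x t\<bar> \<le> grad_decay_const / (t ^ k * sqrt t)"
proof -
  define B where "B = avg_coeff 2 m * (2 * real (m + 2) * mass)"
  have B0: "B \<ge> 0" using mass_nonneg avg_coeff_pos[of 2 m] by (simp add: B_def)
  have pw: "t powr - (real k + 1/2) = 1 / (t ^ k * sqrt t)" if "t > 0" for t k
    using that by (simp only: powr_minus_divide powr_add powr_realpow powr_half_sqrt)
  have bnd: "\<bar>lap_avg 2 (partial_deriv b u) m x t\<bar> \<le> B * t powr - (real m + 1/2)" if t: "t > 0" for t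
  proof -
    have "\<bar>bump_avg (Suc (m + 1)) (partial_deriv b f) x t\<bar> \<le> 2 * real (Suc (m + 1)) / sqrt t * (mass / t ^ m)"
      using bump_avg_partial_deriv_le[OF _ smooth_f f_int b t, of "m + 1" x] sqrt_power_dim[OF t]
      by (simp add: mass_def)
    then have "\<bar>lap_avg 2 (partial_deriv b u) m x t\<bar> \<le> avg_coeff 2 m * (2 * real (Suc (m + 1)) / sqrt t * (mass / t ^ m))"
      unfolding lap_avg_def neg_laplacian_power_partial_deriv[OF smooth_u b] eq abs_mult
      using avg_coeff_pos[of 2 m] by (intro mult_mono) auto
    also have "\<dots> = B * t powr - (real m + 1/2)"
      unfolding pw[OF t] by (simp add: B_def field_simps)
    finally show ?thesis .
  qed
  have "\<bar>lap_avg 2 (partial_deriv b u) k x t\<bar> \<le> 2 ^ (m - k) * B * t powr - (real k + 1/2)"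
    by (rule derivative_chain_decay[of m "\<lambda>k. lap_avg 2 (partial_deriv b u) k x"])
      (use k t bnd b lap_avg_partial_deriv_tendsto_0[OF b] in
        \<open>auto intro!: DERIV_lap_avg smooth_fun_partial_deriv smooth_u\<close>)
  also have "\<dots> \<le> 2 ^ m * B * t powr - (real k + 1/2)"
    using B0 by (intro mult_right_mono power_increasing) auto
  finally show ?thesis unfolding pw[OF t] by (simp add: grad_decay_const_def B_def)
qed

section \<open>The gradient as a regularized logarithmic potential\<close>

lemma taylor_avg_partial_deriv_tendsto_0:
  assumes b: "b \<in> Basis"
  shows "(taylor_avg 2 (partial_deriv b u) m x \<longlongrightarrow> 0) at_top"
proof -
  have "((\<lambda>t. t ^ k / fact k * lap_avg 2 (partial_deriv b u) k x t) \<longlongrightarrow> 0) at_top" if "k < m" for k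
  proof (rule Lim_null_comparison)
    show "((\<lambda>t. grad_decay_const * inverse (sqrt t)) \<longlongrightarrow> 0) at_top"
      by (intro tendsto_mult_right_zero tendsto_inverse_0_at_top sqrt_at_top)
    show "\<forall>\<^sub>F t in at_top. norm (t ^ k / fact k * lap_avg 2 (partial_deriv b u) k x t) \<le> grad_decay_const * inverse (sqrt t)"
      using eventually_gt_at_top[of 0]
    proof eventually_elim
      case (elim t)
      have "\<bar>t ^ k / fact k\<bar> * \<bar>lap_avg 2 (partial_deriv b u) k x t\<bar>
          \<le> t ^ k * (grad_decay_const / (t ^ k * sqrt t))"
        using lap_avg_partial_deriv_decay[OF b, of k t x] that elim
        by (intro mult_mono abs_power_div_fact_le) auto
      also have "\<dots> = grad_decay_const * inverse (sqrt t)" using elim by (simp add: field_simps)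
      finally show ?case by (simp only: abs_mult real_norm_def)
    qed
  qed
  then show ?thesis unfolding taylor_avg_def[abs_def] by (intro tendsto_null_sum) auto
qed

text \<open>Up to sign, the factor in front of \<open>t ^ (m - 1)\<close> times the top-order
  average when \<open>taylor_avg 2 g m\<close> is differentiated.\<close>

definition pot_coeff where "pot_coeff = avg_coeff 2 m / fact (m - 1)"

lemma pot_coeff_pos: "pot_coeff > 0"
  by (simp add: pot_coeff_def avg_coeff_pos)

text \<open>The derivative in direction \<open>b\<close> of \<open>pot_coeff\<close> times the
  potential of \<open>f\<close> whose kernel is the smoothed \<open>- ln\<close> of the squared
  distance; the factor 2 is from differentiating \<open>(x - z) \<bullet> (x - z)\<close>. The
  exponent \<open>m + 1\<close> is the one left on the weight after the derivative of
  \<open>f\<close> is moved to it.\<close>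

definition grad_pot where
  "grad_pot b x r = 2 * pot_coeff * (\<integral>z. ((x - z) \<bullet> b) * log_kernel_deriv (m + 1) r ((x - z) \<bullet> (x - z)) * f z \<partial>lborel)"

text \<open>The top-order term is an average of a derivative of \<open>f\<close>; after integration
  by parts and the substitution \<open>z = x + sqrt t y\<close> the integrand is the scale
  derivative of the kernel in \<open>grad_pot\<close>. The sign changes twice, as \<open>y\<close>
  points from \<open>x\<close> to \<open>z\<close>.\<close>

lemma DERIV_taylor_avg_partial_deriv:
  assumes b: "b \<in> Basis" and t: "t > 0"
  shows "(taylor_avg 2 (partial_deriv b u) m x has_real_derivative
     2 * pot_coeff * (\<integral>z. ((x - z) \<bullet> b) * (real (m + 2) / t\<^sup>2 * max 0 (1 - ((x - z) \<bullet> (x - z)) / t) ^ (m + 1)) * f z \<partial>lborel)) (at t)"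
proof -
  obtain n where n: "m = Suc n" using m2 by (cases m) auto
  define J where "J = (\<integral>z. ((x - z) \<bullet> b) * (max 0 (1 - ((x - z) \<bullet> (x - z)) / t) ^ (m + 1)) * f z \<partial>lborel)"
  have meas: "(\<lambda>z. ((x - z) \<bullet> b) * (max 0 (1 - ((x - z) \<bullet> (x - z)) / t) ^ (m + 1)) * f z) \<in> borel_measurable borel"
    by (intro borel_measurable_continuous_onI continuous_intros smooth_fun_continuous[OF smooth_f]) (use t in auto)
  have J: "(\<integral>y. bump (m + 1) y * ((y \<bullet> b) * f (x + sqrt t *\<^sub>R y)) \<partial>lborel) = - (J / (sqrt t * t ^ m))"
  proof -
    have "bump (m + 1) y * ((y \<bullet> b) * f (x + sqrt t *\<^sub>R y)) = - (1 / sqrt t) *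
       (((x - (x + sqrt t *\<^sub>R y)) \<bullet> b) * (max 0 (1 - ((x - (x + sqrt t *\<^sub>R y)) \<bullet> (x - (x + sqrt t *\<^sub>R y))) / t) ^ (m + 1))
         * f (x + sqrt t *\<^sub>R y))" for y
    proof -
      have "sqrt t * (sqrt t * (y \<bullet> y)) / t = y \<bullet> y" using t by (simp flip: mult.assoc)
      then show ?thesis using t by (simp add: bump_def)
    qed
    then have "(\<integral>y. bump (m + 1) y * ((y \<bullet> b) * f (x + sqrt t *\<^sub>R y)) \<partial>lborel) = - (1 / sqrt t) *
      (\<integral>y. (((x - (x + sqrt t *\<^sub>R y)) \<bullet> b) * (max 0 (1 - ((x - (x + sqrt t *\<^sub>R y)) \<bullet> (x - (x + sqrt t *\<^sub>R y))) / t) ^ (m + 1))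
         * f (x + sqrt t *\<^sub>R y)) \<partial>lborel)"
      by (simp only: integral_mult_right_zero)
    also have "\<dots> = - (1 / sqrt t) * (J / t ^ m)"
      unfolding J_def
      by (subst integral_affine[OF meas, of "sqrt t" x]) (use t in \<open>auto simp: sqrt_power_dim\<close>)
    finally show ?thesis by simp
  qed
  have "lap_avg 2 (partial_deriv b u) m x t = avg_coeff 2 m * bump_avg (Suc (m + 1)) (partial_deriv b f) x t"
    unfolding lap_avg_def neg_laplacian_power_partial_deriv[OF smooth_u b] eq by simp
  also have "\<dots> = avg_coeff 2 m * (2 * real (m + 2) / sqrt t * - (J / (sqrt t * t ^ m)))"
    using bump_avg_partial_deriv[OF _ smooth_f b t, of "m + 1" x] J by simp
  also have "\<dots> = - (avg_coeff 2 m * (2 * real (m + 2) / (t * t ^ m) * J))"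
  proof -
    have "a / sqrt t * (J / (sqrt t * c)) = a / (t * c) * J" for a c :: real
      using t by simp
    then show ?thesis using t by simp
  qed
  finally have L: "lap_avg 2 (partial_deriv b u) m x t = - (avg_coeff 2 m * (2 * real (m + 2) / (t * t ^ m) * J))" .
  have "(taylor_avg 2 (partial_deriv b u) (Suc n) x has_real_derivative
     - (t ^ n / fact n * lap_avg 2 (partial_deriv b u) (Suc n) x t)) (at t)"
    by (rule DERIV_taylor_avg) (auto simp: smooth_fun_partial_deriv smooth_u b t)
  also have "- (t ^ n / fact n * lap_avg 2 (partial_deriv b u) (Suc n) x t) = 2 * pot_coeff * (real (m + 2) / t\<^sup>2 * J)"
  proof -
    have "m - 1 = n" and tm: "t ^ m = t * t ^ n" by (simp_all add: n)
    then have pc: "pot_coeff = avg_coeff 2 m / fact n" unfolding pot_coeff_def by (simp only:)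
    show ?thesis unfolding n[symmetric] L pc tm using t by (simp add: power2_eq_square)
  qed
  also have "real (m + 2) / t\<^sup>2 * J = (\<integral>z. ((x - z) \<bullet> b) * (real (m + 2) / t\<^sup>2 * max 0 (1 - ((x - z) \<bullet> (x - z)) / t) ^ (m + 1)) * f z \<partial>lborel)"
    unfolding J_def by (subst integral_mult_right_zero[symmetric]) (simp add: mult_ac)
  finally show ?thesis by (simp add: n)
qed

text \<open>Up to the factor \<open>p + 1\<close> the kernel is at most
  \<open>\<rho> / max r (\<rho>^2)\<close> with \<open>\<rho>\<close> the distance, which is at most
  \<open>1 / r\<close> for \<open>\<rho> \<le> 1\<close> and at most 1 beyond.\<close>

lemma abs_kernel_le:
  assumes "r > 0" "b \<in> Basis"
  shows "\<bar>((x - z) \<bullet> b) * log_kernel_deriv p r ((x - z) \<bullet> (x - z))\<bar> \<le> real (Suc p) * (1 + 1 / r)"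
proof -
  define \<rho> where "\<rho> = norm (x - z)"
  have d: "(x - z) \<bullet> (x - z) = \<rho>\<^sup>2" by (simp add: \<rho>_def dot_square_norm)
  have "\<bar>(x - z) \<bullet> b\<bar> \<le> \<rho>" using Basis_le_norm[OF assms(2)] by (simp add: \<rho>_def)
  moreover have "\<bar>log_kernel_deriv p r (\<rho>\<^sup>2)\<bar> \<le> real (Suc p) / max r (\<rho>\<^sup>2)"
    by (rule abs_log_kernel_deriv_le) (use assms in auto)
  ultimately have "\<bar>((x - z) \<bullet> b) * log_kernel_deriv p r ((x - z) \<bullet> (x - z))\<bar> \<le> \<rho> * (real (Suc p) / max r (\<rho>\<^sup>2))"
    unfolding abs_mult d by (intro mult_mono) (auto simp: \<rho>_def)
  also have "\<dots> = real (Suc p) * (\<rho> / max r (\<rho>\<^sup>2))" by simp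
  also have "\<dots> \<le> real (Suc p) * (1 + 1 / r)"
  proof (rule mult_left_mono)
    have "\<rho> \<ge> 0" by (simp add: \<rho>_def)
    show "\<rho> / max r (\<rho>\<^sup>2) \<le> 1 + 1 / r"
    proof (cases "\<rho> \<le> 1")
      case True
      then have "\<rho> / max r (\<rho>\<^sup>2) \<le> 1 / r" using \<open>\<rho> \<ge> 0\<close> assms by (intro frac_le) auto
      then show ?thesis by simp
    next
      case False
      then have "\<rho> / max r (\<rho>\<^sup>2) \<le> \<rho> / \<rho>\<^sup>2" using assms by (intro divide_left_mono) auto
      also have "\<dots> \<le> 1" using False by (simp add: power2_eq_square)
      finally show ?thesis using assms by (simp add: add_increasing2)
    qed
  qed simp
  finally show ?thesis .
qed

lemma integrable_kernel:
  assumes "r > 0" "b \<in> Basis"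
  shows "integrable lborel (\<lambda>z. ((x - z) \<bullet> b) * log_kernel_deriv p r ((x - z) \<bullet> (x - z)) * f z)"
proof (rule Bochner_Integration.integrable_bound)
  show "integrable lborel (\<lambda>z. real (Suc p) * (1 + 1 / r) * \<bar>f z\<bar>)"
    using f_int by (intro integrable_mult_right) auto
  have "continuous_on UNIV (\<lambda>z. ((x - z) \<bullet> b) * log_kernel_deriv p r ((x - z) \<bullet> (x - z)) * f z)"
    by (intro continuous_intros continuous_on_log_kernel_deriv smooth_fun_continuous[OF smooth_f] assms)
  then show "(\<lambda>z. ((x - z) \<bullet> b) * log_kernel_deriv p r ((x - z) \<bullet> (x - z)) * f z) \<in> borel_measurable lborel"
    by (simp add: borel_measurable_continuous_onI)
  show "AE z in lborel. norm (((x - z) \<bullet> b) * log_kernel_deriv p r ((x - z) \<bullet> (x - z)) * f z)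
      \<le> norm (real (Suc p) * (1 + 1 / r) * \<bar>f z\<bar>)"
  proof (rule AE_I2)
    fix z
    have "\<bar>((x - z) \<bullet> b) * log_kernel_deriv p r ((x - z) \<bullet> (x - z))\<bar> * \<bar>f z\<bar> \<le> real (Suc p) * (1 + 1 / r) * \<bar>f z\<bar>"
      by (rule mult_right_mono[OF abs_kernel_le[OF assms]]) simp
    also have "\<dots> \<le> \<bar>real (Suc p) * (1 + 1 / r) * \<bar>f z\<bar>\<bar>" by (rule abs_ge_self)
    finally show "norm (((x - z) \<bullet> b) * log_kernel_deriv p r ((x - z) \<bullet> (x - z)) * f z)
      \<le> norm (real (Suc p) * (1 + 1 / r) * \<bar>f z\<bar>)" by (simp add: abs_mult)
  qed
qed

lemma DERIV_grad_pot:
  assumes b: "b \<in> Basis" and r: "r > 0"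
  shows "(grad_pot b x has_real_derivative
     2 * pot_coeff * (\<integral>z. ((x - z) \<bullet> b) * (real (m + 2) / r\<^sup>2 * max 0 (1 - ((x - z) \<bullet> (x - z)) / r) ^ (m + 1)) * f z \<partial>lborel)) (at r)"
proof -
  let ?p = "m + 1"
  let ?k = "\<lambda>s z. ((x - z) \<bullet> b) * log_kernel_deriv ?p s ((x - z) \<bullet> (x - z)) * f z"
  let ?k' = "\<lambda>s z. ((x - z) \<bullet> b) * (real (m + 2) / s\<^sup>2 * max 0 (1 - ((x - z) \<bullet> (x - z)) / s) ^ ?p) * f z"
  obtain c d :: 'a where cd: "cball x (sqrt (2 * r)) \<subseteq> cbox c d"
    using bounded_cbox_containing[OF bounded_cball] by blast
  \<comment> \<open>The kernel itself is not compactly supported, but its difference from the kernel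
    at the fixed scale \<open>r\<close> is, since both are given by \<open>- 1 / d\<close> far
    away.\<close>
  have "((\<lambda>s. \<integral>z. ?k s z - ?k r z \<partial>lborel) has_real_derivative (\<integral>z. ?k' r z \<partial>lborel)) (at r)"
  proof (rule DERIV_integral_compact_support[where p="r/2" and q="2*r" and c=c and d=d and \<phi>'="?k'"])
    show "((\<lambda>s. ?k s z - ?k r z) has_real_derivative ?k' s z) (at s)" if "s \<in> {r/2<..<2*r}" for s z
    proof -
      have "((\<lambda>s. log_kernel_deriv ?p s ((x - z) \<bullet> (x - z))) has_real_derivative
          real (m + 2) / s\<^sup>2 * max 0 (1 - ((x - z) \<bullet> (x - z)) / s) ^ ?p) (at s)"
        using DERIV_log_kernel_deriv[of ?p s "(x - z) \<bullet> (x - z)"] that r by simp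
      from DERIV_diff[OF DERIV_cmult_right[OF DERIV_cmult[OF this]] DERIV_const]
      show ?thesis by simp
    qed
    show "continuous_on UNIV (\<lambda>z. ?k s z - ?k r z)" if "s \<in> {r/2<..<2*r}" for s
      by (intro continuous_intros continuous_on_log_kernel_deriv smooth_fun_continuous[OF smooth_f])
        (use that r in auto)
    show "continuous_on ({r/2<..<2*r} \<times> UNIV) (\<lambda>(s, z). ?k' s z)"
      unfolding case_prod_beta
      by (intro continuous_intros smooth_fun_continuous_compose[OF smooth_f]) (use r in auto)
    show "?k s z - ?k r z = 0" if "s \<in> {r/2<..<2*r}" "z \<notin> cbox c d" for s z
    proof -
      have "norm (x - z) > sqrt (2 * r)" using that(2) cd by (auto simp: dist_norm subset_iff not_le)
      then have "(norm (x - z))\<^sup>2 > 2 * r"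
        using r by (metis abs_norm_cancel real_sqrt_abs real_sqrt_less_iff)
      then have "(x - z) \<bullet> (x - z) \<ge> 2 * r" by (simp add: dot_square_norm)
      then show ?thesis using log_kernel_deriv_far[of s "(x - z) \<bullet> (x - z)" ?p]
          log_kernel_deriv_far[of r "(x - z) \<bullet> (x - z)" ?p] that r by simp
    qed
  qed (use r in auto)
  from DERIV_add[OF DERIV_cmult[OF this, of "2 * pot_coeff"] DERIV_const[of "grad_pot b x r"]]
  have "((\<lambda>s. 2 * pot_coeff * (\<integral>z. ?k s z - ?k r z \<partial>lborel) + grad_pot b x r) has_real_derivative
      2 * pot_coeff * (\<integral>z. ?k' r z \<partial>lborel)) (at r)" by simp
  then show ?thesis
  proof (rule has_field_derivative_transform_within_open[where S="{0<..}"])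
    show "2 * pot_coeff * (\<integral>z. ?k s z - ?k r z \<partial>lborel) + grad_pot b x r = grad_pot b x s" if "s \<in> {0<..}" for s
    proof -
      have "s > 0" using that by simp
      from Bochner_Integration.integral_diff[OF integrable_kernel[OF this b] integrable_kernel[OF r b]]
      show ?thesis unfolding grad_pot_def by (simp only: right_diff_distrib diff_add_cancel)
    qed
  qed (use r in auto)
qed

text \<open>For \<open>r \<ge> 1\<close> the kernel is bounded independently of \<open>r\<close>,
  and at each fixed \<open>z\<close> it is of order \<open>1 / r\<close>.\<close>

lemma grad_pot_tendsto_0:
  assumes b: "b \<in> Basis"
  shows "(grad_pot b x \<longlongrightarrow> 0) at_top"
proof -
  let ?p = "m + 1"
  have "((\<lambda>r. \<integral>z. ((x - z) \<bullet> b) * log_kernel_deriv ?p r ((x - z) \<bullet> (x - z)) * f z \<partial>lborel) \<longlongrightarrow> (\<integral>z. 0 \<partial>(lborel :: 'a measure))) at_top"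
  proof (rule integral_dominated_convergence_at_top[where w="\<lambda>z. real (Suc ?p) * 2 * \<bar>f z\<bar>"])
    show "integrable lborel (\<lambda>z. real (Suc ?p) * 2 * \<bar>f z\<bar>)"
      using f_int by (intro integrable_mult_right) auto
    show "\<forall>\<^sub>F r in at_top. AE z in lborel. norm (((x - z) \<bullet> b) * log_kernel_deriv ?p r ((x - z) \<bullet> (x - z)) * f z)
        \<le> real (Suc ?p) * 2 * \<bar>f z\<bar>"
      using eventually_ge_at_top[of 1]
    proof eventually_elim
      case (elim r)
      show ?case
      proof (rule AE_I2)
        fix z
        have "\<bar>((x - z) \<bullet> b) * log_kernel_deriv ?p r ((x - z) \<bullet> (x - z))\<bar> \<le> real (Suc ?p) * (1 + 1 / r)"
          using elim b by (intro abs_kernel_le) auto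
        also have "\<dots> \<le> real (Suc ?p) * 2" using elim by (intro mult_left_mono) auto
        finally have "\<bar>((x - z) \<bullet> b) * log_kernel_deriv ?p r ((x - z) \<bullet> (x - z))\<bar> * \<bar>f z\<bar> \<le> real (Suc ?p) * 2 * \<bar>f z\<bar>"
          by (rule mult_right_mono) simp
        then show "norm (((x - z) \<bullet> b) * log_kernel_deriv ?p r ((x - z) \<bullet> (x - z)) * f z) \<le> real (Suc ?p) * 2 * \<bar>f z\<bar>"
          by (simp add: abs_mult)
      qed
    qed
    show "AE z in lborel. ((\<lambda>r. ((x - z) \<bullet> b) * log_kernel_deriv ?p r ((x - z) \<bullet> (x - z)) * f z) \<longlongrightarrow> 0) at_top"
    proof (rule AE_I2)
      fix z
      have "((\<lambda>r. log_kernel_deriv ?p r ((x - z) \<bullet> (x - z))) \<longlongrightarrow> 0) at_top"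
      proof (rule Lim_null_comparison)
        show "((\<lambda>r. real (Suc ?p) * inverse r) \<longlongrightarrow> 0) at_top"
          by (intro tendsto_mult_right_zero tendsto_inverse_0_at_top filterlim_ident)
        show "\<forall>\<^sub>F r in at_top. norm (log_kernel_deriv ?p r ((x - z) \<bullet> (x - z))) \<le> real (Suc ?p) * inverse r"
          using eventually_gt_at_top[of 0]
        proof eventually_elim
          case (elim r)
          have "\<bar>log_kernel_deriv ?p r ((x - z) \<bullet> (x - z))\<bar> \<le> real (Suc ?p) / max r ((x - z) \<bullet> (x - z))"
            using elim by (intro abs_log_kernel_deriv_le) auto
          also have "\<dots> \<le> real (Suc ?p) / r" using elim by (intro divide_left_mono) auto
          finally show ?case by (simp add: divide_inverse)
        qed
      qed
      then show "((\<lambda>r. ((x - z) \<bullet> b) * log_kernel_deriv ?p r ((x - z) \<bullet> (x - z)) * f z) \<longlongrightarrow> 0) at_top"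
        by (intro tendsto_mult_left_zero tendsto_mult_right_zero)
    qed
    show "(\<lambda>z. ((x - z) \<bullet> b) * log_kernel_deriv ?p r ((x - z) \<bullet> (x - z)) * f z) \<in> borel_measurable lborel" for r
      unfolding log_kernel_deriv_def using borel_measurable_integrable[OF f_int] by measurable
  qed simp
  from tendsto_mult[OF tendsto_const[of "2 * pot_coeff"] this]
  show ?thesis by (simp add: grad_pot_def[abs_def])
qed

text \<open>Both sides have the same derivative in \<open>r\<close> and vanish as \<open>r\<close>
  tends to infinity. No singular integral has to be differentiated: the identity is proved at
  positive scales, and at \<open>r = 0\<close> the left side is a multiple of the derivative of
  \<open>u\<close> itself.\<close>

lemma taylor_avg_partial_deriv_eq:
  assumes b: "b \<in> Basis" and r: "r > 0"
  shows "taylor_avg 2 (partial_deriv b u) m x r = grad_pot b x r"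
proof -
  let ?D = "\<lambda>r. taylor_avg 2 (partial_deriv b u) m x r - grad_pot b x r"
  have "\<exists>c. \<forall>r\<in>{0<..}. ?D r = c"
  proof (rule has_field_derivative_zero_constant)
    fix r :: real assume "r \<in> {0<..}"
    then have r: "r > 0" by simp
    from DERIV_diff[OF DERIV_taylor_avg_partial_deriv[OF b r, of x] DERIV_grad_pot[OF b r, of x]]
    have "(?D has_field_derivative 0) (at r)" by (simp only: diff_self)
    then show "(?D has_field_derivative 0) (at r within {0<..})" by (rule has_field_derivative_at_within)
  qed simp
  then obtain c where c: "\<And>r. r > 0 \<Longrightarrow> ?D r = c" by auto
  have "(?D \<longlongrightarrow> 0 - 0) at_top"
    by (intro tendsto_diff taylor_avg_partial_deriv_tendsto_0 grad_pot_tendsto_0 b)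
  moreover have "\<forall>\<^sub>F r in at_top. ?D r = c"
    using eventually_gt_at_top[of 0] by eventually_elim (use c in auto)
  ultimately have "((\<lambda>r::real. c) \<longlongrightarrow> 0) at_top" by (simp add: tendsto_cong)
  then have "c = 0" by (simp add: tendsto_const_iff)
  then show ?thesis using c[OF r] by simp
qed

end

section \<open>The symmetrized potential identity\<close>

text \<open>A compactly supported stand-in for the dilation field; exponent 2 rather than 1 makes it
  continuously differentiable across the sphere of radius \<open>R\<close>.\<close>

definition cutoff_field :: "real \<Rightarrow> 'a::euclidean_space \<Rightarrow> 'a" where
  "cutoff_field R x = bump 2 (x /\<^sub>R R) *\<^sub>R x"

lemma bump_eq_min:
  "bump j y = (1 - (min 1 (norm y))\<^sup>2) ^ j"
proof (cases "norm y \<le> 1")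
  case True
  then have "(norm y)\<^sup>2 \<le> 1" by (simp add: power_le_one)
  then show ?thesis using True by (simp add: bump_def dot_square_norm)
next
  case False
  then have "(norm y)\<^sup>2 \<ge> 1" by (simp add: one_le_power)
  then show ?thesis using False by (simp add: bump_def dot_square_norm)
qed

text \<open>In terms of the truncated norms \<open>a\<close> and \<open>b\<close> the difference
  factors as \<open>(b - a) (a + b) (2 - a^2 - b^2)\<close>, and the last two factors are at most 2
  each.\<close>

lemma bump_2_lipschitz: "\<bar>bump 2 x - bump 2 y\<bar> \<le> 4 * norm (x - y)"
proof -
  define a b where "a = min 1 (norm x)" and "b = min 1 (norm y)"
  have ab: "0 \<le> a" "a \<le> 1" "0 \<le> b" "b \<le> 1" by (auto simp: a_def b_def)
  have d: "\<bar>a - b\<bar> \<le> norm (x - y)"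
    using norm_triangle_ineq3[of x y] by (auto simp: a_def b_def)
  have "bump 2 x - bump 2 y = (b - a) * ((a + b) * (2 - a\<^sup>2 - b\<^sup>2))"
    unfolding bump_eq_min a_def[symmetric] b_def[symmetric] by (simp add: power2_eq_square algebra_simps)
  moreover have "\<bar>(a + b) * (2 - a\<^sup>2 - b\<^sup>2)\<bar> \<le> 4"
  proof -
    have "a\<^sup>2 \<le> 1" "b\<^sup>2 \<le> 1" using ab by (auto simp: power_le_one)
    then have "0 \<le> 2 - a\<^sup>2 - b\<^sup>2" "2 - a\<^sup>2 - b\<^sup>2 \<le> 2" by auto
    moreover have "0 \<le> a + b" "a + b \<le> 2" using ab by auto
    ultimately have "\<bar>a + b\<bar> * \<bar>2 - a\<^sup>2 - b\<^sup>2\<bar> \<le> 2 * 2" by (intro mult_mono) auto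
    then show ?thesis by (simp add: abs_mult)
  qed
  moreover have "\<bar>b - a\<bar> * \<bar>(a + b) * (2 - a\<^sup>2 - b\<^sup>2)\<bar> \<le> norm (x - y) * 4"
    using d calculation(2) by (intro mult_mono) auto
  ultimately show ?thesis by (simp add: abs_mult)
qed

text \<open>The cut-off has slope at most \<open>4 / R\<close> and multiplies a vector of length at
  most \<open>R\<close>; its own size adds 1. Independence of \<open>R\<close> is the point, as it
  dominates the limit \<open>R\<close> to infinity. It suffices that one of the points lies in the
  ball, since otherwise both values are 0.\<close>

lemma cutoff_field_lipschitz:
  fixes x z :: "'a::euclidean_space"
  assumes R: "R > 0"
  shows "norm (cutoff_field R x - cutoff_field R z) \<le> 5 * norm (x - z)"
proof -
  have in_ball: "norm (cutoff_field R x - cutoff_field R z) \<le> 5 * norm (x - z)" if "norm x \<le> R" for x z :: 'a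
  proof -
    have eq: "cutoff_field R x - cutoff_field R z
      = bump 2 (z /\<^sub>R R) *\<^sub>R (x - z) + (bump 2 (x /\<^sub>R R) - bump 2 (z /\<^sub>R R)) *\<^sub>R x"
      by (simp add: cutoff_field_def algebra_simps)
    have 1: "norm (bump 2 (z /\<^sub>R R) *\<^sub>R (x - z)) \<le> 1 * norm (x - z)"
      unfolding norm_scaleR using bump_le_one[of 2 "z /\<^sub>R R"] by (intro mult_right_mono) auto
    have "\<bar>bump 2 (x /\<^sub>R R) - bump 2 (z /\<^sub>R R)\<bar> \<le> 4 * norm (x /\<^sub>R R - z /\<^sub>R R)"
      by (rule bump_2_lipschitz)
    also have "\<dots> = 4 * (norm (x - z) / R)"
      using R by (simp add: divide_inverse mult.commute flip: scaleR_right_diff_distrib)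
    finally have "\<bar>bump 2 (x /\<^sub>R R) - bump 2 (z /\<^sub>R R)\<bar> * norm x \<le> 4 * (norm (x - z) / R) * R"
      using that R by (intro mult_mono) auto
    then have 2: "norm ((bump 2 (x /\<^sub>R R) - bump 2 (z /\<^sub>R R)) *\<^sub>R x) \<le> 4 * norm (x - z)"
      using R by simp
    show ?thesis unfolding eq using norm_triangle_le[OF add_mono[OF 1 2]] by simp
  qed
  show ?thesis
  proof (cases "norm x \<le> R")
    case True
    then show ?thesis by (rule in_ball)
  next
    case x: False
    show ?thesis
    proof (cases "norm z \<le> R")
      case True
      then show ?thesis using in_ball[of z x] by (simp add: norm_minus_commute)
    next
      case False
      have "bump 2 (y /\<^sub>R R) = 0" if "\<not> norm y \<le> R" for y :: 'a
        by (rule bump_zero_outside) (use that R in \<open>auto simp: field_simps\<close>)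
      then show ?thesis using x False by (simp add: cutoff_field_def)
    qed
  qed
qed

lemma norm_cutoff_field_le:
  assumes "R > 0"
  shows "norm (cutoff_field R x) \<le> 5 * norm x"
  using cutoff_field_lipschitz[OF assms, of x 0] by (simp add: cutoff_field_def)

lemma cutoff_field_outside:
  assumes "R > 0" "norm x \<ge> R"
  shows "cutoff_field R x = 0"
proof -
  have "bump 2 (x /\<^sub>R R) = 0"
    by (rule bump_zero_outside) (use assms in \<open>auto simp: field_simps\<close>)
  then show ?thesis by (simp add: cutoff_field_def)
qed

lemma continuous_on_cutoff_field:
  assumes "continuous_on S h"
  shows "continuous_on S (\<lambda>x. cutoff_field R (h x))"
  unfolding cutoff_field_def by (intro continuous_intros assms)

lemma bump_scaled_tendsto_1:
  fixes x :: "'a::euclidean_space"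
  shows "((\<lambda>R. bump j (x /\<^sub>R R)) \<longlongrightarrow> 1) at_top"
proof -
  have lim: "((\<lambda>R. x /\<^sub>R R) \<longlongrightarrow> 0 *\<^sub>R x) at_top"
    by (intro tendsto_scaleR tendsto_const tendsto_inverse_0_at_top filterlim_ident)
  have "((\<lambda>R. max 0 (1 - (x /\<^sub>R R) \<bullet> (x /\<^sub>R R)) ^ j) \<longlongrightarrow> max 0 (1 - (0 *\<^sub>R x) \<bullet> (0 *\<^sub>R x)) ^ j) at_top"
    by (intro tendsto_power tendsto_max tendsto_const tendsto_diff tendsto_inner lim)
  then show ?thesis by (simp add: bump_def)
qed

lemma cutoff_field_tendsto: "((\<lambda>R. cutoff_field R x) \<longlongrightarrow> x) at_top"
  unfolding cutoff_field_def using tendsto_scaleR[OF bump_scaled_tendsto_1 tendsto_const, of 2 x x] by simp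

context polyharmonic
begin

definition bump_mass where "bump_mass = (\<integral>y. bump 2 (y :: 'a) \<partial>lborel)"

lemma bump_mass_pos: "bump_mass > 0"
  unfolding bump_mass_def by (rule bump_integral_pos) simp

definition total where "total = (\<integral>z. f z \<partial>lborel)"

lemma f_measurable [measurable]: "f \<in> borel_measurable borel"
  using f_int by auto

section \<open>Double integrals against f(x) f(z)\<close>

lemma integrable_f_f: "integrable (lborel :: ('a \<times> 'a) measure) (\<lambda>p. f (fst p) * f (snd p))"
proof -
  have "integrable (lborel \<Otimes>\<^sub>M (lborel :: 'a measure)) (\<lambda>p. f (fst p) * f (snd p))"
  proof (rule lborel_pair.Fubini_integrable)
    show "(\<lambda>p. f (fst p) * f (snd p)) \<in> borel_measurable (lborel \<Otimes>\<^sub>M (lborel :: 'a measure))"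
      by measurable
    have "(\<lambda>x. \<integral>y. norm (f (fst (x, y)) * f (snd (x, y))) \<partial>lborel) = (\<lambda>x. \<bar>f x\<bar> * mass)"
      by (simp add: abs_mult mass_def)
    then show "integrable lborel (\<lambda>x. \<integral>y. norm (f (fst (x, y)) * f (snd (x, y))) \<partial>lborel)"
      using f_int by simp
    show "AE x in lborel. integrable lborel (\<lambda>y. f (fst (x, y)) * f (snd (x, y)))"
      using f_int by simp
  qed
  then show ?thesis by (simp add: lborel_prod)
qed

lemma integrable_f_f_bounded:
  fixes w :: "'a \<times> 'a \<Rightarrow> real"
  assumes "w \<in> borel_measurable borel" "\<And>p. \<bar>w p\<bar> \<le> B"
  shows "integrable lborel (\<lambda>p. w p * (f (fst p) * f (snd p)))"
proof (rule Bochner_Integration.integrable_bound)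
  show "integrable lborel (\<lambda>p. B * (f (fst p) * f (snd p)))"
    by (intro integrable_mult_right integrable_f_f)
  show "(\<lambda>p. w p * (f (fst p) * f (snd p))) \<in> borel_measurable lborel"
    using assms(1) borel_measurable_integrable[OF integrable_f_f] by measurable
  show "AE p in lborel. norm (w p * (f (fst p) * f (snd p))) \<le> norm (B * (f (fst p) * f (snd p)))"
  proof (rule AE_I2)
    fix p
    have "\<bar>w p\<bar> \<le> \<bar>B\<bar>" using assms(2)[of p] by linarith
    then show "norm (w p * (f (fst p) * f (snd p))) \<le> norm (B * (f (fst p) * f (snd p)))"
      by (simp add: abs_mult mult_right_mono)
  qed
qed

text \<open>Tests the extrapolated gradient averages at scale \<open>r\<close> with the cut-off
  field. At \<open>r = 0\<close> it is a multiple of the integral with the true gradient; for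
  \<open>r > 0\<close> the regularized potential can be inserted.\<close>

definition flux where
  "flux R r = (\<integral>x. (\<Sum>b\<in>Basis. (cutoff_field R x \<bullet> b) * taylor_avg 2 (partial_deriv b u) m x r) * f x \<partial>lborel)"

lemma flux_at_0:
  "flux R 0 = bump_mass * (\<integral>x. (cutoff_field R x \<bullet> gradient u x) * f x \<partial>lborel)"
proof -
  obtain n where n: "m = Suc n" using m2 by (cases m) auto
  have "(\<Sum>b\<in>Basis. (cutoff_field R x \<bullet> b) * taylor_avg 2 (partial_deriv b u) m x 0) * f x
     = bump_mass * ((cutoff_field R x \<bullet> gradient u x) * f x)" for x
    unfolding n taylor_avg_at_0 gradient_def inner_sum_right
    by (simp add: bump_mass_def sum_distrib_left sum_distrib_right mult_ac)
  then show ?thesis unfolding flux_def by (simp only: integral_mult_right_zero)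
qed

lemma flux_tendsto:
  assumes R: "R > 0"
  shows "(flux R \<longlongrightarrow> flux R 0) (at_right 0)"
proof -
  obtain c d :: 'a where cd: "cball 0 R \<subseteq> cbox c d"
    using bounded_cbox_containing[OF bounded_cball] by blast
  let ?h = "\<lambda>r x. (\<Sum>b\<in>Basis. (cutoff_field R x \<bullet> b) * taylor_avg 2 (partial_deriv b u) m x r) * f x"
  have T: "continuous_on S (\<lambda>p. taylor_avg 2 (partial_deriv b u) m (F p) (G p))"
    if "b \<in> Basis" "continuous_on S F" "continuous_on S G" for S :: "'s::topological_space set" and F G b
  proof -
    have "continuous_on UNIV (\<lambda>p. taylor_avg 2 (partial_deriv b u) m (fst p) (snd p))"
      by (rule continuous_on_taylor_avg) (use that in \<open>auto intro: smooth_fun_partial_deriv smooth_u\<close>)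
    from continuous_on_compose2[OF this continuous_on_Pair[OF that(2,3)]] show ?thesis by simp
  qed
  have "flux R r = integral (cbox c d) (?h r)" for r
    unfolding flux_def
  proof (rule integral_cbox_support)
    show "continuous_on UNIV (?h r)"
      by (intro continuous_intros continuous_on_cutoff_field T smooth_fun_continuous[OF smooth_f])
    show "?h r y = 0" if "y \<notin> cbox c d" for y
    proof -
      have "norm y \<ge> R" using that cd by (meson linear mem_cball_0 subsetD)
      then have "cutoff_field R y = 0" by (rule cutoff_field_outside[OF R])
      then show ?thesis by simp
    qed
  qed
  \<comment> \<open>Continuity holds for all real \<open>r\<close>, because \<open>sqrt\<close> is
    continuous on the whole line; so 0 is an interior point.\<close>
  moreover have "continuous_on UNIV (\<lambda>r. integral (cbox c d) (?h r))"
  proof (rule integral_continuous_on_param)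
    show "continuous_on (UNIV \<times> cbox c d) (\<lambda>(r, x). ?h r x)"
      unfolding case_prod_beta
      by (intro continuous_intros continuous_on_cutoff_field T smooth_fun_continuous_compose[OF smooth_f])
  qed
  ultimately have "continuous_on UNIV (flux R)" by presburger
  then have "isCont (flux R) 0"
    by (simp add: continuous_on_eq_continuous_at)
  then show ?thesis
    by (simp add: isCont_def filterlim_at_split)
qed

lemma abs_sum_kernel_le:
  fixes x z :: 'a
  assumes "r > 0" "R > 0"
  shows "\<bar>(cutoff_field R x \<bullet> (x - z)) * log_kernel_deriv p r ((x - z) \<bullet> (x - z))\<bar>
    \<le> real DIM('a) * (5 * R * (real (Suc p) * (1 + 1 / r)))"
proof -
  have n: "norm (cutoff_field R x) \<le> 5 * R"
  proof (cases "norm x \<ge> R")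
    case True
    then have "cutoff_field R x = 0" by (rule cutoff_field_outside[OF assms(2)])
    then show ?thesis using assms by simp
  next
    case False
    then show ?thesis using norm_cutoff_field_le[OF assms(2), of x] by linarith
  qed
  have "(cutoff_field R x \<bullet> (x - z)) * log_kernel_deriv p r ((x - z) \<bullet> (x - z))
     = (\<Sum>b\<in>Basis. (cutoff_field R x \<bullet> b) * (((x - z) \<bullet> b) * log_kernel_deriv p r ((x - z) \<bullet> (x - z))))"
    unfolding euclidean_inner[of "cutoff_field R x" "x - z"] sum_distrib_right by (simp add: mult_ac)
  also have "\<bar>\<dots>\<bar> \<le> (\<Sum>b\<in>Basis. \<bar>(cutoff_field R x \<bullet> b) * (((x - z) \<bullet> b) * log_kernel_deriv p r ((x - z) \<bullet> (x - z)))\<bar>)"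
    by (rule sum_abs)
  also have "\<dots> \<le> (\<Sum>b\<in>(Basis::'a set). 5 * R * (real (Suc p) * (1 + 1 / r)))"
  proof (rule sum_mono)
    fix b :: 'a assume b: "b \<in> Basis"
    have "\<bar>cutoff_field R x \<bullet> b\<bar> \<le> 5 * R" using Basis_le_norm[OF b, of "cutoff_field R x"] n by linarith
    then show "\<bar>(cutoff_field R x \<bullet> b) * (((x - z) \<bullet> b) * log_kernel_deriv p r ((x - z) \<bullet> (x - z)))\<bar>
       \<le> 5 * R * (real (Suc p) * (1 + 1 / r))"
      unfolding abs_mult[of "cutoff_field R x \<bullet> b"] using abs_kernel_le[OF assms(1) b, of x z p] assms
      by (intro mult_mono) auto
  qed
  finally show ?thesis by simp
qed

text \<open>The scalar factor is symmetric in \<open>x\<close> and \<open>z\<close> while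
  \<open>x - z\<close> changes sign, so adding the integral with swapped variables replaces the
  field by its difference at the two points and absorbs the factor 2 of \<open>grad_pot\<close>. The
  cut-off and \<open>r > 0\<close> keep the weight bounded, which justifies Fubini.\<close>

lemma flux_eq_symmetric:
  assumes r: "r > 0" and R: "R > 0"
  shows "flux R r = pot_coeff * (\<integral>p. (((cutoff_field R (fst p) - cutoff_field R (snd p)) \<bullet> (fst p - snd p))
     * log_kernel_deriv (m + 1) r ((fst p - snd p) \<bullet> (fst p - snd p))) * (f (fst p) * f (snd p)) \<partial>lborel)"
proof -
  define k where "k p = log_kernel_deriv (m + 1) r ((fst p - snd p) \<bullet> (fst p - snd p))" for p :: "'a \<times> 'a"
  define \<Phi> where "\<Phi> p = ((cutoff_field R (fst p) \<bullet> (fst p - snd p)) * k p) * (f (fst p) * f (snd p))" for p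
  have kc: "continuous_on UNIV k"
    unfolding k_def by (intro continuous_on_log_kernel_deriv continuous_intros r)
  have \<Phi>: "integrable lborel \<Phi>"
    unfolding \<Phi>_def
  proof (rule integrable_f_f_bounded)
    show "(\<lambda>p. (cutoff_field R (fst p) \<bullet> (fst p - snd p)) * k p) \<in> borel_measurable borel"
      by (intro borel_measurable_continuous_onI continuous_intros continuous_on_cutoff_field kc)
    show "\<bar>(cutoff_field R (fst p) \<bullet> (fst p - snd p)) * k p\<bar>
        \<le> real DIM('a) * (5 * R * (real (Suc (m + 1)) * (1 + 1 / r)))" for p
      unfolding k_def by (rule abs_sum_kernel_le[OF r R])
  qed
  then have \<Phi>2: "integrable (lborel \<Otimes>\<^sub>M (lborel :: 'a measure)) \<Phi>" by (simp add: lborel_prod)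
  then have \<Phi>3: "integrable (lborel \<Otimes>\<^sub>M (lborel :: 'a measure)) (\<lambda>(x, z). \<Phi> (x, z))"
    by (simp add: case_prod_unfold)
  have swap: "(\<integral>p. \<Phi> (snd p, fst p) \<partial>(lborel \<Otimes>\<^sub>M (lborel :: 'a measure))) = (\<integral>p. \<Phi> p \<partial>(lborel \<Otimes>\<^sub>M lborel))"
    using lborel_pair.integral_product_swap[of \<Phi>] borel_measurable_integrable[OF \<Phi>2]
    by (simp add: case_prod_unfold)
  have \<Phi>4: "integrable (lborel \<Otimes>\<^sub>M (lborel :: 'a measure)) (\<lambda>p. \<Phi> (snd p, fst p))"
    using lborel_pair.integrable_product_swap[OF \<Phi>2] by (simp add: case_prod_unfold)
  have "flux R r = (\<integral>x. 2 * pot_coeff * (\<integral>z. \<Phi> (x, z) \<partial>lborel) \<partial>lborel)"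
    unfolding flux_def
  proof (rule Bochner_Integration.integral_cong[OF refl])
    fix x
    have i: "integrable lborel (\<lambda>z. ((x - z) \<bullet> b) * k (x, z) * f z)" if "b \<in> Basis" for b
      using integrable_kernel[OF r that, of x "m + 1"] by (simp add: k_def)
    have "(\<Sum>b\<in>Basis. (cutoff_field R x \<bullet> b) * taylor_avg 2 (partial_deriv b u) m x r) * f x
       = 2 * pot_coeff * (f x * (\<Sum>b\<in>Basis. (cutoff_field R x \<bullet> b) * (\<integral>z. ((x - z) \<bullet> b) * k (x, z) * f z \<partial>lborel)))"
      using r by (simp add: taylor_avg_partial_deriv_eq grad_pot_def k_def sum_distrib_left sum_distrib_right mult_ac)
    also have "(\<Sum>b\<in>Basis. (cutoff_field R x \<bullet> b) * (\<integral>z. ((x - z) \<bullet> b) * k (x, z) * f z \<partial>lborel))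
       = (\<integral>z. (\<Sum>b\<in>Basis. (cutoff_field R x \<bullet> b) * (((x - z) \<bullet> b) * k (x, z) * f z)) \<partial>lborel)"
      using i by simp
    also have "\<dots> = (\<integral>z. (cutoff_field R x \<bullet> (x - z)) * (k (x, z) * f z) \<partial>lborel)"
    proof -
      have "(\<Sum>b\<in>Basis. (cutoff_field R x \<bullet> b) * (((x - z) \<bullet> b) * k (x, z) * f z))
          = (cutoff_field R x \<bullet> (x - z)) * (k (x, z) * f z)" for z
        unfolding euclidean_inner[of "cutoff_field R x" "x - z"] sum_distrib_right by (simp add: mult_ac)
      then show ?thesis by (simp only:)
    qed
    also have "f x * \<dots> = (\<integral>z. \<Phi> (x, z) \<partial>lborel)"
      unfolding \<Phi>_def by (subst integral_mult_right_zero[symmetric]) (simp add: mult_ac)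
    finally show "(\<Sum>b\<in>Basis. (cutoff_field R x \<bullet> b) * taylor_avg 2 (partial_deriv b u) m x r) * f x
      = 2 * pot_coeff * (\<integral>z. \<Phi> (x, z) \<partial>lborel)" .
  qed
  also have "\<dots> = 2 * pot_coeff * (\<integral>p. \<Phi> p \<partial>(lborel \<Otimes>\<^sub>M lborel))"
    using lborel_pair.integral_fst'[OF \<Phi>2] by simp
  also have "\<dots> = pot_coeff * ((\<integral>p. \<Phi> p \<partial>(lborel \<Otimes>\<^sub>M lborel)) + (\<integral>p. \<Phi> (snd p, fst p) \<partial>(lborel \<Otimes>\<^sub>M lborel)))"
    by (simp add: swap)
  also have "(\<integral>p. \<Phi> p \<partial>(lborel \<Otimes>\<^sub>M lborel)) + (\<integral>p. \<Phi> (snd p, fst p) \<partial>(lborel \<Otimes>\<^sub>M lborel))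
     = (\<integral>p. \<Phi> p + \<Phi> (snd p, fst p) \<partial>(lborel \<Otimes>\<^sub>M lborel))"
    by (rule Bochner_Integration.integral_add[symmetric, OF \<Phi>2 \<Phi>4])
  also have "\<dots> = (\<integral>p. (((cutoff_field R (fst p) - cutoff_field R (snd p)) \<bullet> (fst p - snd p)) * k p) * (f (fst p) * f (snd p)) \<partial>lborel)"
    unfolding lborel_prod
  proof (rule Bochner_Integration.integral_cong[OF refl])
    fix p :: "'a \<times> 'a"
    have "k (snd p, fst p) = k p" by (simp add: k_def inner_diff_left inner_diff_right algebra_simps)
    then show "\<Phi> p + \<Phi> (snd p, fst p) = (((cutoff_field R (fst p) - cutoff_field R (snd p)) \<bullet> (fst p - snd p)) * k p) * (f (fst p) * f (snd p))"
      by (simp add: \<Phi>_def inner_diff_left inner_diff_right algebra_simps)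
  qed
  finally show ?thesis by (simp add: k_def)
qed

text \<open>For the field \<open>x\<close> without cut-off this would be 1 off the diagonal. On the
  diagonal it is 0, by the convention for division by zero.\<close>

definition dilation_quotient where
  "dilation_quotient R p = ((cutoff_field R (fst p) - cutoff_field R (snd p)) \<bullet> (fst p - snd p)) /
     ((fst p - snd p) \<bullet> (fst p - snd p))" for p :: "'a \<times> 'a"

lemma cutoff_inner_le:
  assumes "R > 0"
  shows "\<bar>(cutoff_field R x - cutoff_field R z) \<bullet> (x - z)\<bar> \<le> 5 * ((x - z) \<bullet> (x - z))"
proof -
  have "\<bar>(cutoff_field R x - cutoff_field R z) \<bullet> (x - z)\<bar> \<le> norm (cutoff_field R x - cutoff_field R z) * norm (x - z)"
    by (rule Cauchy_Schwarz_ineq2)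
  also have "\<dots> \<le> (5 * norm (x - z)) * norm (x - z)"
    by (intro mult_right_mono cutoff_field_lipschitz assms) simp
  finally show ?thesis by (simp add: dot_square_norm power2_eq_square)
qed

lemma abs_dilation_quotient_le:
  assumes "R > 0"
  shows "\<bar>dilation_quotient R p\<bar> \<le> 5"
proof (cases "fst p = snd p")
  case False
  then have d: "(fst p - snd p) \<bullet> (fst p - snd p) > 0" by simp
  show ?thesis
    unfolding dilation_quotient_def abs_div_pos[OF d, symmetric] pos_divide_le_eq[OF d]
    by (rule cutoff_inner_le[OF assms])
qed (simp add: dilation_quotient_def)

lemma measurable_dilation_quotient: "dilation_quotient R \<in> borel_measurable borel"
  unfolding dilation_quotient_def[abs_def]
proof (rule borel_measurable_divide)
  show "(\<lambda>p::'a \<times> 'a. (cutoff_field R (fst p) - cutoff_field R (snd p)) \<bullet> (fst p - snd p)) \<in> borel_measurable borel"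
    by (intro borel_measurable_continuous_onI continuous_intros continuous_on_cutoff_field)
  show "(\<lambda>p::'a \<times> 'a. (fst p - snd p) \<bullet> (fst p - snd p)) \<in> borel_measurable borel"
    by (intro borel_measurable_continuous_onI continuous_intros)
qed

text \<open>As \<open>r\<close> tends to 0 the kernel becomes singular on the diagonal, but the
  Lipschitz bound for the field supplies the squared distance \<open>d\<close>, and \<open>d\<close>
  times \<open>log_kernel_deriv\<close> is at most 1 in absolute value. Hence the domination with
  constant 5.\<close>

lemma flux_0_eq:
  assumes R: "R > 0"
  shows "flux R 0 = - pot_coeff * (\<integral>p. dilation_quotient R p * (f (fst p) * f (snd p)) \<partial>lborel)"
proof -
  let ?d = "\<lambda>p::'a \<times> 'a. (fst p - snd p) \<bullet> (fst p - snd p)"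
  let ?w = "\<lambda>r p. ((cutoff_field R (fst p) - cutoff_field R (snd p)) \<bullet> (fst p - snd p)) * log_kernel_deriv (m + 1) r (?d p)"
  define r where "r n = 1 / real (Suc n)" for n
  have r0: "r n > 0" for n by (simp add: r_def)
  have rlim: "r \<longlonglongrightarrow> 0" unfolding r_def by (intro LIMSEQ_Suc lim_1_over_n)
  have "(\<lambda>n. \<integral>p. ?w (r n) p * (f (fst p) * f (snd p)) \<partial>lborel)
      \<longlonglongrightarrow> (\<integral>p. - dilation_quotient R p * (f (fst p) * f (snd p)) \<partial>lborel)"
  proof (rule integral_dominated_convergence[where w="\<lambda>p. 5 * \<bar>f (fst p) * f (snd p)\<bar>"])
    show "integrable lborel (\<lambda>p. 5 * \<bar>f (fst p) * f (snd p)\<bar>)"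
      by (intro integrable_mult_right integrable_abs integrable_f_f)
    show "(\<lambda>p. - dilation_quotient R p * (f (fst p) * f (snd p))) \<in> borel_measurable lborel"
      using measurable_dilation_quotient borel_measurable_integrable[OF integrable_f_f] by measurable
    have "?w (r n) \<in> borel_measurable borel" for n
      by (intro borel_measurable_continuous_onI continuous_intros continuous_on_cutoff_field
          continuous_on_log_kernel_deriv r0)
    then show "(\<lambda>p. ?w (r n) p * (f (fst p) * f (snd p))) \<in> borel_measurable lborel" for n
      using borel_measurable_integrable[OF integrable_f_f]
      by (intro borel_measurable_times[of "?w (r n)"]) simp_all
    show "AE p in lborel. norm (?w (r n) p * (f (fst p) * f (snd p))) \<le> 5 * \<bar>f (fst p) * f (snd p)\<bar>" for n
    proof (rule AE_I2)
      fix p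
      have "\<bar>?w (r n) p\<bar> \<le> 5 * ?d p * \<bar>log_kernel_deriv (m + 1) (r n) (?d p)\<bar>"
        unfolding abs_mult by (intro mult_right_mono cutoff_inner_le R) simp
      also have "\<dots> = 5 * \<bar>?d p * log_kernel_deriv (m + 1) (r n) (?d p)\<bar>" by (simp add: abs_mult)
      also have "\<dots> = 5 * \<bar>max 0 (1 - ?d p / r n) ^ Suc (m + 1) - 1\<bar>"
        by (subst log_kernel_deriv_mult[OF r0]) auto
      also have "\<dots> \<le> 5 * 1"
      proof (rule mult_left_mono)
        have "max 0 (1 - ?d p / r n) \<le> 1" using r0[of n] by simp
        then have "max 0 (1 - ?d p / r n) ^ Suc (m + 1) \<le> 1" by (intro power_le_one) auto
        moreover have "0 \<le> max 0 (1 - ?d p / r n) ^ Suc (m + 1)" by (intro zero_le_power) auto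
        ultimately show "\<bar>max 0 (1 - ?d p / r n) ^ Suc (m + 1) - 1\<bar> \<le> 1" by (simp only: abs_le_iff) simp
      qed simp
      finally have "\<bar>?w (r n) p\<bar> \<le> 5" by simp
      then show "norm (?w (r n) p * (f (fst p) * f (snd p))) \<le> 5 * \<bar>f (fst p) * f (snd p)\<bar>"
        unfolding real_norm_def abs_mult[of "?w (r n) p"] by (rule mult_right_mono) simp
    qed
    show "AE p in lborel. (\<lambda>n. ?w (r n) p * (f (fst p) * f (snd p))) \<longlonglongrightarrow> - dilation_quotient R p * (f (fst p) * f (snd p))"
    proof (rule AE_I2)
      fix p
      show "(\<lambda>n. ?w (r n) p * (f (fst p) * f (snd p))) \<longlonglongrightarrow> - dilation_quotient R p * (f (fst p) * f (snd p))"
      proof (cases "fst p = snd p")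
        case True
        then show ?thesis by (simp add: dilation_quotient_def)
      next
        case False
        then have d: "?d p > 0" by simp
        \<comment> \<open>Off the diagonal the kernel equals \<open>- 1 / d\<close> once
          \<open>r n < d\<close>, so the integrands are eventually constant in
          \<open>n\<close>.\<close>
        then have "\<forall>\<^sub>F n in sequentially. r n < ?d p" using rlim by (simp add: order_tendsto_iff)
        then have "\<forall>\<^sub>F n in sequentially. ?w (r n) p * (f (fst p) * f (snd p)) = - dilation_quotient R p * (f (fst p) * f (snd p))"
          by eventually_elim (use r0 in \<open>simp add: log_kernel_deriv_far dilation_quotient_def\<close>)
        then show ?thesis by (rule tendsto_eventually)
      qed
    qed
  qed
  from tendsto_mult[OF tendsto_const[of pot_coeff] this]
  have "(\<lambda>n. flux R (r n)) \<longlonglongrightarrow> pot_coeff * (\<integral>p. - dilation_quotient R p * (f (fst p) * f (snd p)) \<partial>lborel)"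
    using r0 R by (simp add: flux_eq_symmetric)
  moreover have "(\<lambda>n. flux R (r n)) \<longlonglongrightarrow> flux R 0"
    by (rule filterlim_compose[OF flux_tendsto[OF R]])
      (use rlim r0 in \<open>auto simp: filterlim_at less_imp_neq[THEN not_sym]\<close>)
  ultimately have "flux R 0 = pot_coeff * (\<integral>p. - dilation_quotient R p * (f (fst p) * f (snd p)) \<partial>lborel)"
    by (rule LIMSEQ_unique[rotated])
  then show ?thesis by simp
qed

lemma integral_off_diagonal:
  "(\<integral>p. (if fst p = snd p then 0 else 1) * (f (fst p) * f (snd p)) \<partial>lborel) = total\<^sup>2"
proof -
  let ?w = "\<lambda>p::'a \<times> 'a. (if fst p = snd p then 0 else (1::real))"
  have m: "?w \<in> borel_measurable borel"
  proof -
    have "closed {p::'a \<times> 'a. fst p = snd p}"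
      by (intro closed_Collect_eq continuous_intros)
    then have [measurable]: "{p::'a \<times> 'a. fst p = snd p} \<in> sets borel" by auto
    have "?w = (\<lambda>p. 1 - indicator {p::'a \<times> 'a. fst p = snd p} p)" by (auto simp: indicator_def)
    also have "\<dots> \<in> borel_measurable borel" by measurable
    finally show ?thesis .
  qed
  have "integrable lborel (\<lambda>p. ?w p * (f (fst p) * f (snd p)))"
    by (rule integrable_f_f_bounded[OF m, of 1]) auto
  then have i: "integrable (lborel \<Otimes>\<^sub>M (lborel :: 'a measure)) (\<lambda>p. ?w p * (f (fst p) * f (snd p)))"
    by (simp add: lborel_prod)
  have "(\<integral>p. ?w p * (f (fst p) * f (snd p)) \<partial>lborel) = (\<integral>x. (\<integral>z. ?w (x, z) * (f (fst (x, z)) * f (snd (x, z))) \<partial>lborel) \<partial>lborel)"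
    unfolding lborel_pair.integral_fst'[OF i] by (simp add: lborel_prod)
  also have "\<dots> = (\<integral>x. f x * total \<partial>lborel)"
  proof (rule Bochner_Integration.integral_cong[OF refl])
    fix x
    have "(\<integral>z. ?w (x, z) * (f (fst (x, z)) * f (snd (x, z))) \<partial>lborel) = (\<integral>z. f x * f z \<partial>lborel)"
    proof (rule integral_cong_AE)
      \<comment> \<open>The slice of the diagonal over \<open>x\<close> is a single point, hence
        null.\<close>
      have "AE z in lborel. z \<noteq> x" by (rule AE_lborel_singleton)
      then show "AE z in lborel. ?w (x, z) * (f (fst (x, z)) * f (snd (x, z))) = f x * f z"
        by eventually_elim auto
      have [measurable]: "{x} \<in> sets (borel :: 'a measure)" by auto
      have "(\<lambda>z. ?w (x, z)) = (\<lambda>z. 1 - indicator {x} z)" by (auto simp: indicator_def)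
      also have "\<dots> \<in> borel_measurable borel" by measurable
      finally show "(\<lambda>z. ?w (x, z) * (f (fst (x, z)) * f (snd (x, z)))) \<in> borel_measurable lborel"
        by (intro borel_measurable_times) auto
    qed auto
    then show "(\<integral>z. ?w (x, z) * (f (fst (x, z)) * f (snd (x, z))) \<partial>lborel) = f x * total"
      by (simp add: total_def)
  qed
  also have "\<dots> = total\<^sup>2" by (simp add: total_def power2_eq_square)
  finally show ?thesis .
qed

text \<open>As \<open>R\<close> grows the field tends to the identity, so the quotient tends to 1
  off the diagonal and the double integral to the square of \<open>total\<close>; the uniform bound
  5 dominates.\<close>

lemma flux_limit:
  "((\<lambda>R. bump_mass * (\<integral>x. (cutoff_field R x \<bullet> gradient u x) * f x \<partial>lborel)) \<longlongrightarrow> - pot_coeff * total\<^sup>2) at_top"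
proof -
  have "((\<lambda>R. \<integral>p. dilation_quotient R p * (f (fst p) * f (snd p)) \<partial>lborel)
      \<longlongrightarrow> (\<integral>p. (if fst p = snd p then 0 else 1) * (f (fst p) * f (snd p)) \<partial>lborel)) at_top"
  proof (rule integral_dominated_convergence_at_top[where w="\<lambda>p. 5 * \<bar>f (fst p) * f (snd p)\<bar>"])
    show "integrable lborel (\<lambda>p. 5 * \<bar>f (fst p) * f (snd p)\<bar>)"
      by (intro integrable_mult_right integrable_abs integrable_f_f)
    show "(\<lambda>p. dilation_quotient R p * (f (fst p) * f (snd p))) \<in> borel_measurable lborel" for R
      using measurable_dilation_quotient borel_measurable_integrable[OF integrable_f_f] by measurable
    show "(\<lambda>p. (if fst p = snd p then 0 else 1) * (f (fst p) * f (snd p))) \<in> borel_measurable lborel"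
    proof (rule borel_measurable_times)
      have "closed {p::'a \<times> 'a. fst p = snd p}"
        by (intro closed_Collect_eq continuous_intros)
      then have [measurable]: "{p::'a \<times> 'a. fst p = snd p} \<in> sets borel" by auto
      have "(\<lambda>p::'a \<times> 'a. if fst p = snd p then 0 else (1::real)) = (\<lambda>p. 1 - indicator {p::'a \<times> 'a. fst p = snd p} p)"
        by (auto simp: indicator_def)
      also have "\<dots> \<in> borel_measurable borel" by measurable
      finally show "(\<lambda>p::'a \<times> 'a. if fst p = snd p then 0 else (1::real)) \<in> borel_measurable lborel" by simp
    qed (use borel_measurable_integrable[OF integrable_f_f] in simp)
    show "\<forall>\<^sub>F R in at_top. AE p in lborel. norm (dilation_quotient R p * (f (fst p) * f (snd p))) \<le> 5 * \<bar>f (fst p) * f (snd p)\<bar>"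
      using eventually_gt_at_top[of 0]
    proof eventually_elim
      case (elim R)
      show ?case
      proof (rule AE_I2)
        fix p
        show "norm (dilation_quotient R p * (f (fst p) * f (snd p))) \<le> 5 * \<bar>f (fst p) * f (snd p)\<bar>"
          unfolding real_norm_def abs_mult[of "dilation_quotient R p"]
          by (intro mult_right_mono abs_dilation_quotient_le elim) simp
      qed
    qed
    show "AE p in lborel. ((\<lambda>R. dilation_quotient R p * (f (fst p) * f (snd p)))
        \<longlongrightarrow> (if fst p = snd p then 0 else 1) * (f (fst p) * f (snd p))) at_top"
    proof (rule AE_I2)
      fix p :: "'a \<times> 'a"
      have "((\<lambda>R. dilation_quotient R p) \<longlongrightarrow> (if fst p = snd p then 0 else 1)) at_top"
      proof (cases "fst p = snd p")
        case False
        then have "((\<lambda>R. dilation_quotient R p) \<longlongrightarrow> ((fst p - snd p) \<bullet> (fst p - snd p)) / ((fst p - snd p) \<bullet> (fst p - snd p))) at_top"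
          unfolding dilation_quotient_def by (intro tendsto_intros cutoff_field_tendsto) auto
        then show ?thesis using False by simp
      qed (simp add: dilation_quotient_def)
      then show "((\<lambda>R. dilation_quotient R p * (f (fst p) * f (snd p)))
        \<longlongrightarrow> (if fst p = snd p then 0 else 1) * (f (fst p) * f (snd p))) at_top"
        by (intro tendsto_mult tendsto_const)
    qed
  qed
  from tendsto_mult[OF tendsto_const[of "- pot_coeff"] this]
  have "((\<lambda>R. - pot_coeff * (\<integral>p. dilation_quotient R p * (f (fst p) * f (snd p)) \<partial>lborel)) \<longlongrightarrow> - pot_coeff * total\<^sup>2) at_top"
    unfolding integral_off_diagonal .
  moreover have "\<forall>\<^sub>F R in at_top. - pot_coeff * (\<integral>p. dilation_quotient R p * (f (fst p) * f (snd p)) \<partial>lborel)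
      = bump_mass * (\<integral>x. (cutoff_field R x \<bullet> gradient u x) * f x \<partial>lborel)"
    using eventually_gt_at_top[of 0]
    by eventually_elim (use flux_0_eq flux_at_0 in auto)
  ultimately show ?thesis by (rule Lim_transform_eventually)
qed

end

section \<open>The dilation identity\<close>

locale curvature = polyharmonic +
  fixes K :: "'a \<Rightarrow> real"
  assumes f_eq: "f x = K x * exp (real DIM('a) * u x)"
    and smooth_K: "smooth_fun K"
    and radial: "x \<bullet> gradient K x \<le> 0"
begin

lemma partial_deriv_f:
  assumes b: "b \<in> Basis"
  shows "partial_deriv b f x = partial_deriv b K x * exp (real DIM('a) * u x)
     + real DIM('a) * f x * partial_deriv b u x"
proof -
  have "((\<lambda>s. K (x + s *\<^sub>R b) * exp (real DIM('a) * u (x + s *\<^sub>R b))) has_real_derivative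
     partial_deriv b K (x + 0 *\<^sub>R b) * exp (real DIM('a) * u (x + 0 *\<^sub>R b)) +
     (exp (real DIM('a) * u (x + 0 *\<^sub>R b)) * (real DIM('a) * partial_deriv b u (x + 0 *\<^sub>R b))) * K (x + 0 *\<^sub>R b)) (at 0)"
    by (intro DERIV_mult DERIV_fun_exp DERIV_cmult smooth_fun_DERIV_Basis smooth_K smooth_u b)
  then have "((\<lambda>s. f (x + s *\<^sub>R b)) has_real_derivative
     partial_deriv b K x * exp (real DIM('a) * u x) + real DIM('a) * f x * partial_deriv b u x) (at 0)"
    by (simp add: f_eq mult_ac)
  from DERIV_unique[OF _ this] smooth_fun_DERIV_Basis[OF smooth_f b, of x 0]
  show ?thesis by simp
qed

lemma inner_gradient: "x \<bullet> gradient g y = (\<Sum>b\<in>Basis. (x \<bullet> b) * partial_deriv b g y)"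
  by (simp add: gradient_def inner_sum_right mult.commute)

lemma radial_deriv_f:
  "(\<Sum>b\<in>Basis. (x \<bullet> b) * partial_deriv b f x)
    = (x \<bullet> gradient K x) * exp (real DIM('a) * u x) + real DIM('a) * ((x \<bullet> gradient u x) * f x)"
  by (simp add: partial_deriv_f inner_gradient sum.distrib sum_distrib_left sum_distrib_right algebra_simps)

section \<open>The cut-off dilation identity\<close>

definition weighted_total where "weighted_total R = (\<integral>x. bump 2 (x /\<^sub>R R) * f x \<partial>lborel)"

text \<open>The derivative of the cut-off along \<open>x\<close> is minus the factor in front of
  \<open>f\<close>. This factor is bounded and tends to 0 pointwise, so the term vanishes in the
  limit.\<close>

definition boundary_term where
  "boundary_term R = (\<integral>x. 4 * (bump 1 (x /\<^sub>R R) * ((x /\<^sub>R R) \<bullet> (x /\<^sub>R R))) * f x \<partial>lborel)"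

text \<open>The sign makes the integrand nonnegative under \<open>radial\<close>. The cut-off is
  kept because integrability of \<open>x \<bullet> gradient K x\<close> times the exponential is not
  among the assumptions; \<open>radial_term_tendsto\<close> obtains the limit from the other
  terms.\<close>

definition radial_term where
  "radial_term R = (\<integral>x. bump 2 (x /\<^sub>R R) * (- (x \<bullet> gradient K x) * exp (real DIM('a) * u x)) \<partial>lborel)"

lemma continuous_on_gradient_compose:
  assumes "smooth_fun g"
  shows "continuous_on S (gradient g)"
  unfolding gradient_def[abs_def]
  by (intro continuous_intros continuous_on_subset[OF smooth_fun_continuous[OF smooth_fun_partial_deriv[OF assms]]]) auto

lemma integrable_bump_scaled:
  fixes h :: "'a \<Rightarrow> real"
  assumes R: "R > 0" and j: "j \<ge> 1" and h: "continuous_on UNIV h"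
  shows "integrable lborel (\<lambda>x. bump j (x /\<^sub>R R) * h x)"
proof -
  obtain c d :: 'a where cd: "cball 0 R \<subseteq> cbox c d"
    using bounded_cbox_containing[OF bounded_cball] by blast
  show ?thesis
  proof (rule integrable_compact_support)
    show "continuous_on UNIV (\<lambda>x. bump j (x /\<^sub>R R) * h x)"
      by (intro continuous_intros h)
    show "bump j (y /\<^sub>R R) * h y = 0" if "y \<notin> cbox c d" for y
    proof -
      have "norm y \<ge> R" using that cd by (meson linear mem_cball_0 subsetD)
      then have "bump j (y /\<^sub>R R) = 0" using R by (intro bump_zero_outside[OF j]) (simp add: field_simps)
      then show ?thesis by simp
    qed
  qed
qed

text \<open>The divergence of \<open>f\<close> times \<open>cutoff_field R\<close> integrates to 0.
  It consists of the dimension from the divergence of \<open>x\<close>, the derivative of the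
  cut-off, and the radial derivative of \<open>f\<close>, which \<open>radial_deriv_f\<close> splits
  into a part with \<open>K\<close> and a part with \<open>u\<close>.\<close>

lemma scaling_identity:
  assumes R: "R > 0"
  shows "real DIM('a) * (\<integral>x. (cutoff_field R x \<bullet> gradient u x) * f x \<partial>lborel)
     = - real DIM('a) * weighted_total R + boundary_term R + radial_term R"
proof -
  have cf: "continuous_on UNIV f" by (rule smooth_fun_continuous[OF smooth_f])
  have cu: "continuous_on UNIV u" by (rule smooth_fun_continuous[OF smooth_u])
  note cg = continuous_on_gradient_compose
  define \<phi>' where "\<phi>' b x = bump 2 (x /\<^sub>R R) * (f x + (x \<bullet> b) * partial_deriv b f x)
     - 4 * (bump 1 (x /\<^sub>R R) * (((x /\<^sub>R R) \<bullet> b) * ((x /\<^sub>R R) \<bullet> b) * f x))" for b x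
  have cpf: "continuous_on UNIV (partial_deriv b f)" if "b \<in> Basis" for b
    by (rule smooth_fun_continuous[OF smooth_fun_partial_deriv[OF smooth_f that]])
  have c\<phi>': "continuous_on UNIV (\<phi>' b)" if "b \<in> Basis" for b
    unfolding \<phi>'_def by (intro continuous_intros cpf cf that)
  have zero: "(\<integral>x. \<phi>' b x \<partial>lborel) = 0" if b: "b \<in> Basis" for b
  proof (rule integral_directional_derivative_zero[where b=b and r=R
        and \<phi>="\<lambda>x. bump 2 (x /\<^sub>R R) * ((x \<bullet> b) * f x)"])
    fix x
    have h: "((\<lambda>s. s / R) has_real_derivative 1 / R) (at 0)" by (rule DERIV_cdivide[OF DERIV_ident])
    have "((\<lambda>s. bump (Suc 1) (x /\<^sub>R R + s *\<^sub>R b)) has_real_derivative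
        - 2 * real (Suc 1) * ((x /\<^sub>R R) \<bullet> b) * bump 1 (x /\<^sub>R R)) (at (0 / R))"
      using bump_has_derivative[of 1 "x /\<^sub>R R" b 0] by simp
    from DERIV_chain2[OF this h]
    have "((\<lambda>s. bump (Suc 1) (x /\<^sub>R R + (s / R) *\<^sub>R b)) has_real_derivative
        - 2 * real (Suc 1) * ((x /\<^sub>R R) \<bullet> b) * bump 1 (x /\<^sub>R R) * (1 / R)) (at 0)" .
    moreover have "x /\<^sub>R R + (s / R) *\<^sub>R b = (x + s *\<^sub>R b) /\<^sub>R R" for s
      by (simp add: scaleR_add_right divide_inverse mult.commute)
    ultimately have d1: "((\<lambda>s. bump 2 ((x + s *\<^sub>R b) /\<^sub>R R)) has_real_derivative
        - 4 * ((x /\<^sub>R R) \<bullet> b) * bump 1 (x /\<^sub>R R) * (1 / R)) (at 0)"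
      by (simp add: numeral_2_eq_2)
    have d2: "((\<lambda>s. (x + s *\<^sub>R b) \<bullet> b) has_real_derivative 1) (at 0)"
      unfolding inner_add_left inner_scaleR_left using b by (auto intro!: derivative_eq_intros)
    have d3: "((\<lambda>s. f (x + s *\<^sub>R b)) has_real_derivative partial_deriv b f x) (at 0)"
      using smooth_fun_DERIV_Basis[OF smooth_f b, of x 0] by simp
    have "((\<lambda>s. bump 2 ((x + s *\<^sub>R b) /\<^sub>R R) * (((x + s *\<^sub>R b) \<bullet> b) * f (x + s *\<^sub>R b))) has_real_derivative
      (- 4 * ((x /\<^sub>R R) \<bullet> b) * bump 1 (x /\<^sub>R R) * (1 / R)) * (((x + 0 *\<^sub>R b) \<bullet> b) * f (x + 0 *\<^sub>R b)) +
      (1 * f (x + 0 *\<^sub>R b) + partial_deriv b f x * ((x + 0 *\<^sub>R b) \<bullet> b)) * bump 2 ((x + 0 *\<^sub>R b) /\<^sub>R R)) (at 0)"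
      by (rule DERIV_mult[OF d1 DERIV_mult[OF d2 d3]])
    then show "((\<lambda>s. bump 2 ((x + s *\<^sub>R b) /\<^sub>R R) * (((x + s *\<^sub>R b) \<bullet> b) * f (x + s *\<^sub>R b))) has_real_derivative \<phi>' b x) (at 0)"
      by (rule DERIV_cong) (simp add: \<phi>'_def divide_inverse algebra_simps)
    show "bump 2 (x /\<^sub>R R) * ((x \<bullet> b) * f x) = 0" if "R \<le> norm x"
    proof -
      have "bump 2 (x /\<^sub>R R) = 0" using that R by (intro bump_zero_outside) (auto simp: field_simps)
      then show ?thesis by simp
    qed
  qed (intro continuous_intros cf c\<phi>' b)+
  have i\<phi>': "integrable lborel (\<phi>' b)" if "b \<in> Basis" for b
    unfolding \<phi>'_def
    by (intro Bochner_Integration.integrable_diff integrable_mult_right integrable_bump_scaled R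
        continuous_intros cpf cf that) auto
  have i1: "integrable lborel (\<lambda>x. bump 2 (x /\<^sub>R R) * f x)"
    by (intro integrable_bump_scaled R cf) simp
  have i2: "integrable lborel (\<lambda>x. 4 * (bump 1 (x /\<^sub>R R) * ((x /\<^sub>R R) \<bullet> (x /\<^sub>R R))) * f x)"
    unfolding mult.assoc by (intro integrable_mult_right integrable_bump_scaled R continuous_intros cf) simp
  have i3: "integrable lborel (\<lambda>x. bump 2 (x /\<^sub>R R) * (- (x \<bullet> gradient K x) * exp (real DIM('a) * u x)))"
    by (intro integrable_bump_scaled R continuous_intros cg smooth_K cu) simp
  have i4: "integrable lborel (\<lambda>x. (cutoff_field R x \<bullet> gradient u x) * f x)"
    unfolding cutoff_field_def inner_scaleR_left mult.assoc
    by (intro integrable_bump_scaled R continuous_intros cg smooth_u cf) simp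
  have sum: "(\<Sum>b\<in>Basis. \<phi>' b x) = real DIM('a) * (bump 2 (x /\<^sub>R R) * f x)
      + real DIM('a) * ((cutoff_field R x \<bullet> gradient u x) * f x)
      - bump 2 (x /\<^sub>R R) * (- (x \<bullet> gradient K x) * exp (real DIM('a) * u x))
      - 4 * (bump 1 (x /\<^sub>R R) * ((x /\<^sub>R R) \<bullet> (x /\<^sub>R R))) * f x" for x
  proof -
    have "(\<Sum>b\<in>Basis. \<phi>' b x) = bump 2 (x /\<^sub>R R) * (real DIM('a) * f x + (\<Sum>b\<in>Basis. (x \<bullet> b) * partial_deriv b f x))
       - 4 * (bump 1 (x /\<^sub>R R) * ((\<Sum>b\<in>Basis. ((x /\<^sub>R R) \<bullet> b) * ((x /\<^sub>R R) \<bullet> b)) * f x))"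
      by (simp add: \<phi>'_def sum_subtractf sum.distrib flip: sum_distrib_left sum_distrib_right)
    also have "(\<Sum>b\<in>Basis. ((x /\<^sub>R R) \<bullet> b) * ((x /\<^sub>R R) \<bullet> b)) = (x /\<^sub>R R) \<bullet> (x /\<^sub>R R)"
      by (rule euclidean_inner[symmetric])
    finally show ?thesis
      unfolding radial_deriv_f cutoff_field_def by (simp add: algebra_simps)
  qed
  have "0 = (\<integral>x. (\<Sum>b\<in>Basis. \<phi>' b x) \<partial>lborel)"
    using zero i\<phi>' by simp
  also have "\<dots> = real DIM('a) * weighted_total R
      + real DIM('a) * (\<integral>x. (cutoff_field R x \<bullet> gradient u x) * f x \<partial>lborel) - radial_term R - boundary_term R"
    unfolding sum weighted_total_def radial_term_def boundary_term_def
    using i1 i2 i3 i4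
    by (simp only: Bochner_Integration.integral_diff Bochner_Integration.integral_add integral_mult_right_zero
        Bochner_Integration.integrable_diff Bochner_Integration.integrable_add integrable_mult_right)
  finally show ?thesis by simp
qed

section \<open>Removing the cut-off\<close>

lemma weighted_total_tendsto: "(weighted_total \<longlongrightarrow> total) at_top"
proof -
  have "((\<lambda>R. \<integral>x. bump 2 (x /\<^sub>R R) * f x \<partial>lborel) \<longlongrightarrow> (\<integral>x. f x \<partial>lborel)) at_top"
  proof (rule integral_dominated_convergence_at_top[where w="\<lambda>x. \<bar>f x\<bar>"])
    show "\<forall>\<^sub>F R in at_top. AE x in lborel. norm (bump 2 (x /\<^sub>R R) * f x) \<le> \<bar>f x\<bar>"
      by (auto simp: abs_mult bump_le_one intro!: always_eventually mult_left_le_one_le)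
    show "AE x in lborel. ((\<lambda>R. bump 2 (x /\<^sub>R R) * f x) \<longlongrightarrow> f x) at_top"
      using tendsto_mult[OF bump_scaled_tendsto_1 tendsto_const] by (intro AE_I2) fastforce
    have "continuous_on UNIV (\<lambda>x. bump 2 (x /\<^sub>R R) * f x)" for R
      by (intro continuous_intros smooth_fun_continuous[OF smooth_f])
    then show "(\<lambda>x. bump 2 (x /\<^sub>R R) * f x) \<in> borel_measurable lborel" for R
      by (simp add: borel_measurable_continuous_onI)
  qed (use f_int in auto)
  then show ?thesis by (simp add: weighted_total_def[abs_def] total_def)
qed

lemma boundary_term_tendsto: "(boundary_term \<longlongrightarrow> 0) at_top"
proof -
  have "((\<lambda>R. \<integral>x. 4 * (bump 1 (x /\<^sub>R R) * ((x /\<^sub>R R) \<bullet> (x /\<^sub>R R))) * f x \<partial>lborel) \<longlongrightarrow> (\<integral>x. 0 \<partial>(lborel :: 'a measure))) at_top"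
  proof (rule integral_dominated_convergence_at_top[where w="\<lambda>x. 4 * \<bar>f x\<bar>"])
    have le: "\<bar>bump 1 y * (y \<bullet> y)\<bar> \<le> 1" for y :: 'a
    proof (cases "norm y \<ge> 1")
      case True
      then have "bump 1 y = 0" by (intro bump_zero_outside) auto
      then show ?thesis by simp
    next
      case False
      then have "y \<bullet> y \<le> 1" by (simp add: dot_square_norm power_le_one)
      then show ?thesis using bump_le_one[of 1 y] by (simp add: abs_mult mult_le_one)
    qed
    show "\<forall>\<^sub>F R in at_top. AE x in lborel. norm (4 * (bump 1 (x /\<^sub>R R) * ((x /\<^sub>R R) \<bullet> (x /\<^sub>R R))) * f x) \<le> 4 * \<bar>f x\<bar>"
    proof (intro always_eventually allI AE_I2)
      fix R :: real and x :: 'a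
      show "norm (4 * (bump 1 (x /\<^sub>R R) * ((x /\<^sub>R R) \<bullet> (x /\<^sub>R R))) * f x) \<le> 4 * \<bar>f x\<bar>"
        using mult_right_mono[OF le[of "x /\<^sub>R R"], of "\<bar>f x\<bar>"] unfolding real_norm_def abs_mult[of _ "f x"] abs_mult[of 4] by simp
    qed
    show "AE x in lborel. ((\<lambda>R. 4 * (bump 1 (x /\<^sub>R R) * ((x /\<^sub>R R) \<bullet> (x /\<^sub>R R))) * f x) \<longlongrightarrow> 0) at_top"
    proof (rule AE_I2)
      fix x :: 'a
      have lim: "((\<lambda>R. x /\<^sub>R R) \<longlongrightarrow> 0 *\<^sub>R x) at_top"
        by (intro tendsto_scaleR tendsto_const tendsto_inverse_0_at_top filterlim_ident)
      have "((\<lambda>R. 4 * (bump 1 (x /\<^sub>R R) * ((x /\<^sub>R R) \<bullet> (x /\<^sub>R R))) * f x) \<longlongrightarrow> 4 * (1 * ((0 *\<^sub>R x) \<bullet> (0 *\<^sub>R x))) * f x) at_top"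
        by (intro tendsto_mult tendsto_const bump_scaled_tendsto_1 tendsto_inner lim)
      then show "((\<lambda>R. 4 * (bump 1 (x /\<^sub>R R) * ((x /\<^sub>R R) \<bullet> (x /\<^sub>R R))) * f x) \<longlongrightarrow> 0) at_top" by simp
    qed
    have "continuous_on UNIV (\<lambda>x. 4 * (bump 1 (x /\<^sub>R R) * ((x /\<^sub>R R) \<bullet> (x /\<^sub>R R))) * f x)" for R
      by (intro continuous_intros smooth_fun_continuous[OF smooth_f])
    then show "(\<lambda>x. 4 * (bump 1 (x /\<^sub>R R) * ((x /\<^sub>R R) \<bullet> (x /\<^sub>R R))) * f x) \<in> borel_measurable lborel" for R
      by (simp add: borel_measurable_continuous_onI)
  qed (use f_int in auto)
  then show ?thesis by (simp add: boundary_term_def[abs_def])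
qed

lemma radial_term_tendsto:
  "(radial_term \<longlongrightarrow> real DIM('a) * (total - pot_coeff * total\<^sup>2 / bump_mass)) at_top"
proof -
  let ?I = "\<lambda>R. \<integral>x. (cutoff_field R x \<bullet> gradient u x) * f x \<partial>lborel"
  have "((\<lambda>R. bump_mass * ?I R / bump_mass) \<longlongrightarrow> - pot_coeff * total\<^sup>2 / bump_mass) at_top"
    by (intro tendsto_divide tendsto_const flux_limit) (use bump_mass_pos in auto)
  then have I: "(?I \<longlongrightarrow> - pot_coeff * total\<^sup>2 / bump_mass) at_top" using bump_mass_pos by simp
  have "((\<lambda>R. real DIM('a) * ?I R + real DIM('a) * weighted_total R - boundary_term R) \<longlongrightarrow>
     real DIM('a) * (- pot_coeff * total\<^sup>2 / bump_mass) + real DIM('a) * total - 0) at_top"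
    by (intro tendsto_diff tendsto_add tendsto_mult tendsto_const I weighted_total_tendsto boundary_term_tendsto)
  moreover have "\<forall>\<^sub>F R in at_top. real DIM('a) * ?I R + real DIM('a) * weighted_total R - boundary_term R = radial_term R"
    using eventually_gt_at_top[of 0] by eventually_elim (use scaling_identity in auto)
  ultimately have "(radial_term \<longlongrightarrow> real DIM('a) * (- pot_coeff * total\<^sup>2 / bump_mass) + real DIM('a) * total - 0) at_top"
    by (rule Lim_transform_eventually)
  then show ?thesis by (simp add: algebra_simps)
qed

text \<open>The integrand of \<open>radial_term\<close> is nonnegative and its weight increases with
  \<open>R\<close>, so the limit is at least the value at one radius, which is positive.\<close>

lemma total_less:
  assumes "x0 \<bullet> gradient K x0 \<noteq> 0"
  shows "total - pot_coeff * total\<^sup>2 / bump_mass > 0"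
proof -
  \<comment> \<open>A radius beyond \<open>norm x0\<close>, so that the weight is positive at
    \<open>x0\<close>.\<close>
  define R0 where "R0 = norm x0 + 1"
  have R0: "R0 > 0" by (simp add: R0_def add_nonneg_pos)
  let ?g = "\<lambda>x. - (x \<bullet> gradient K x) * exp (real DIM('a) * u x)"
  have cu: "continuous_on UNIV u" by (rule smooth_fun_continuous[OF smooth_u])
  have cg: "continuous_on UNIV ?g"
    by (intro continuous_intros continuous_on_gradient_compose smooth_K cu)
  have g0: "?g x \<ge> 0" for x
    using radial[of x] by (intro mult_nonneg_nonneg) auto
  have i: "integrable lborel (\<lambda>x. bump 2 (x /\<^sub>R R) * ?g x)" if "R > 0" for R
    by (rule integrable_bump_scaled[OF that _ cg]) simp
  have pos: "radial_term R0 > 0"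
    unfolding radial_term_def
  proof (rule integral_pos_continuous[OF i[OF R0]])
    show "continuous_on UNIV (\<lambda>x. bump 2 (x /\<^sub>R R0) * ?g x)" by (intro continuous_on_mult cg continuous_intros)
    show "bump 2 (x /\<^sub>R R0) * ?g x \<ge> 0" for x by (intro mult_nonneg_nonneg g0) simp
    have "bump 2 (x0 /\<^sub>R R0) > 0"
      by (rule bump_pos) (use R0 in \<open>simp add: R0_def field_simps\<close>)
    moreover have "?g x0 > 0" using radial[of x0] assms by (intro mult_pos_pos) auto
    ultimately show "bump 2 (x0 /\<^sub>R R0) * ?g x0 > 0" by (rule mult_pos_pos)
  qed
  have mono: "radial_term R0 \<le> radial_term R" if R: "R \<ge> R0" for R
    unfolding radial_term_def
  proof (rule integral_mono[OF i[OF R0] i])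
    show "R > 0" using R R0 by simp
    fix x :: 'a
    have "norm (x /\<^sub>R R) \<le> norm (x /\<^sub>R R0)"
      using R R0 by (simp add: frac_le divide_inverse mult_right_mono)
    then have "(min 1 (norm (x /\<^sub>R R)))\<^sup>2 \<le> (min 1 (norm (x /\<^sub>R R0)))\<^sup>2"
      by (intro power_mono min.mono) auto
    then have "bump 2 (x /\<^sub>R R0) \<le> bump 2 (x /\<^sub>R R)"
      unfolding bump_eq_min by (intro power_mono) (auto simp: power_le_one)
    then show "bump 2 (x /\<^sub>R R0) * ?g x \<le> bump 2 (x /\<^sub>R R) * ?g x"
      by (rule mult_right_mono[OF _ g0])
  qed
  have "radial_term R0 \<le> real DIM('a) * (total - pot_coeff * total\<^sup>2 / bump_mass)"
    by (rule tendsto_lowerbound[OF radial_term_tendsto])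
      (use mono in \<open>auto simp: eventually_at_top_linorder\<close>)
  then have "real DIM('a) * (total - pot_coeff * total\<^sup>2 / bump_mass) > 0" using pos by linarith
  then show ?thesis by (simp add: zero_less_mult_iff)
qed

end

section \<open>The mass seen from a cone\<close>

context polyharmonic
begin

section \<open>Averages at different centers\<close>

lemma DERIV_lap_avg_center:
  "((\<lambda>s. lap_avg 2 u 0 (s *\<^sub>R x) t) has_real_derivative
     (\<Sum>b\<in>Basis. (x \<bullet> b) * lap_avg 2 (partial_deriv b u) 0 (s *\<^sub>R x) t)) (at s)"
proof -
  obtain c d :: 'a where cd: "\<And>y. y \<notin> cbox c d \<Longrightarrow> norm y \<ge> 1" by (rule unit_ball_cbox) blast
  let ?\<phi>' = "\<lambda>s y. bump 2 y * (\<Sum>b\<in>Basis. (x \<bullet> b) * partial_deriv b u (s *\<^sub>R x + sqrt t *\<^sub>R y))"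
  have "((\<lambda>s. \<integral>y. bump 2 y * u (s *\<^sub>R x + sqrt t *\<^sub>R y) \<partial>lborel) has_real_derivative
      (\<integral>y. ?\<phi>' s y \<partial>lborel)) (at s)"
  proof (rule DERIV_integral_compact_support[where p="s - 1" and q="s + 1" and c=c and d=d and \<phi>'="?\<phi>'"])
    show "((\<lambda>s. bump 2 y * u (s *\<^sub>R x + sqrt t *\<^sub>R y)) has_real_derivative ?\<phi>' s y) (at s)" for s y
      using DERIV_cmult[OF smooth_fun_DERIV_line[OF smooth_u, of "sqrt t *\<^sub>R y" x s], of "bump 2 y"]
      by (simp add: add.commute)
    show "continuous_on UNIV (\<lambda>y. bump 2 y * u (s *\<^sub>R x + sqrt t *\<^sub>R y))" for s
      by (intro continuous_intros continuous_on_affine_compose smooth_fun_continuous smooth_u)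
    show "continuous_on ({s - 1<..<s + 1} \<times> UNIV) (\<lambda>(s, y). ?\<phi>' s y)"
      unfolding case_prod_beta
      by (intro continuous_intros smooth_fun_continuous_compose[OF smooth_fun_partial_deriv[OF smooth_u]]) auto
    show "bump 2 y * u (s *\<^sub>R x + sqrt t *\<^sub>R y) = 0" if "y \<notin> cbox c d" for s y
    proof -
      have "bump 2 y = 0" by (rule bump_zero_outside[OF _ cd[OF that]]) simp
      then show ?thesis by simp
    qed
  qed auto
  moreover have "(\<integral>y. ?\<phi>' s y \<partial>lborel) = (\<Sum>b\<in>Basis. (x \<bullet> b) * bump_avg 2 (partial_deriv b u) (s *\<^sub>R x) t)"
  proof -
    have i: "integrable lborel (\<lambda>y. bump 2 y * partial_deriv b u (s *\<^sub>R x + sqrt t *\<^sub>R y))" if "b \<in> Basis" for b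
      by (intro integrable_bump_affine smooth_fun_continuous smooth_fun_partial_deriv smooth_u that) simp
    have "(\<integral>y. ?\<phi>' s y \<partial>lborel) = (\<integral>y. (\<Sum>b\<in>Basis. (x \<bullet> b) * (bump 2 y * partial_deriv b u (s *\<^sub>R x + sqrt t *\<^sub>R y))) \<partial>lborel)"
      by (simp add: sum_distrib_left mult_ac)
    also have "\<dots> = (\<Sum>b\<in>Basis. (x \<bullet> b) * bump_avg 2 (partial_deriv b u) (s *\<^sub>R x) t)"
      using i by (simp add: bump_avg_def)
    finally show ?thesis .
  qed
  ultimately show ?thesis by (simp add: lap_avg_def avg_coeff_def bump_avg_def)
qed

text \<open>The mean value theorem on the segment from 0 to \<open>x\<close>, with the decay of
  gradient averages. When \<open>norm x\<close> is comparable to \<open>sqrt t\<close> the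
  difference is bounded, so averages of radius \<open>\<delta> k\<close> around \<open>k e\<close>
  and around 0 agree up to a constant.\<close>

lemma lap_avg_center_diff:
  assumes t: "t > 0"
  shows "\<bar>lap_avg 2 u 0 x t - lap_avg 2 u 0 0 t\<bar> \<le> real DIM('a) * (norm x * (grad_decay_const / sqrt t))"
proof -
  have "\<exists>\<xi>>0. \<xi> < 1 \<and> lap_avg 2 u 0 (1 *\<^sub>R x) t - lap_avg 2 u 0 (0 *\<^sub>R x) t
      = (1 - 0) * (\<Sum>b\<in>Basis. (x \<bullet> b) * lap_avg 2 (partial_deriv b u) 0 (\<xi> *\<^sub>R x) t)"
    by (rule MVT2) (use DERIV_lap_avg_center in auto)
  then obtain \<xi> where "lap_avg 2 u 0 x t - lap_avg 2 u 0 0 t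
      = (\<Sum>b\<in>Basis. (x \<bullet> b) * lap_avg 2 (partial_deriv b u) 0 (\<xi> *\<^sub>R x) t)" by auto
  also have "\<bar>\<dots>\<bar> \<le> (\<Sum>b\<in>(Basis :: 'a set). norm x * (grad_decay_const / sqrt t))"
  proof (rule order_trans[OF sum_abs sum_mono])
    fix b :: 'a assume b: "b \<in> Basis"
    show "\<bar>(x \<bullet> b) * lap_avg 2 (partial_deriv b u) 0 (\<xi> *\<^sub>R x) t\<bar> \<le> norm x * (grad_decay_const / sqrt t)"
      unfolding abs_mult using lap_avg_partial_deriv_decay[OF b _ t, of 0] Basis_le_norm[OF b, of x]
      by (intro mult_mono) auto
  qed
  finally show ?thesis by simp
qed

text \<open>By the substitution \<open>z = sqrt t y\<close> this is the integral of \<open>f\<close>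
  against the weight \<open>bump (2 + m)\<close> at \<open>z / sqrt t\<close>, hence tends to
  \<open>total\<close>.\<close>

definition scaled_total where "scaled_total t = t ^ m * bump_avg (2 + m) f 0 t"

lemma scaled_total_tendsto: "(scaled_total \<longlongrightarrow> total) at_top"
proof -
  let ?h = "\<lambda>t z. bump (2 + m) (z /\<^sub>R sqrt t) * f z"
  have c: "continuous_on UNIV (?h t)" for t
    by (intro continuous_intros smooth_fun_continuous smooth_f)
  have eq: "scaled_total t = (\<integral>z. ?h t z \<partial>lborel)" if t: "t > 0" for t
  proof -
    have "bump_avg (2 + m) f 0 t = (\<integral>y. ?h t (0 + sqrt t *\<^sub>R y) \<partial>lborel)"
      using t by (simp add: bump_avg_def)
    also have "\<dots> = (\<integral>z. ?h t z \<partial>lborel) / sqrt t ^ DIM('a)"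
      by (rule integral_affine) (use t borel_measurable_continuous_onI[OF c] in auto)
    finally show ?thesis using t by (simp add: scaled_total_def sqrt_power_dim)
  qed
  have "((\<lambda>t. \<integral>z. ?h t z \<partial>lborel) \<longlongrightarrow> (\<integral>z. f z \<partial>lborel)) at_top"
  proof (rule integral_dominated_convergence_at_top[where w="\<lambda>z. \<bar>f z\<bar>"])
    show "\<forall>\<^sub>F t in at_top. AE z in lborel. norm (?h t z) \<le> \<bar>f z\<bar>"
      by (auto simp: abs_mult bump_le_one intro!: always_eventually mult_left_le_one_le)
    show "AE z in lborel. ((\<lambda>t. ?h t z) \<longlongrightarrow> f z) at_top"
    proof (rule AE_I2)
      fix z :: 'a
      have "((\<lambda>t. bump (2 + m) (z /\<^sub>R sqrt t)) \<longlongrightarrow> 1) at_top"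
        by (rule filterlim_compose[OF bump_scaled_tendsto_1 sqrt_at_top])
      from tendsto_mult[OF this tendsto_const] show "((\<lambda>t. ?h t z) \<longlongrightarrow> f z) at_top" by simp
    qed
    show "?h t \<in> borel_measurable lborel" for t
      using borel_measurable_continuous_onI[OF c] by simp
  qed (use f_int in auto)
  moreover have "\<forall>\<^sub>F t in at_top. (\<integral>z. ?h t z \<partial>lborel) = scaled_total t"
    using eventually_gt_at_top[of 0] by eventually_elim (use eq in auto)
  ultimately have "(scaled_total \<longlongrightarrow> (\<integral>z. f z \<partial>lborel)) at_top" by (rule Lim_transform_eventually)
  then show ?thesis by (simp add: total_def)
qed

text \<open>The derivative of \<open>taylor_avg 2 u m\<close> at the origin is
  \<open>- pot_coeff * scaled_total t / t\<close>, and \<open>scaled_total t\<close> is eventually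
  below \<open>total + \<epsilon>\<close>; passing to the plain average costs a bounded
  amount.\<close>

lemma lap_avg_origin_ge:
  assumes "\<epsilon> > 0"
  obtains A T where "T > 0" "\<And>t. t \<ge> T \<Longrightarrow> lap_avg 2 u 0 0 t \<ge> A - pot_coeff * (total + \<epsilon>) * ln t"
proof -
  obtain n where n: "m = Suc n" using m2 by (cases m) auto
  have "\<forall>\<^sub>F t in at_top. scaled_total t < total + \<epsilon>"
    using scaled_total_tendsto assms by (intro order_tendstoD(2)) auto
  then obtain T0 where T0: "\<And>t. t \<ge> T0 \<Longrightarrow> scaled_total t < total + \<epsilon>"
    unfolding eventually_at_top_linorder by blast
  define T where "T = max T0 1"
  let ?M = "taylor_avg 2 u m 0"
  let ?c = "pot_coeff * (total + \<epsilon>)"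
  have inc: "?M T + ?c * ln T \<le> ?M t + ?c * ln t" if "t \<ge> T" for t
  proof (rule DERIV_nonneg_imp_nondecreasing[OF that])
    fix r assume "T \<le> r" "r \<le> t"
    then have r: "r > 0" "r \<ge> T0" by (auto simp: T_def)
    have "r ^ n / fact n * lap_avg 2 u (Suc n) 0 r = pot_coeff * (scaled_total r / r)"
    proof -
      have "m - 1 = n" by (simp add: n)
      then have pc: "pot_coeff = avg_coeff 2 m / fact n" unfolding pot_coeff_def by (simp only:)
      have "r ^ m / r = r ^ n" using r by (simp add: n)
      then have st: "scaled_total r / r = r ^ n * bump_avg (2 + m) f 0 r"
        by (simp only: scaled_total_def flip: times_divide_eq_left)
      show ?thesis unfolding st pc n[symmetric] lap_avg_def eq by simp
    qed
    then have "(?M has_real_derivative - (pot_coeff * (scaled_total r / r))) (at r)"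
      using DERIV_taylor_avg[of 2 u r n 0] smooth_u r by (simp add: n)
    then have "((\<lambda>t. ?M t + ?c * ln t) has_real_derivative
        - (pot_coeff * (scaled_total r / r)) + ?c * inverse r) (at r)"
      by (intro DERIV_add DERIV_cmult DERIV_ln r)
    moreover have "- (pot_coeff * (scaled_total r / r)) + ?c * inverse r \<ge> 0"
    proof -
      have "pot_coeff * (scaled_total r / r) \<le> pot_coeff * ((total + \<epsilon>) / r)"
        using T0[OF r(2)] r pot_coeff_pos by (intro mult_left_mono divide_right_mono) auto
      then show ?thesis by (simp add: divide_inverse mult.assoc)
    qed
    ultimately show "\<exists>y. ((\<lambda>t. ?M t + ?c * ln t) has_real_derivative y) (at r) \<and> 0 \<le> y" by blast
  qed
  have T: "T > 0" by (simp add: T_def)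
  have "lap_avg 2 u 0 0 t \<ge> (?M T + ?c * ln T - real m * decay_const 2) - ?c * ln t" if "t \<ge> T" for t
    using inc[OF that] taylor_avg_close[of 2 t 0] T that by (simp add: abs_le_iff)
  then show ?thesis using T that by blast
qed

end

section \<open>Lower bound for the total from the cone\<close>

context curvature
begin

text \<open>On balls of radius \<open>\<delta> k\<close> around \<open>k e\<close> the lower bound
  for \<open>K\<close> controls \<open>exp (n u)\<close> by \<open>\<bar>f\<bar>\<close>, and a
  tangent inequality for \<open>exp\<close> at a suitable level turns this into an upper bound for
  the average of \<open>u\<close>.\<close>

lemma cone_average_le:
  assumes R\<^sub>1: "R\<^sub>1 > 0" and \<theta>: "0 < \<theta>" "\<theta> \<le> pi" and c\<^sub>1: "c\<^sub>1 > 0" and e: "norm e = 1" and \<gamma>: "\<gamma> \<ge> 0"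
    and lower: "\<And>x. x \<in> solid_cone e \<theta> - ball 0 R\<^sub>1 \<Longrightarrow> \<bar>K x\<bar> \<ge> c\<^sub>1 * norm x powr \<gamma>"
  obtains \<delta> B where "\<delta> > 0" "\<And>k. k \<ge> max 1 (2 * R\<^sub>1) \<Longrightarrow>
     real DIM('a) * lap_avg 2 u 0 (k *\<^sub>R e) ((\<delta> * k)\<^sup>2) \<le> B - bump_mass * (real DIM('a) + \<gamma>) * ln k"
proof -
  \<comment> \<open>The ball stays in the cone if
    \<open>(1 + \<delta>) cos \<theta> \<le> 1 - \<delta>\<close>. Dividing by 4 achieves this and
    also gives \<open>\<delta> \<le> 1/2\<close>, which keeps the ball at distance at least
    \<open>k / 2\<close> from the origin.\<close>
  define \<delta> where "\<delta> = (1 - cos \<theta>) / 4"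
  have "cos \<theta> < cos 0" using \<theta> by (intro cos_monotone_0_pi) auto
  then have cos: "cos \<theta> < 1" by simp
  then have \<delta>1: "\<delta> > 0" unfolding \<delta>_def by simp
  have "(1 - cos \<theta>) / 4 \<le> (1 - (- 1)) / 4"
    by (intro divide_right_mono diff_left_mono cos_ge_minus_one) simp
  then have \<delta>2: "\<delta> \<le> 1/2" by (simp add: \<delta>_def)
  note \<delta> = \<delta>1 \<delta>2
  define B where "B = (2 powr \<gamma> / c\<^sub>1) * (mass / \<delta> ^ DIM('a)) - bump_mass"
  have "real DIM('a) * lap_avg 2 u 0 (k *\<^sub>R e) ((\<delta> * k)\<^sup>2) \<le> B - bump_mass * (real DIM('a) + \<gamma>) * ln k"
    if k: "k \<ge> max 1 (2 * R\<^sub>1)" for k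
  proof -
    have k0: "k > 0" using k by simp
    have sq: "sqrt ((\<delta> * k)\<^sup>2) = \<delta> * k" using \<delta> k0 by simp
    \<comment> \<open>The level at which \<open>exp\<close> is replaced by its tangent. It makes
      \<open>exp (- a) = k powr (n + \<gamma>)\<close>: the factor \<open>k powr \<gamma>\<close>
      cancels the growth of \<open>K\<close>, the factor \<open>k ^ n\<close> the volume
      scaling.\<close>
    define a where "a = - (real DIM('a) + \<gamma>) * ln k"
    define z where "z y = k *\<^sub>R e + (\<delta> * k) *\<^sub>R y" for y :: 'a
    define L where "L = k powr (real DIM('a) + \<gamma>) / (c\<^sub>1 * (k / 2) powr \<gamma>)"
    have L0: "L \<ge> 0" using c\<^sub>1 by (simp add: L_def)
    have ea: "exp (- a) = k powr (real DIM('a) + \<gamma>)" using k0 by (simp add: a_def powr_def algebra_simps)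
    have zlow: "norm (z y) \<ge> k / 2" "z y \<in> solid_cone e \<theta>" if y: "norm y < 1" for y
    proof -
      have dy: "\<delta> * norm y \<le> \<delta>" using y \<delta> by (simp add: mult_left_le)
      have "z y \<bullet> e = k * (1 + \<delta> * (y \<bullet> e))"
        using e by (simp add: z_def inner_add_left dot_square_norm algebra_simps)
      moreover have "\<delta> * (y \<bullet> e) \<ge> - \<delta>"
      proof -
        have "\<bar>y \<bullet> e\<bar> \<le> norm y" using Cauchy_Schwarz_ineq2[of y e] e by simp
        then have "y \<bullet> e \<ge> - 1" using y by linarith
        then have "\<delta> * (y \<bullet> e) \<ge> \<delta> * (- 1)" using \<delta> by (intro mult_left_mono) auto
        then show ?thesis by simp
      qed
      ultimately have ze: "z y \<bullet> e \<ge> k * (1 - \<delta>)"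
        using k0 by (simp add: mult_left_mono)
      have n_le: "norm (z y) \<le> k * (1 + \<delta>)"
      proof -
        have "norm (z y) \<le> norm (k *\<^sub>R e) + norm ((\<delta> * k) *\<^sub>R y)" unfolding z_def by (rule norm_triangle_ineq)
        also have "\<dots> = k * (1 + \<delta> * norm y)" using e k0 \<delta> by (simp add: algebra_simps)
        also have "\<dots> \<le> k * (1 + \<delta>)" using dy k0 by (intro mult_left_mono) auto
        finally show ?thesis .
      qed
      have "z y \<bullet> e \<le> norm (z y)" using norm_cauchy_schwarz[of "z y" e] e by simp
      moreover have "k * (1 - \<delta>) \<ge> k * (1 / 2)" using k0 \<delta> by (intro mult_left_mono) auto
      ultimately show "norm (z y) \<ge> k / 2" using ze by simp
      have "norm (z y) * cos \<theta> \<le> k * (1 - \<delta>)"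
      proof (cases "cos \<theta> \<ge> 0")
        case True
        then have "norm (z y) * cos \<theta> \<le> k * (1 + \<delta>) * cos \<theta>" by (intro mult_right_mono n_le)
        also have "\<dots> = k * ((1 + \<delta>) * cos \<theta>)" by simp
        also have "\<dots> \<le> k * (1 - \<delta>)"
        proof (rule mult_left_mono)
          have "\<delta> * cos \<theta> \<le> \<delta>" using \<delta> cos by (simp add: mult_left_le)
          then show "(1 + \<delta>) * cos \<theta> \<le> 1 - \<delta>" using cos by (simp add: algebra_simps) (simp add: \<delta>_def field_simps)
        qed (use k0 in simp)
        finally show ?thesis .
      next
        case False
        then have "norm (z y) * cos \<theta> \<le> 0" by (simp add: mult_nonneg_nonpos)
        also have "0 \<le> k * (1 - \<delta>)" using k0 \<delta> by simp
        finally show ?thesis .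
      qed
      then show "z y \<in> solid_cone e \<theta>" using ze by (simp add: solid_cone_def)
    qed
    text \<open>Jensen's inequality, through \<open>1 + s \<le> exp s\<close>.\<close>
    have pt: "bump 2 y * (real DIM('a) * u (z y)) \<le> (a - 1) * bump 2 y + L * (bump 2 y * \<bar>f (z y)\<bar>)" for y
    proof (cases "norm y < 1")
      case False
      then have "bump 2 y = 0" by (intro bump_zero_outside) auto
      then show ?thesis by simp
    next
      case True
      have zl: "norm (z y) \<ge> k / 2" "z y \<in> solid_cone e \<theta>" by (rule zlow[OF True])+
      have "z y \<notin> ball 0 R\<^sub>1" using zl(1) k by simp
      then have "\<bar>K (z y)\<bar> \<ge> c\<^sub>1 * norm (z y) powr \<gamma>" using lower zl(2) by blast
      moreover have "c\<^sub>1 * norm (z y) powr \<gamma> \<ge> c\<^sub>1 * (k / 2) powr \<gamma>"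
        using zl(1) c\<^sub>1 k0 \<gamma> by (intro mult_left_mono powr_mono2) auto
      ultimately have "c\<^sub>1 * (k / 2) powr \<gamma> * exp (real DIM('a) * u (z y)) \<le> \<bar>f (z y)\<bar>"
        unfolding f_eq abs_mult by (intro mult_mono) auto
      then have E: "exp (real DIM('a) * u (z y)) \<le> \<bar>f (z y)\<bar> / (c\<^sub>1 * (k / 2) powr \<gamma>)"
        using c\<^sub>1 k0 by (simp add: field_simps)
      have "1 + (real DIM('a) * u (z y) - a) \<le> exp (real DIM('a) * u (z y) - a)" by (rule exp_ge_add_one_self)
      also have "\<dots> = exp (- a) * exp (real DIM('a) * u (z y))" by (simp add: exp_diff exp_minus field_simps)
      also have "\<dots> \<le> exp (- a) * (\<bar>f (z y)\<bar> / (c\<^sub>1 * (k / 2) powr \<gamma>))" by (rule mult_left_mono[OF E]) simp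
      also have "\<dots> = L * \<bar>f (z y)\<bar>" by (simp add: L_def ea)
      finally have "real DIM('a) * u (z y) \<le> (a - 1) + L * \<bar>f (z y)\<bar>" by simp
      from mult_left_mono[OF this bump_nonneg[of 2 y]] show ?thesis by (simp add: algebra_simps)
    qed
    have cu: "continuous_on UNIV u" and cf: "continuous_on UNIV f"
      by (rule smooth_fun_continuous[OF smooth_u], rule smooth_fun_continuous[OF smooth_f])
    have i1: "integrable lborel (\<lambda>y. bump 2 y * (real DIM('a) * u (z y)))"
      and i2: "integrable lborel (\<lambda>y. bump 2 y * \<bar>f (z y)\<bar>)"
      unfolding z_def by (intro integrable_bump_mult continuous_intros continuous_on_affine_compose cu cf; simp)+
    have i3: "integrable lborel (bump 2 :: 'a \<Rightarrow> real)" by (rule integrable_bump) simp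
    have "real DIM('a) * lap_avg 2 u 0 (k *\<^sub>R e) ((\<delta> * k)\<^sup>2) = (\<integral>y. bump 2 y * (real DIM('a) * u (z y)) \<partial>lborel)"
      unfolding lap_avg_def bump_avg_def sq z_def
      by (simp add: avg_coeff_def mult.left_commute)
    also have "\<dots> \<le> (\<integral>y. (a - 1) * bump 2 y + L * (bump 2 y * \<bar>f (z y)\<bar>) \<partial>lborel)"
      by (rule integral_mono[OF i1 _ pt]) (intro Bochner_Integration.integrable_add integrable_mult_right i2 i3)
    also have "\<dots> = (a - 1) * bump_mass + L * (\<integral>y. bump 2 y * \<bar>f (z y)\<bar> \<partial>lborel)"
      using i2 i3 by (simp add: bump_mass_def)
    also have "\<dots> \<le> (a - 1) * bump_mass + L * (mass / (\<delta> * k) ^ DIM('a))"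
    proof -
      have "\<bar>\<integral>y. bump 2 y * \<bar>f (k *\<^sub>R e + sqrt ((\<delta> * k)\<^sup>2) *\<^sub>R y)\<bar> \<partial>lborel\<bar> \<le> (\<integral>z. \<bar>\<bar>f z\<bar>\<bar> \<partial>lborel) / sqrt ((\<delta> * k)\<^sup>2) ^ DIM('a)"
        by (rule integral_affine_le[where f="\<lambda>z. \<bar>f z\<bar>"]) (use f_int \<delta> k0 in \<open>auto simp: bump_le_one\<close>)
      then have "(\<integral>y. bump 2 y * \<bar>f (z y)\<bar> \<partial>lborel) \<le> mass / (\<delta> * k) ^ DIM('a)"
        unfolding sq by (simp add: z_def mass_def)
      then show ?thesis using L0 by (intro add_left_mono mult_left_mono)
    qed
    \<comment> \<open>Here \<open>k\<close> disappears, so that the remainder \<open>B\<close> is a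
      constant.\<close>
    also have "L * (mass / (\<delta> * k) ^ DIM('a)) = (2 powr \<gamma> / c\<^sub>1) * (mass / \<delta> ^ DIM('a))"
    proof -
      have "L = (2 powr \<gamma> / c\<^sub>1) * k ^ DIM('a)"
        using k0 c\<^sub>1 by (simp add: L_def powr_add powr_realpow powr_divide)
      then show ?thesis using k0 \<delta> by (simp add: power_mult_distrib)
    qed
    finally show ?thesis by (simp add: B_def a_def algebra_simps)
  qed
  then show ?thesis using \<delta>(1) that by blast
qed

text \<open>The upper bound in the cone and the lower bound at the origin are compared at the
  squared radius \<open>(\<delta> k)^2\<close>. Their coefficients of \<open>ln k\<close> must be
  ordered, since all other terms stay bounded as \<open>k\<close> grows.\<close>

lemma total_ge:
  assumes R\<^sub>1: "R\<^sub>1 > 0" and \<theta>: "0 < \<theta>" "\<theta> \<le> pi" and c\<^sub>1: "c\<^sub>1 > 0" and e: "norm e = 1"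
    and \<gamma>: "\<gamma> \<ge> real DIM('a)"
    and lower: "\<And>x. x \<in> solid_cone e \<theta> - ball 0 R\<^sub>1 \<Longrightarrow> \<bar>K x\<bar> \<ge> c\<^sub>1 * norm x powr \<gamma>"
  shows "pot_coeff * total \<ge> bump_mass"
proof (rule field_le_epsilon)
  let ?n = "real DIM('a)"
  fix \<eta> :: real assume \<eta>: "\<eta> > 0"
  define \<epsilon> where "\<epsilon> = \<eta> / pot_coeff"
  have \<epsilon>: "\<epsilon> > 0" "pot_coeff * (total + \<epsilon>) = pot_coeff * total + \<eta>"
    using \<eta> pot_coeff_pos by (auto simp: \<epsilon>_def distrib_left)
  have "\<gamma> \<ge> 0" using \<gamma> by simp
  then obtain \<delta> B where \<delta>: "\<delta> > 0" and B: "\<And>k. k \<ge> max 1 (2 * R\<^sub>1) \<Longrightarrow>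
     ?n * lap_avg 2 u 0 (k *\<^sub>R e) ((\<delta> * k)\<^sup>2) \<le> B - bump_mass * (?n + \<gamma>) * ln k"
    using cone_average_le[OF R\<^sub>1 \<theta> c\<^sub>1 e _ lower] by blast
  obtain A T where T: "T > 0" and A: "\<And>t. t \<ge> T \<Longrightarrow> lap_avg 2 u 0 0 t \<ge> A - (pot_coeff * total + \<eta>) * ln t"
    by (rule lap_avg_origin_ge[OF \<epsilon>(1), unfolded \<epsilon>(2)]) blast
  define D where "D = ?n * (grad_decay_const / \<delta>)"
  \<comment> \<open>The coefficient of \<open>ln k\<close>; the factor 2 comes from
    \<open>ln\<close> of the squared radius.\<close>
  define q where "q = bump_mass * (?n + \<gamma>) - 2 * ?n * (pot_coeff * total + \<eta>)"
  define P where "P = B + ?n * D - ?n * A + 2 * ?n * (pot_coeff * total + \<eta>) * ln \<delta>"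
  have main: "q * ln k \<le> P" if k: "k \<ge> max (max 1 (2 * R\<^sub>1)) (sqrt T / \<delta>)" for k
  proof -
    have k1: "k \<ge> max 1 (2 * R\<^sub>1)" "sqrt T / \<delta> \<le> k" and k0: "k > 0" using k by auto
    have "sqrt T \<le> \<delta> * k" using k1(2) \<delta> by (simp add: field_simps)
    then have tT: "(\<delta> * k)\<^sup>2 \<ge> T"
      using T by (metis less_eq_real_def power_mono real_sqrt_ge_zero real_sqrt_pow2)
    have t0: "(\<delta> * k)\<^sup>2 > 0" using \<delta> k0 by simp
    have sq: "sqrt ((\<delta> * k)\<^sup>2) = \<delta> * k" using \<delta> k0 by simp
    have ln: "ln ((\<delta> * k)\<^sup>2) = 2 * ln \<delta> + 2 * ln k" using \<delta> k0 by (simp add: ln_realpow ln_mult)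
    have "\<bar>lap_avg 2 u 0 (k *\<^sub>R e) ((\<delta> * k)\<^sup>2) - lap_avg 2 u 0 0 ((\<delta> * k)\<^sup>2)\<bar> \<le> D"
      using lap_avg_center_diff[OF t0, of "k *\<^sub>R e"] e k0 unfolding sq D_def by simp
    then have "lap_avg 2 u 0 (k *\<^sub>R e) ((\<delta> * k)\<^sup>2) \<ge> A - (pot_coeff * total + \<eta>) * (2 * ln \<delta> + 2 * ln k) - D"
      using A[OF tT] unfolding ln by (simp add: abs_le_iff)
    then have "?n * (A - (pot_coeff * total + \<eta>) * (2 * ln \<delta> + 2 * ln k) - D) \<le> ?n * lap_avg 2 u 0 (k *\<^sub>R e) ((\<delta> * k)\<^sup>2)"
      by (intro mult_left_mono) auto
    then show ?thesis using B[OF k1(1)] by (simp add: q_def P_def algebra_simps)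
  qed
  have "q \<le> 0"
  proof (rule ccontr)
    assume "\<not> q \<le> 0"
    then have "filterlim (\<lambda>k. q * ln k) at_top at_top"
      by (intro filterlim_tendsto_pos_mult_at_top[OF tendsto_const _ ln_at_top]) auto
    then have "\<forall>\<^sub>F k in at_top. P < q * ln k" by (simp add: filterlim_at_top_dense)
    moreover have "\<forall>\<^sub>F k in at_top. q * ln k \<le> P"
      using eventually_ge_at_top[of "max (max 1 (2 * R\<^sub>1)) (sqrt T / \<delta>)"] by eventually_elim (rule main)
    ultimately have "\<forall>\<^sub>F k::real in at_top. False" by eventually_elim simp
    then show False by simp
  qed
  \<comment> \<open>Here \<open>\<gamma> \<ge> n\<close> enters, replacing
    \<open>n + \<gamma>\<close> by \<open>2 n\<close>.\<close>
  moreover have "bump_mass * (?n + ?n) \<le> bump_mass * (?n + \<gamma>)"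
    using \<gamma> bump_mass_pos by (intro mult_left_mono) auto
  ultimately have "(2 * ?n) * bump_mass \<le> (2 * ?n) * (pot_coeff * total + \<eta>)"
    by (simp add: q_def algebra_simps)
  then show "bump_mass \<le> pot_coeff * total + \<eta>" by simp
qed

text \<open>Otherwise \<open>K\<close> has the constant value \<open>K 0\<close> along the axis of
  the cone, contradicting its growth there. This supplies the point needed in
  \<open>total_less\<close>.\<close>

lemma nonconstant_along_ray:
  assumes R\<^sub>1: "R\<^sub>1 > 0" and \<theta>: "0 < \<theta>" "\<theta> \<le> pi" and c\<^sub>1: "c\<^sub>1 > 0" and e: "norm e = 1"
    and \<gamma>: "\<gamma> > 0"
    and lower: "\<And>x. x \<in> solid_cone e \<theta> - ball 0 R\<^sub>1 \<Longrightarrow> \<bar>K x\<bar> \<ge> c\<^sub>1 * norm x powr \<gamma>"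
  shows "\<exists>x. x \<bullet> gradient K x \<noteq> 0"
proof (rule ccontr)
  assume "\<not> ?thesis"
  then have z: "x \<bullet> gradient K x = 0" for x by blast
  have const: "K (s *\<^sub>R e) = K 0" if s: "s > 0" for s
  proof -
    have "(\<lambda>r. K (0 + r *\<^sub>R e)) s = (\<lambda>r. K (0 + r *\<^sub>R e)) 0"
    proof (rule DERIV_isconst_end[OF s, of "\<lambda>r. K (0 + r *\<^sub>R e)"])
      show "continuous_on {0..s} (\<lambda>r. K (0 + r *\<^sub>R e))"
        by (intro smooth_fun_continuous_compose[OF smooth_K] continuous_intros)
      fix r :: real assume r: "0 < r" "r < s"
      have "r * (e \<bullet> gradient K (r *\<^sub>R e)) = 0" using z[of "r *\<^sub>R e"] by simp
      then have "e \<bullet> gradient K (r *\<^sub>R e) = 0" using r by simp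
      then show "((\<lambda>r. K (0 + r *\<^sub>R e)) has_real_derivative 0) (at r)"
        using smooth_fun_DERIV_line[OF smooth_K, of 0 e r] by (simp add: inner_gradient)
    qed
    then show ?thesis by simp
  qed
  have low: "c\<^sub>1 * s powr \<gamma> \<le> \<bar>K 0\<bar>" if "s \<ge> R\<^sub>1" for s
  proof -
    have s: "s > 0" using that R\<^sub>1 by simp
    have "s *\<^sub>R e \<in> solid_cone e \<theta> - ball 0 R\<^sub>1"
      using that s e by (simp add: solid_cone_def dot_square_norm mult_left_le)
    from lower[OF this] show ?thesis using const[OF s] s e by simp
  qed
  have "filterlim (\<lambda>s. c\<^sub>1 * s powr \<gamma>) at_top at_top"
    by (intro filterlim_tendsto_pos_mult_at_top[OF tendsto_const c\<^sub>1] real_powr_at_top \<gamma>)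
  then have "\<forall>\<^sub>F s in at_top. \<bar>K 0\<bar> < c\<^sub>1 * s powr \<gamma>" by (simp add: filterlim_at_top_dense)
  moreover have "\<forall>\<^sub>F s in at_top. c\<^sub>1 * s powr \<gamma> \<le> \<bar>K 0\<bar>"
    using eventually_ge_at_top[of R\<^sub>1] by eventually_elim (rule low)
  ultimately have "\<forall>\<^sub>F s::real in at_top. False" by eventually_elim simp
  then show False by simp
qed

text \<open>With \<open>c = pot_coeff / bump_mass\<close>, the cone gives
  \<open>c * total \<ge> 1\<close>, in particular \<open>total > 0\<close>, while the dilation
  identity gives \<open>total > c * total^2\<close>.\<close>

lemma not_PCC: "\<not> PCC K"
proof
  assume "PCC K"
  then obtain R\<^sub>1 \<theta> \<gamma> c\<^sub>1 and e :: 'a where *: "R\<^sub>1 > 0" "0 < \<theta>" "\<theta> \<le> pi" "c\<^sub>1 > 0" "norm e = 1" "\<gamma> \<ge> real DIM('a)"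
    "\<And>x. x \<in> solid_cone e \<theta> - ball 0 R\<^sub>1 \<Longrightarrow> \<bar>K x\<bar> \<ge> c\<^sub>1 * norm x powr \<gamma>"
    unfolding PCC_def by blast
  have ge: "pot_coeff * total \<ge> bump_mass" by (rule total_ge[OF *])
  have "\<gamma> > 0" using *(6) DIM_positive[where 'a='a] by linarith
  from nonconstant_along_ray[OF *(1-5) this *(7)]
  obtain x0 where "x0 \<bullet> gradient K x0 \<noteq> 0" by blast
  then have less: "total - pot_coeff * total\<^sup>2 / bump_mass > 0" by (rule total_less)
  have "pot_coeff * total > 0" using ge bump_mass_pos by linarith
  then have "total > 0" using pot_coeff_pos by (simp add: zero_less_mult_iff)
  then have "total * bump_mass \<le> total * (pot_coeff * total)" by (intro mult_left_mono ge) simp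
  then show False using less bump_mass_pos by (simp add: field_simps power2_eq_square)
qed

end

theorem theorem1p4:
  fixes K :: "real ^ 'n \<Rightarrow> real" and n :: nat
  assumes n_def: "n = CARD('n)"
    and n_ge: "n \<ge> 4"
    and n_even: "even n"
    and K_smooth: "smooth_fun K"
    and K_pcc: "PCC K"
    and K_radial: "\<And>x. x \<bullet> gradient K x \<le> 0"
  shows "\<not> (\<exists>u :: real ^ 'n \<Rightarrow> real.
            smooth_fun u
          \<and> (\<forall>x. (neg_laplacian ^^ (n div 2)) u x = K x * exp (real n * u x))
          \<and> (\<exists>C. \<forall>x. u x \<le> C)
          \<and> (laplacian u \<longlongrightarrow> 0) at_infinity
          \<and> integrable lborel (\<lambda>x. \<bar>K x\<bar> * exp (real n * u x)))"
proof
  assume "\<exists>u :: real ^ 'n \<Rightarrow> real.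
            smooth_fun u
          \<and> (\<forall>x. (neg_laplacian ^^ (n div 2)) u x = K x * exp (real n * u x))
          \<and> (\<exists>C. \<forall>x. u x \<le> C)
          \<and> (laplacian u \<longlongrightarrow> 0) at_infinity
          \<and> integrable lborel (\<lambda>x. \<bar>K x\<bar> * exp (real n * u x))"
  then obtain u :: "real ^ 'n \<Rightarrow> real" and C where u: "smooth_fun u"
    "\<And>x. (neg_laplacian ^^ (n div 2)) u x = K x * exp (real n * u x)" "\<And>x. u x \<le> C"
    "(laplacian u \<longlongrightarrow> 0) at_infinity" "integrable lborel (\<lambda>x. \<bar>K x\<bar> * exp (real n * u x))"
    by blast
  have dim: "DIM(real ^ 'n) = n" by (simp add: n_def)
  \<comment> \<open>The locale asks for integrability of the signed density; the hypothesis is about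
    its absolute value.\<close>
  have f_int: "integrable lborel (\<lambda>x. K x * exp (real n * u x))"
  proof (rule Bochner_Integration.integrable_bound[OF u(5)])
    have "continuous_on UNIV (\<lambda>x. K x * exp (real n * u x))"
      by (intro continuous_intros smooth_fun_continuous K_smooth u(1))
    then show "(\<lambda>x. K x * exp (real n * u x)) \<in> borel_measurable lborel"
      by (simp add: borel_measurable_continuous_onI)
  qed (simp add: abs_mult)
  interpret curvature u "\<lambda>x. K x * exp (real n * u x)" "n div 2" C K
  proof
    show "DIM(real ^ 'n) = 2 * (n div 2)" using dim n_even by simp
    show "n div 2 \<ge> 2" using n_ge by simp
    show "K x * exp (real n * u x) = K x * exp (real DIM(real ^ 'n) * u x)" for x by (simp add: n_def)
  qed (use u K_smooth K_radial f_int in \<open>auto simp: fun_eq_iff\<close>)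
  show False using not_PCC K_pcc by contradiction
qed

end
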